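(* Let $k\ge 1$ be an integer, $\lambda>0$, $d\in(\frac12-\frac1{2k},\infty)$, and $H=1+kd-\frac k2$. Let $\{\varepsilon_n\}_{n\in\mathbb Z}$ be an i.i.d. sequence of real random variables with mean $0$ and variance $1$. For $\mu>0$ and $n\in\mathbb Z$ let $$Y^{\mu,k}(n)=\sum_{(i_1,\ldots,i_k)\in\mathbb Z^k}^{'}\ \prod_{j=1}^k (i_j)_+^{d-1}e^{-\mu (i_j)_+}\ \varepsilon_{n-i_1}\cdots\varepsilon_{n-i_k},$$ where the prime means that the sum excludes the diagonals $i_p=i_q$, $p\ne q$, and let $$S^{\mu}_N(t)=\sum_{n=1}^{[Nt]}Y^{\mu,k}(n),\qquad 0\le t\le 1.$$ Then, as $N\to\infty$, $$\frac1{N^H}S_N^{\lambda/N}(t)\Rightarrow Z^k_{H,\lambda}(t),$$ where $\Rightarrow$ denotes weak convergence in the Skorokhod space $D[0,1]$ with the uniform metric, and $Z^k_{H,\lambda}$ is the tempered Hermite process of order $k$.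
   Context: Let $B=\{B(t),t\in\mathbb R\}$ be a two-sided real Brownian motion: a process with stationary independent increments with $B(t)$ Gaussian of mean zero and variance $|t|$. For $f\in L^2(\mathbb R^k)$, $\int_{\mathbb R^k}^{'}f(x_1,\ldots,x_k)B(dx_1)\cdots B(dx_k)$ denotes the $k$-fold multiple Wiener--Itô integral (the prime means that one does not integrate over the diagonals $x_i=x_j$, $i\neq j$). Conventions: $(x)_+=x\,I(x>0)$, and $(x)_+^{d-1}$ means $x^{d-1}$ if $x>0$ and $0$ if $x\le0$. $[x]$ denotes the integer part. For $H>\frac12$ and $\lambda>0$, the tempered Hermite process of order $k$ is $$Z^k_{H,\lambda}(t)=\int_{\mathbb R^k}^{'}\int_0^t\prod_{i=1}^k\left((s-y_i)_+^{d-1}e^{-\lambda(s-y_i)_+}\right)ds\,B(dy_1)\cdots B(dy_k),\qquad d=\frac12-\frac{1-H}{k}.$$ It has a version with continuous paths, which is the one used for the weak convergence statement. The relation $H=1+kd-\frac k2$ is the same as $d=\frac12-\frac{1-H}{k}$, and $d>\frac12-\frac1{2k}$ is equivalent to $H>\frac12$. *)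

theory Defs
  imports "HOL-Probability.Probability"
begin

section \<open>Weak convergence in the Skorokhod space with the uniform metric\<close>

text \<open>A path on \<open>[0,1]\<close> is represented by a real function that is \<^const>\<open>undefined\<close>
  outside \<open>[0,1]\<close>, so that equality of paths is equality of functions.\<close>

definition cadlag01 :: "(real \<Rightarrow> real) set" where
  "cadlag01 = {x \<in> extensional {0..1}.
     (\<forall>t\<in>{0..<1}. (x \<longlongrightarrow> x t) (at_right t)) \<and>
     (\<forall>t\<in>{0<..1}. \<exists>l. (x \<longlongrightarrow> l) (at_left t))}"

text \<open>The value \<open>0\<close> off \<^const>\<open>cadlag01\<close> is only there because the library's locale of
  metric spaces asks for nonnegativity and symmetry on the whole type.\<close>

definition unif_dist01 :: "(real \<Rightarrow> real) \<Rightarrow> (real \<Rightarrow> real) \<Rightarrow> real" where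
  "unif_dist01 x y =
     (if x \<in> cadlag01 \<and> y \<in> cadlag01 then (SUP t\<in>{0..1}. \<bar>x t - y t\<bar>) else 0)"

lemma cadlag01_locally_bounded:
  assumes "x \<in> cadlag01" "t \<in> {0..1}"
  shows "\<exists>e>0. \<exists>C. \<forall>s\<in>{0..1}. \<bar>s - t\<bar> < e \<longrightarrow> \<bar>x s\<bar> \<le> C"
proof -
  have bnd: "eventually (\<lambda>s. \<bar>x s\<bar> \<le> \<bar>l\<bar> + 1) F" if "(x \<longlongrightarrow> l) F" for l :: real and F
    using tendstoD[OF that zero_less_one]
    by (rule eventually_mono) (auto simp: dist_real_def)
  have R: "\<exists>C e. e > 0 \<and> (\<forall>s\<in>{0..1}. t < s \<and> s < t + e \<longrightarrow> \<bar>x s\<bar> \<le> C)"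
  proof (cases "t < 1")
    case True
    then have "(x \<longlongrightarrow> x t) (at_right t)" using assms by (auto simp: cadlag01_def)
    then obtain b where "b > t" "\<And>s. t < s \<Longrightarrow> s < b \<Longrightarrow> \<bar>x s\<bar> \<le> \<bar>x t\<bar> + 1"
      using bnd[of "x t" "at_right t"] unfolding eventually_at_right_field by blast
    then show ?thesis by (intro exI[of _ "\<bar>x t\<bar> + 1"] exI[of _ "b - t"]) auto
  next
    case False
    then show ?thesis using assms by (intro exI[of _ 0] exI[of _ 1]) auto
  qed
  have L: "\<exists>C e. e > 0 \<and> (\<forall>s\<in>{0..1}. t - e < s \<and> s < t \<longrightarrow> \<bar>x s\<bar> \<le> C)"
  proof (cases "0 < t")
    case True
    then obtain l where "(x \<longlongrightarrow> l) (at_left t)" using assms by (fastforce simp: cadlag01_def)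
    then obtain b where "b < t" "\<And>s. b < s \<Longrightarrow> s < t \<Longrightarrow> \<bar>x s\<bar> \<le> \<bar>l\<bar> + 1"
      using bnd[of l "at_left t"] unfolding eventually_at_left_field by blast
    then show ?thesis by (intro exI[of _ "\<bar>l\<bar> + 1"] exI[of _ "t - b"]) auto
  next
    case False
    then show ?thesis using assms by (intro exI[of _ 0] exI[of _ 1]) auto
  qed
  obtain C1 e1 where 1: "e1 > 0" "\<And>s. s\<in>{0..1} \<Longrightarrow> t < s \<Longrightarrow> s < t + e1 \<Longrightarrow> \<bar>x s\<bar> \<le> C1"
    using R by blast
  obtain C2 e2 where 2: "e2 > 0" "\<And>s. s\<in>{0..1} \<Longrightarrow> t - e2 < s \<Longrightarrow> s < t \<Longrightarrow> \<bar>x s\<bar> \<le> C2"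
    using L by blast
  have "\<bar>x s\<bar> \<le> max \<bar>x t\<bar> (max C1 C2)" if s: "s \<in> {0..1}" "\<bar>s - t\<bar> < min e1 e2" for s
  proof -
    consider "s < t" | "s = t" | "t < s" by linarith
    then show ?thesis
      using 1(2)[OF s(1)] 2(2)[OF s(1)] s(2) by cases auto
  qed
  moreover have "min e1 e2 > 0" using 1(1) 2(1) by simp
  ultimately show ?thesis by blast
qed

lemma cadlag01_bounded:
  assumes "x \<in> cadlag01"
  shows "\<exists>C. \<forall>t\<in>{0..1}. \<bar>x t\<bar> \<le> C"
proof -
  obtain e C where eC: "\<And>t. t \<in> {0..1} \<Longrightarrow> e t > 0"
      "\<And>t s. t \<in> {0..1} \<Longrightarrow> s \<in> {0..1} \<Longrightarrow> \<bar>s - t\<bar> < e t \<Longrightarrow> \<bar>x s\<bar> \<le> C t"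
    using cadlag01_locally_bounded[OF assms] by metis
  have "{0..1::real} \<subseteq> (\<Union>t\<in>{0..1}. ball t (e t))" using eC(1) by force
  then obtain T where T: "T \<subseteq> {0..1}" "finite T" "{0..1::real} \<subseteq> (\<Union>t\<in>T. ball t (e t))"
    using compactE_image[of "{0..1::real}" "{0..1}" "\<lambda>t. ball t (e t)"] by auto
  have "\<bar>x s\<bar> \<le> (\<Sum>t\<in>T. \<bar>C t\<bar>)" if s: "s \<in> {0..1}" for s
  proof -
    obtain t where t: "t \<in> T" "\<bar>s - t\<bar> < e t"
      using T(3) s by (force simp: dist_real_def abs_minus_commute)
    have "\<bar>x s\<bar> \<le> \<bar>C t\<bar>" using eC(2)[of t s] t T(1) s by fastforce
    also have "\<dots> \<le> (\<Sum>t\<in>T. \<bar>C t\<bar>)" using member_le_sum[of t T "\<lambda>t. \<bar>C t\<bar>"] t T(2) by auto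
    finally show ?thesis .
  qed
  then show ?thesis by blast
qed

lemma cadlag01_bdd_above:
  assumes "x \<in> cadlag01" "y \<in> cadlag01"
  shows "bdd_above ((\<lambda>t. \<bar>x t - y t\<bar>) ` {0..1})"
proof -
  obtain C D where "\<forall>t\<in>{0..1}. \<bar>x t\<bar> \<le> C" "\<forall>t\<in>{0..1}. \<bar>y t\<bar> \<le> D"
    using assms[THEN cadlag01_bounded] by blast
  then show ?thesis by (intro bdd_aboveI2[of _ _ "C + D"]) fastforce
qed

lemma Metric_space_cadlag01: "Metric_space cadlag01 unif_dist01"
proof
  fix x y :: "real \<Rightarrow> real"
  show "0 \<le> unif_dist01 x y"
  proof (cases "x \<in> cadlag01 \<and> y \<in> cadlag01")
    case True
    then have "\<bar>x 0 - y 0\<bar> \<le> unif_dist01 x y"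
      using cSUP_upper[of 0 "{0..1}", OF _ cadlag01_bdd_above[of x y]]
      by (simp add: unif_dist01_def)
    then show ?thesis by linarith
  qed (auto simp: unif_dist01_def)
  show "unif_dist01 x y = unif_dist01 y x"
    by (simp add: unif_dist01_def abs_minus_commute)
next
  fix x y assume xy: "x \<in> cadlag01" "y \<in> cadlag01"
  show "unif_dist01 x y = 0 \<longleftrightarrow> x = y"
  proof
    assume 0: "unif_dist01 x y = 0"
    have "\<bar>x t - y t\<bar> \<le> 0" if "t \<in> {0..1}" for t
      using cSUP_upper[OF that cadlag01_bdd_above[OF xy]] 0 xy by (simp add: unif_dist01_def)
    then show "x = y"
      using xy by (intro extensionalityI[of x "{0..1}"]) (auto simp: cadlag01_def)
  qed (use xy in \<open>auto simp: unif_dist01_def\<close>)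
next
  fix x y z assume xyz: "x \<in> cadlag01" "y \<in> cadlag01" "z \<in> cadlag01"
  have "(SUP t\<in>{0..1}. \<bar>x t - z t\<bar>) \<le> unif_dist01 x y + unif_dist01 y z"
  proof (rule cSUP_least)
    fix t :: real assume t: "t \<in> {0..1}"
    show "\<bar>x t - z t\<bar> \<le> unif_dist01 x y + unif_dist01 y z"
      using cSUP_upper[OF t cadlag01_bdd_above[OF xyz(1,2)]]
        cSUP_upper[OF t cadlag01_bdd_above[OF xyz(2,3)]] xyz
      by (simp add: unif_dist01_def)
  qed auto
  then show "unif_dist01 x z \<le> unif_dist01 x y + unif_dist01 y z"
    using xyz by (simp add: unif_dist01_def)
qed

definition skorokhod01 :: "(real \<Rightarrow> real) topology" where
  "skorokhod01 = Metric_space.mtopology cadlag01 unif_dist01"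

lemma topspace_skorokhod01: "topspace skorokhod01 = cadlag01"
  unfolding skorokhod01_def by (rule Metric_space.topspace_mtopology[OF Metric_space_cadlag01])

definition borel_of_topology :: "'x topology \<Rightarrow> 'x measure" where
  "borel_of_topology T = sigma (topspace T) {U. openin T U}"

text \<open>Weak convergence of the laws of the random elements \<open>X N\<close> to the law of \<open>Z\<close>. Being a
  random element, i.e. Borel measurable for the given topology, is part of the notion; for the
  uniform metric this is a genuine requirement, since that space is not separable.\<close>

definition weakly_converges_to ::
  "'x topology \<Rightarrow> 'a measure \<Rightarrow> (nat \<Rightarrow> 'a \<Rightarrow> 'x) \<Rightarrow> 'b measure \<Rightarrow> ('b \<Rightarrow> 'x) \<Rightarrow> bool" where
  "weakly_converges_to T M X M' Z \<longleftrightarrow>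
     (\<forall>N. X N \<in> M \<rightarrow>\<^sub>M borel_of_topology T) \<and>
     Z \<in> M' \<rightarrow>\<^sub>M borel_of_topology T \<and>
     (\<forall>f. continuous_map T (euclidean :: real topology) f \<and> bounded (f ` topspace T) \<longrightarrow>
        (\<lambda>N. \<integral>\<omega>. f (X N \<omega>) \<partial>M) \<longlonglongrightarrow> (\<integral>\<omega>. f (Z \<omega>) \<partial>M'))"


section \<open>The noise and the Brownian motion\<close>

definition (in prob_space) iid_standardized :: "(int \<Rightarrow> 'a \<Rightarrow> real) \<Rightarrow> bool" where
  "iid_standardized \<epsilon> \<longleftrightarrow>
     indep_vars (\<lambda>_. borel) \<epsilon> UNIV \<and>
     (\<forall>m n. distr M borel (\<epsilon> m) = distr M borel (\<epsilon> n)) \<and>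
     (\<forall>n. integrable M (\<lambda>\<omega>. (\<epsilon> n \<omega>)\<^sup>2) \<and> expectation (\<epsilon> n) = 0 \<and> variance (\<epsilon> n) = 1)"

text \<open>The case \<open>t = 0\<close> is separate because the degenerate Gaussian law has no density.\<close>

definition (in prob_space) two_sided_brownian_motion :: "(real \<Rightarrow> 'a \<Rightarrow> real) \<Rightarrow> bool" where
  "two_sided_brownian_motion B \<longleftrightarrow>
     (\<forall>t. random_variable borel (B t)) \<and>
     (\<forall>s t h. distr M borel (\<lambda>\<omega>. B (t + h) \<omega> - B (s + h) \<omega>)
            = distr M borel (\<lambda>\<omega>. B t \<omega> - B s \<omega>)) \<and>
     (\<forall>m p. strict_mono_on {..m} p \<longrightarrow>
        indep_vars (\<lambda>_. borel) (\<lambda>i \<omega>. B (p (Suc i)) \<omega> - B (p i) \<omega>) {..<m}) \<and>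
     (AE \<omega> in M. B 0 \<omega> = 0) \<and>
     (\<forall>t. t \<noteq> 0 \<longrightarrow> distributed M lborel (B t) (normal_density 0 (sqrt \<bar>t\<bar>)))"


section \<open>Multiple Wiener--Ito integrals\<close>

text \<open>A \<open>k\<close>-tuple over \<open>A\<close> is a function in \<open>{..<k} \<rightarrow>\<^sub>E A\<close>; it is off the diagonals if it is
  injective.\<close>

definition off_diagonal :: "nat \<Rightarrow> 'x set \<Rightarrow> (nat \<Rightarrow> 'x) set" where
  "off_diagonal k A = {i \<in> {..<k} \<rightarrow>\<^sub>E A. inj_on i {..<k}}"

text \<open>Lebesgue measure on the \<open>k\<close>-dimensional Euclidean space.\<close>

definition lebesgue_pow :: "nat \<Rightarrow> (nat \<Rightarrow> real) measure" where
  "lebesgue_pow k = (\<Pi>\<^sub>M i\<in>{..<k}. lborel)"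

definition square_integrable :: "'a measure \<Rightarrow> ('a \<Rightarrow> real) \<Rightarrow> bool" where
  "square_integrable M f \<longleftrightarrow> f \<in> borel_measurable M \<and> integrable M (\<lambda>x. (f x)\<^sup>2)"

definition L2_tendsto :: "'a measure \<Rightarrow> (nat \<Rightarrow> 'a \<Rightarrow> real) \<Rightarrow> ('a \<Rightarrow> real) \<Rightarrow> bool" where
  "L2_tendsto M F f \<longleftrightarrow> (\<lambda>n. \<integral>\<^sup>+x. ennreal ((F n x - f x)\<^sup>2) \<partial>M) \<longlonglongrightarrow> 0"

text \<open>The step function taking the value \<open>c j\<close> on the box with sides
  \<open>(p (j i), p (j i + 1)]\<close> for \<open>i < k\<close>, where \<open>p 0 < \<dots> < p m\<close>, and vanishing on all boxes of
  the grid that meet a diagonal; and its integral with respect to \<open>B\<close>.\<close>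

definition step_fun ::
  "nat \<Rightarrow> nat \<Rightarrow> (nat \<Rightarrow> real) \<Rightarrow> ((nat \<Rightarrow> nat) \<Rightarrow> real) \<Rightarrow> (nat \<Rightarrow> real) \<Rightarrow> real" where
  "step_fun k m p c y =
     (\<Sum>j\<in>off_diagonal k {..<m}. c j * (\<Prod>i<k. indicator {p (j i)<..p (Suc (j i))} (y i)))"

definition step_integral ::
  "(real \<Rightarrow> 'a \<Rightarrow> real) \<Rightarrow> nat \<Rightarrow> nat \<Rightarrow> (nat \<Rightarrow> real) \<Rightarrow> ((nat \<Rightarrow> nat) \<Rightarrow> real) \<Rightarrow> 'a \<Rightarrow> real"
  where
  "step_integral B k m p c \<omega> =
     (\<Sum>j\<in>off_diagonal k {..<m}. c j * (\<Prod>i<k. B (p (Suc (j i))) \<omega> - B (p (j i)) \<omega>))"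

text \<open>\<open>X\<close> is (a version of) the \<open>k\<close>-fold Wiener--Ito integral of the square-integrable function
  \<open>f\<close> with respect to \<open>B\<close>: the mean-square limit of the integrals of off-diagonal step functions
  that approximate \<open>f\<close> in mean square.\<close>

definition has_wiener_ito_integral ::
  "'a measure \<Rightarrow> (real \<Rightarrow> 'a \<Rightarrow> real) \<Rightarrow> nat \<Rightarrow> ((nat \<Rightarrow> real) \<Rightarrow> real) \<Rightarrow> ('a \<Rightarrow> real) \<Rightarrow> bool"
  where
  "has_wiener_ito_integral M B k f X \<longleftrightarrow>
     square_integrable (lebesgue_pow k) f \<and> square_integrable M X \<and>
     (\<exists>m p c. (\<forall>n. strict_mono_on {..m n} (p n)) \<and>
        L2_tendsto (lebesgue_pow k) (\<lambda>n. step_fun k (m n) (p n) (c n)) f \<and>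
        L2_tendsto M (\<lambda>n. step_integral B k (m n) (p n) (c n)) X)"


section \<open>Tempered Hermite processes and the discrete chaos\<close>

definition tempered_power :: "real \<Rightarrow> real \<Rightarrow> real \<Rightarrow> real" where
  "tempered_power d lam x = (if x > 0 then x powr (d - 1) * exp (- lam * x) else 0)"

definition tempered_hermite_kernel ::
  "nat \<Rightarrow> real \<Rightarrow> real \<Rightarrow> real \<Rightarrow> (nat \<Rightarrow> real) \<Rightarrow> real" where
  "tempered_hermite_kernel k H lam t y =
     (let d = 1/2 - (1 - H) / real k
      in LBINT s=0..t. (\<Prod>i<k. tempered_power d lam (s - y i)))"

definition tempered_hermite_process ::
  "'a measure \<Rightarrow> (real \<Rightarrow> 'a \<Rightarrow> real) \<Rightarrow> nat \<Rightarrow> real \<Rightarrow> real \<Rightarrow> real set \<Rightarrow> (real \<Rightarrow> 'a \<Rightarrow> real) \<Rightarrow> bool"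
  where
  "tempered_hermite_process M B k H lam T Z \<longleftrightarrow>
     (\<forall>t\<in>T. has_wiener_ito_integral M B k (tempered_hermite_kernel k H lam t) (Z t))"

text \<open>The series is an unordered sum. For \<open>\<mu> > 0\<close> its coefficients are absolutely summable, so
  for standardized noise it converges absolutely almost surely; on the exceptional null set the
  value is \<open>0\<close>.\<close>

definition discrete_chaos ::
  "(int \<Rightarrow> 'a \<Rightarrow> real) \<Rightarrow> real \<Rightarrow> real \<Rightarrow> nat \<Rightarrow> int \<Rightarrow> 'a \<Rightarrow> real" where
  "discrete_chaos \<epsilon> d \<mu> k n \<omega> =
     (\<Sum>\<^sub>\<infinity>i\<in>off_diagonal k (UNIV :: int set).
        (\<Prod>j<k. tempered_power d \<mu> (real_of_int (i j))) * (\<Prod>j<k. \<epsilon> (n - i j) \<omega>))"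

definition chaos_partial_sum ::
  "(int \<Rightarrow> 'a \<Rightarrow> real) \<Rightarrow> real \<Rightarrow> real \<Rightarrow> nat \<Rightarrow> nat \<Rightarrow> real \<Rightarrow> 'a \<Rightarrow> real" where
  "chaos_partial_sum \<epsilon> d \<mu> k N t \<omega> = (\<Sum>n\<in>{1..\<lfloor>real N * t\<rfloor>}. discrete_chaos \<epsilon> d \<mu> k n \<omega>)"

end

(* The partial sums are off-diagonal polynomial sums ("chaos sums") in the noise, for which
   the second moment is bounded by a constant times the sum of the squared coefficients. Rescaled,
   the coefficients are a discretization of the kernel of the tempered Hermite process, dominated by
   a multiple of the untempered kernel with exponent e - 1, where 1/2 - 1/(2k) < e < min d (1/2);
   that kernel is square integrable and its integral over [a, b] has squared norm of order
   (b - a) powr (2 - k (1 - 2 e)), an exponent above 1. Dominated convergence gives L2 convergence of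
   the kernels; replacing the kernel by an off-diagonal step function turns the chaos sum into a
   polynomial in sums of the noise over disjoint blocks, to which the central limit theorem applies.
   A dyadic maximal inequality controls the oscillation of the partial sums in L2. It suffices to
   test weak convergence on bounded Lipschitz functions, so these two ingredients are enough and
   no tightness theory on the nonseparable path space is needed. *)

theory Submission
  imports Defs
begin

text \<open>The noise has only two moments, so every estimate is a mean-square one, and the
  increment exponent 2 - k (1 - 2 e) > 1 has to be reached already there. The auxiliary exponent e
  exists because d may be 1/2 or larger: the correlation of two copies of x_+^(d-1) then diverges at
  infinity, while tempering pays for any surplus power d - e. The lower bound on e says that \<beta>
  = k (1 - 2 e) < 1, so that |s - s'|^(-\<beta>) is integrable over a square. Coefficients indexed
  by lattice tuples are read as functions on R^k that are constant on cells of side 1/N; the factor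
  N^(k/2) turns the bound for chaos sums into an L2 bound uniform in N, and this one estimate serves
  both the increments and the comparison with step functions. Mean squares are nonnegative integrals
  in \<open>ennreal\<close>, so finiteness is an output of the estimates. In the final limit the
  coarse grid of m points is fixed first: its discretization error m^(1/2 - \<gamma>) is uniform in
  N >= m, and only then N tends to infinity.\<close>

abbreviation mean_sq :: "'x measure \<Rightarrow> ('x \<Rightarrow> real) \<Rightarrow> ennreal" where
  "mean_sq M f \<equiv> (\<integral>\<^sup>+x. ennreal ((f x)\<^sup>2) \<partial>M)"

section \<open>Off-diagonal polynomial sums in independent noise\<close>

text \<open>For real functions unordered summability is absolute summability, that is, integrability
  for counting measure; when it fails both sides take the default value 0, so the equation is
  unconditional.\<close>

lemma infsum_eq_lebesgue_integral_count_space: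
  fixes f :: "'x \<Rightarrow> real"
  shows "infsum f A = (LINT x|count_space A. f x)"
proof -
  have iff: "f summable_on A \<longleftrightarrow> integrable (count_space A) f"
    using summable_on_iff_abs_summable_on_real[of f A] abs_summable_equivalent[of f A]
    unfolding Infinite_Set_Sum.abs_summable_on_def by blast
  show ?thesis
  proof (cases "f summable_on A")
    case True
    then have "Infinite_Set_Sum.abs_summable_on f A"
      using iff unfolding Infinite_Set_Sum.abs_summable_on_def by blast
    then show ?thesis
      using infsetsum_infsum[of f A] by (simp only: infsetsum_def)
  next
    case False
    then show ?thesis
      using iff by (simp add: infsum_not_exists not_integrable_integral_eq)
  qed
qed

text \<open>Fatou's lemma, packaged to carry a bound for finite partial sums over to an almost sure
  limit.\<close>

lemma nn_integral_le_Liminf: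
  fixes u :: "nat \<Rightarrow> 'x \<Rightarrow> ennreal"
  assumes [measurable]: "\<And>n. u n \<in> borel_measurable M"
    and lim: "AE x in M. (\<lambda>n. u n x) \<longlonglongrightarrow> v x"
    and bound: "\<And>n. (\<integral>\<^sup>+x. u n x \<partial>M) \<le> C"
  shows "(\<integral>\<^sup>+x. v x \<partial>M) \<le> C"
proof -
  have "(\<integral>\<^sup>+x. v x \<partial>M) = (\<integral>\<^sup>+x. liminf (\<lambda>n. u n x) \<partial>M)"
    using lim by (intro nn_integral_cong_AE) (auto elim!: eventually_mono simp: lim_imp_Liminf)
  also have "\<dots> \<le> liminf (\<lambda>n. \<integral>\<^sup>+x. u n x \<partial>M)"
    by (rule nn_integral_liminf) simp
  also have "\<dots> \<le> C"
    by (rule Liminf_le) (auto intro!: always_eventually bound)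
  finally show ?thesis .
qed

lemma countable_off_diagonal [simp, intro]: "countable A \<Longrightarrow> countable (off_diagonal k A)"
  unfolding off_diagonal_def by (rule countable_subset[OF _ countable_PiE[of "{..<k}"]]) auto

lemma countable_off_diagonal_UNIV [simp, intro]: "countable (off_diagonal k (UNIV :: int set))"
  by (rule countable_off_diagonal) auto

text \<open>A Bochner integral for counting measure on a countable set, so that Tonelli, dominated
  convergence and linearity apply directly; where the series does not converge absolutely the value
  is 0.\<close>

definition chaos_sum :: "nat \<Rightarrow> (int \<Rightarrow> 'a \<Rightarrow> real) \<Rightarrow> ((nat \<Rightarrow> int) \<Rightarrow> real) \<Rightarrow> 'a \<Rightarrow> real"
  where "chaos_sum k \<epsilon> F \<omega> =
    (LINT a|count_space (off_diagonal k UNIV). F a * (\<Prod>j<k. \<epsilon> (a j) \<omega>))"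

locale iid_noise = prob_space M for M :: "'a measure" +
  fixes \<epsilon> :: "int \<Rightarrow> 'a \<Rightarrow> real"
  assumes iid: "iid_standardized \<epsilon>"
begin

lemma indep_noise: "indep_vars (\<lambda>_. borel) \<epsilon> UNIV"
  and distr_noise: "distr M borel (\<epsilon> m) = distr M borel (\<epsilon> n)"
  and integrable_noise_square: "integrable M (\<lambda>\<omega>. (\<epsilon> n \<omega>)\<^sup>2)"
  and expectation_noise: "expectation (\<epsilon> n) = 0"
  and variance_noise: "variance (\<epsilon> n) = 1"
  using iid unfolding iid_standardized_def by blast+

lemma noise_measurable [measurable]: "\<epsilon> n \<in> borel_measurable M"
  using indep_noise unfolding indep_vars_def by simp

lemma integrable_noise: "integrable M (\<epsilon> n)"
  by (rule square_integrable_imp_integrable[OF _ integrable_noise_square]) simp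

lemma expectation_noise_square: "expectation (\<lambda>\<omega>. (\<epsilon> n \<omega>)\<^sup>2) = 1"
  using variance_noise[of n] by (simp add: expectation_noise)

text \<open>Orthonormality of square-free monomials: a product of two of them has squared factors on
  the intersection and simple factors on the symmetric difference, and by independence a single
  index of the latter makes the mean 0.\<close>

lemma expectation_prod_noise:
  assumes fin: "finite E" "finite E'"
  shows "integrable M (\<lambda>\<omega>. (\<Prod>x\<in>E. \<epsilon> x \<omega>) * (\<Prod>x\<in>E'. \<epsilon> x \<omega>))"
    and "expectation (\<lambda>\<omega>. (\<Prod>x\<in>E. \<epsilon> x \<omega>) * (\<Prod>x\<in>E'. \<epsilon> x \<omega>)) = (if E = E' then 1 else 0)"
proof -
  define g :: "int \<Rightarrow> real \<Rightarrow> real" where "g x = (if x \<in> E \<inter> E' then (\<lambda>r. r\<^sup>2) else (\<lambda>r. r))" for x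
  have split: "(\<Prod>x\<in>E. \<epsilon> x \<omega>) * (\<Prod>x\<in>E'. \<epsilon> x \<omega>) = (\<Prod>x\<in>E \<union> E'. g x (\<epsilon> x \<omega>))" for \<omega>
  proof -
    have "(\<Prod>x\<in>E \<union> E'. g x (\<epsilon> x \<omega>)) =
        (\<Prod>x\<in>E \<union> E'. (if x \<in> E then \<epsilon> x \<omega> else 1) * (if x \<in> E' then \<epsilon> x \<omega> else 1))"
      by (intro prod.cong) (auto simp: g_def power2_eq_square)
    also have "\<dots> = (\<Prod>x\<in>E \<union> E'. (if x \<in> E then \<epsilon> x \<omega> else 1))
        * (\<Prod>x\<in>E \<union> E'. (if x \<in> E' then \<epsilon> x \<omega> else 1))"
      by (rule prod.distrib)
    also have "(\<Prod>x\<in>E \<union> E'. (if x \<in> E then \<epsilon> x \<omega> else 1)) = (\<Prod>x\<in>E. \<epsilon> x \<omega>)"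
      using fin by (intro prod.mono_neutral_cong_right) auto
    also have "(\<Prod>x\<in>E \<union> E'. (if x \<in> E' then \<epsilon> x \<omega> else 1)) = (\<Prod>x\<in>E'. \<epsilon> x \<omega>)"
      using fin by (intro prod.mono_neutral_cong_right) auto
    finally show ?thesis by simp
  qed
  have [measurable]: "g x \<in> borel_measurable borel" for x unfolding g_def by simp
  have ind: "indep_vars (\<lambda>_. borel) (\<lambda>x \<omega>. g x (\<epsilon> x \<omega>)) (E \<union> E')"
    by (rule indep_vars_compose2[OF indep_vars_subset[OF indep_noise]]) auto
  have int: "integrable M (\<lambda>\<omega>. g x (\<epsilon> x \<omega>))" for x
    unfolding g_def using integrable_noise integrable_noise_square by auto
  show "integrable M (\<lambda>\<omega>. (\<Prod>x\<in>E. \<epsilon> x \<omega>) * (\<Prod>x\<in>E'. \<epsilon> x \<omega>))"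
    unfolding split using fin by (intro indep_vars_integrable ind int) auto
  have "expectation (\<lambda>\<omega>. (\<Prod>x\<in>E. \<epsilon> x \<omega>) * (\<Prod>x\<in>E'. \<epsilon> x \<omega>)) =
      (\<Prod>x\<in>E \<union> E'. expectation (\<lambda>\<omega>. g x (\<epsilon> x \<omega>)))"
    unfolding split using fin by (intro indep_vars_lebesgue_integral ind int) auto
  also have "\<dots> = (\<Prod>x\<in>E \<union> E'. if x \<in> E \<inter> E' then 1 else 0)"
    by (intro prod.cong) (auto simp: g_def expectation_noise expectation_noise_square)
  also have "\<dots> = (if E = E' then 1 else 0)"
    using fin by (cases "E = E'") (auto simp: prod_zero_iff)
  finally show "expectation (\<lambda>\<omega>. (\<Prod>x\<in>E. \<epsilon> x \<omega>) * (\<Prod>x\<in>E'. \<epsilon> x \<omega>)) = (if E = E' then 1 else 0)" .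
qed

lemma off_diagonal_prod:
  assumes "a \<in> off_diagonal k UNIV"
  shows "(\<Prod>j<k. \<epsilon> (a j) \<omega>) = (\<Prod>x\<in>a ` {..<k}. \<epsilon> x \<omega>)"
  using assms by (simp add: off_diagonal_def prod.reindex)

text \<open>Off-diagonal tuples with the same image are reorderings of each other and carry the same
  monomial; counting all maps into the image gives the crude k ^ k, which becomes the constant of
  the mean-square bounds for chaos sums.\<close>

lemma card_same_image_le:
  assumes "finite A" "A \<subseteq> off_diagonal k UNIV" "a \<in> off_diagonal k (UNIV :: int set)"
  shows "card {b\<in>A. b ` {..<k} = a ` {..<k}} \<le> k ^ k"
proof -
  let ?E = "a ` {..<k}"
  have cE: "card ?E = k" using assms(3) by (auto simp: off_diagonal_def card_image)
  have "{b\<in>A. b ` {..<k} = ?E} \<subseteq> {..<k} \<rightarrow>\<^sub>E ?E"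
    using assms(2) by (auto simp: off_diagonal_def PiE_def)
  then have "card {b\<in>A. b ` {..<k} = ?E} \<le> card ({..<k} \<rightarrow>\<^sub>E ?E)"
    by (intro card_mono) (auto intro!: finite_PiE)
  also have "\<dots> = k ^ k"
    by (simp add: card_PiE cE)
  finally show ?thesis .
qed


text \<open>Each monomial occurs once for every ordering of its index set. As F need not be
  symmetric, the cross terms F a * F b within one ordering class are split by the
  arithmetic-geometric mean inequality, and the size of the class is at most k ^ k.\<close>

lemma nn_integral_finite_chaos_le:
  assumes A: "finite A" "A \<subseteq> off_diagonal k UNIV"
  shows "mean_sq M (\<lambda>\<omega>. \<Sum>a\<in>A. F a * (\<Prod>j<k. \<epsilon> (a j) \<omega>))
    \<le> ennreal (real (k ^ k) * (\<Sum>a\<in>A. (F a)\<^sup>2))"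
proof -
  define P where "P a \<omega> = (\<Prod>j<k. \<epsilon> (a j) \<omega>)" for a \<omega>
  have P: "P a \<omega> * P b \<omega> = (\<Prod>x\<in>a`{..<k}. \<epsilon> x \<omega>) * (\<Prod>x\<in>b`{..<k}. \<epsilon> x \<omega>)"
    if "a \<in> A" "b \<in> A" for a b \<omega>
    using that A by (simp add: P_def off_diagonal_prod subset_iff)
  have int: "integrable M (\<lambda>\<omega>. P a \<omega> * P b \<omega>)" if "a \<in> A" "b \<in> A" for a b
    using that by (simp add: P expectation_prod_noise)
  have ex: "expectation (\<lambda>\<omega>. P a \<omega> * P b \<omega>) = (if b`{..<k} = a`{..<k} then 1 else 0)"
    if "a \<in> A" "b \<in> A" for a b
    using that by (simp add: P expectation_prod_noise)
  have expand: "(\<Sum>a\<in>A. F a * P a \<omega>)\<^sup>2 = (\<Sum>a\<in>A. \<Sum>b\<in>A. F a * F b * (P a \<omega> * P b \<omega>))" for \<omega>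
    by (simp add: power2_eq_square sum_product mult_ac)
  have int2: "integrable M (\<lambda>\<omega>. (\<Sum>a\<in>A. F a * P a \<omega>)\<^sup>2)"
    unfolding expand by (intro Bochner_Integration.integrable_sum integrable_mult_right int)
  have "expectation (\<lambda>\<omega>. (\<Sum>a\<in>A. F a * P a \<omega>)\<^sup>2)
      = (\<Sum>a\<in>A. \<Sum>b\<in>A. F a * F b * expectation (\<lambda>\<omega>. P a \<omega> * P b \<omega>))"
    unfolding expand using int
    by (subst Bochner_Integration.integral_sum) (auto intro!: sum.cong Bochner_Integration.integrable_sum)
  also have "\<dots> = (\<Sum>a\<in>A. \<Sum>b\<in>A. F a * F b * (if b`{..<k} = a`{..<k} then 1 else 0))"
    by (intro sum.cong refl) (simp add: ex)
  also have "\<dots> \<le> (\<Sum>a\<in>A. \<Sum>b\<in>A. ((F a)\<^sup>2 / 2 + (F b)\<^sup>2 / 2) * (if b`{..<k} = a`{..<k} then 1 else 0))"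
  proof (intro sum_mono)
    fix a b
    have "F a * F b \<le> (F a)\<^sup>2 / 2 + (F b)\<^sup>2 / 2"
      using sum_squares_bound[of "F a" "F b"] by (simp add: field_simps)
    then show "F a * F b * (if b`{..<k} = a`{..<k} then 1 else 0)
        \<le> ((F a)\<^sup>2 / 2 + (F b)\<^sup>2 / 2) * (if b`{..<k} = a`{..<k} then 1 else 0)"
      by auto
  qed
  also have "\<dots> = (\<Sum>a\<in>A. \<Sum>b\<in>A. (F a)\<^sup>2 / 2 * (if b`{..<k} = a`{..<k} then 1 else 0))
      + (\<Sum>a\<in>A. \<Sum>b\<in>A. (F b)\<^sup>2 / 2 * (if b`{..<k} = a`{..<k} then 1 else 0))"
    by (simp only: distrib_right sum.distrib)
  \<comment> \<open>Having the same image is a symmetric relation, so exchanging the sums identifies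
    the two halves.\<close>
  also have "(\<Sum>a\<in>A. \<Sum>b\<in>A. (F b)\<^sup>2 / 2 * (if b`{..<k} = a`{..<k} then 1 else 0))
      = (\<Sum>a\<in>A. \<Sum>b\<in>A. (F a)\<^sup>2 / 2 * (if b`{..<k} = a`{..<k} then 1 else 0))"
    by (subst sum.swap) (intro sum.cong refl, auto)
  also have "(\<Sum>a\<in>A. \<Sum>b\<in>A. (F a)\<^sup>2 / 2 * (if b`{..<k} = a`{..<k} then 1 else 0))
      + (\<Sum>a\<in>A. \<Sum>b\<in>A. (F a)\<^sup>2 / 2 * (if b`{..<k} = a`{..<k} then 1 else 0))
      = (\<Sum>a\<in>A. (F a)\<^sup>2 * real (card {b\<in>A. b`{..<k} = a`{..<k}}))"
    using A(1) by (simp flip: sum.distrib sum_distrib_left add: sum.If_cases Int_def)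
  also have "\<dots> \<le> (\<Sum>a\<in>A. (F a)\<^sup>2 * real (k ^ k))"
    using A by (intro sum_mono mult_left_mono) (auto intro!: card_same_image_le simp del: of_nat_power)
  also have "\<dots> = real (k ^ k) * (\<Sum>a\<in>A. (F a)\<^sup>2)"
    by (simp add: sum_distrib_left mult.commute)
  finally show ?thesis
    unfolding P_def[symmetric] by (subst nn_integral_eq_integral[OF int2]) (auto intro!: ennreal_leI)
qed

text \<open>|P| <= (1 + P^2) / 2, and P has mean square 1. This first-moment bound feeds the Tonelli
  argument for absolute convergence.\<close>

lemma nn_integral_abs_chaos_le:
  assumes "a \<in> off_diagonal k UNIV"
  shows "(\<integral>\<^sup>+\<omega>. ennreal \<bar>\<Prod>j<k. \<epsilon> (a j) \<omega>\<bar> \<partial>M) \<le> 1"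
proof -
  let ?P = "\<lambda>\<omega>. \<Prod>j<k. \<epsilon> (a j) \<omega>"
  have eq: "(?P \<omega>)\<^sup>2 = (\<Prod>x\<in>a`{..<k}. \<epsilon> x \<omega>) * (\<Prod>x\<in>a`{..<k}. \<epsilon> x \<omega>)" for \<omega>
    using assms by (simp add: off_diagonal_prod power2_eq_square)
  have int: "integrable M (\<lambda>\<omega>. (?P \<omega>)\<^sup>2)" and ex: "expectation (\<lambda>\<omega>. (?P \<omega>)\<^sup>2) = 1"
    unfolding eq using expectation_prod_noise[of "a`{..<k}" "a`{..<k}"] by auto
  have "(\<integral>\<^sup>+\<omega>. ennreal \<bar>?P \<omega>\<bar> \<partial>M) \<le> (\<integral>\<^sup>+\<omega>. ennreal ((1 + (?P \<omega>)\<^sup>2) / 2) \<partial>M)"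
  proof (intro nn_integral_mono ennreal_leI)
    fix \<omega> show "\<bar>?P \<omega>\<bar> \<le> (1 + (?P \<omega>)\<^sup>2) / 2"
      using sum_squares_bound[of 1 "\<bar>?P \<omega>\<bar>"] by simp
  qed
  also have "\<dots> = ennreal (expectation (\<lambda>\<omega>. (1 + (?P \<omega>)\<^sup>2) / 2))"
    using int by (intro nn_integral_eq_integral) auto
  also have "expectation (\<lambda>\<omega>. (1 + (?P \<omega>)\<^sup>2) / 2) = 1"
    using int ex by (simp add: prob_space)
  finally show ?thesis by simp
qed

lemma chaos_pair_measurable [measurable]:
  "(\<lambda>(\<omega>, a). F a * (\<Prod>j<k. \<epsilon> (a j) \<omega>))
    \<in> borel_measurable (M \<Otimes>\<^sub>M count_space (off_diagonal k UNIV))"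
proof -
  have "(\<lambda>(a, \<omega>). F a * (\<Prod>j<k. \<epsilon> (a j) \<omega>))
      \<in> borel_measurable (count_space (off_diagonal k UNIV) \<Otimes>\<^sub>M M)"
    by (rule measurable_pair_measure_countable1) auto
  from measurable_compose[OF measurable_pair_swap' this] show ?thesis
    by (simp add: case_prod_beta' cong: measurable_cong)
qed

lemma chaos_sum_measurable [measurable]: "chaos_sum k \<epsilon> F \<in> borel_measurable M"
  unfolding chaos_sum_def[abs_def]
  by (rule sigma_finite_measure.borel_measurable_lebesgue_integral[OF
        sigma_finite_measure_count_space_countable]) auto

text \<open>By Tonelli the expected sum of absolute values is at most the sum of |F a|, hence
  finite, so the series converges absolutely outside a null set.\<close>

lemma AE_chaos_integrable:
  assumes "integrable (count_space (off_diagonal k UNIV)) F"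
  shows "AE \<omega> in M. integrable (count_space (off_diagonal k UNIV)) (\<lambda>a. F a * (\<Prod>j<k. \<epsilon> (a j) \<omega>))"
proof -
  let ?C = "count_space (off_diagonal k (UNIV :: int set))"
  interpret C: sigma_finite_measure ?C
    by (rule sigma_finite_measure_count_space_countable) auto
  interpret P: pair_sigma_finite M ?C ..
  have "(\<integral>\<^sup>+\<omega>. (\<integral>\<^sup>+a. ennreal \<bar>F a * (\<Prod>j<k. \<epsilon> (a j) \<omega>)\<bar> \<partial>?C) \<partial>M)
      = (\<integral>\<^sup>+a. (\<integral>\<^sup>+\<omega>. ennreal \<bar>F a * (\<Prod>j<k. \<epsilon> (a j) \<omega>)\<bar> \<partial>M) \<partial>?C)"
    by (rule P.Fubini'[symmetric]) measurable
  also have "\<dots> \<le> (\<integral>\<^sup>+a. ennreal \<bar>F a\<bar> \<partial>?C)"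
  proof (intro nn_integral_mono)
    fix a :: "nat \<Rightarrow> int" assume a: "a \<in> space ?C"
    have "(\<integral>\<^sup>+\<omega>. ennreal \<bar>F a * (\<Prod>j<k. \<epsilon> (a j) \<omega>)\<bar> \<partial>M)
        = ennreal \<bar>F a\<bar> * (\<integral>\<^sup>+\<omega>. ennreal \<bar>\<Prod>j<k. \<epsilon> (a j) \<omega>\<bar> \<partial>M)"
      by (subst nn_integral_cmult[symmetric]) (auto simp: abs_mult ennreal_mult)
    also have "\<dots> \<le> ennreal \<bar>F a\<bar> * 1"
      using a by (intro mult_left_mono nn_integral_abs_chaos_le) auto
    finally show "(\<integral>\<^sup>+\<omega>. ennreal \<bar>F a * (\<Prod>j<k. \<epsilon> (a j) \<omega>)\<bar> \<partial>M) \<le> ennreal \<bar>F a\<bar>" by simp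
  qed
  also have "\<dots> < \<infinity>"
    using assms by (simp add: integrable_iff_bounded)
  finally have "AE \<omega> in M. (\<integral>\<^sup>+a. ennreal \<bar>F a * (\<Prod>j<k. \<epsilon> (a j) \<omega>)\<bar> \<partial>?C) \<noteq> \<infinity>"
    by (intro nn_integral_noteq_infinite) (auto simp: less_top)
  then show ?thesis
    by (rule eventually_mono) (auto simp: integrable_iff_bounded less_top)
qed

text \<open>The finite bound passes to the series along an enumeration of the countable index set:
  absolute convergence makes the finite sums converge almost surely, and Fatou's lemma keeps the
  bound.\<close>

lemma nn_integral_chaos_sum_square_le:
  assumes F: "integrable (count_space (off_diagonal k UNIV)) F"
    and C: "\<And>A. finite A \<Longrightarrow> A \<subseteq> off_diagonal k UNIV \<Longrightarrow> (\<Sum>a\<in>A. (F a)\<^sup>2) \<le> C"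
  shows "mean_sq M (chaos_sum k \<epsilon> F) \<le> ennreal (real (k ^ k) * C)"
proof -
  let ?D = "off_diagonal k (UNIV :: int set)"
  define g where "g = to_nat_on ?D"
  define A where "A n = {a\<in>?D. g a < n}" for n
  have inj: "inj_on g ?D" unfolding g_def by (rule inj_on_to_nat_on) auto
  have finA: "finite (A n)" for n
    unfolding A_def by (rule finite_imageD[of g]) (auto intro!: finite_subset[of _ "{..<n}"] inj_on_subset[OF inj])
  have lim: "AE \<omega> in M. (\<lambda>n. \<Sum>a\<in>A n. F a * (\<Prod>j<k. \<epsilon> (a j) \<omega>)) \<longlonglongrightarrow> chaos_sum k \<epsilon> F \<omega>"
    using AE_chaos_integrable[OF F]
  proof eventually_elim
    fix \<omega> assume int: "integrable (count_space ?D) (\<lambda>a. F a * (\<Prod>j<k. \<epsilon> (a j) \<omega>))" (is "integrable _ ?f")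
    have "(\<lambda>n. LINT a|count_space ?D. indicator (A n) a * ?f a) \<longlonglongrightarrow> (LINT a|count_space ?D. ?f a)"
    proof (rule integral_dominated_convergence[where w="\<lambda>a. \<bar>?f a\<bar>"])
      show "AE a in count_space ?D. (\<lambda>n. indicator (A n) a * ?f a) \<longlonglongrightarrow> ?f a"
      proof (rule AE_I2)
        fix a assume "a \<in> space (count_space ?D)"
        then have "eventually (\<lambda>n. indicator (A n) a * ?f a = ?f a) sequentially"
          by (auto simp: A_def eventually_sequentially indicator_def intro!: exI[of _ "Suc (g a)"])
        then show "(\<lambda>n. indicator (A n) a * ?f a) \<longlonglongrightarrow> ?f a"
          by (rule tendsto_eventually)
      qed
    qed (use int in \<open>auto simp: indicator_def intro!: AE_I2\<close>)
    moreover have "(LINT a|count_space ?D. indicator (A n) a * ?f a) = (\<Sum>a\<in>A n. ?f a)" for n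
    proof -
      have "(LINT a|count_space ?D. indicator (A n) a * ?f a)
          = (\<Sum>a | a \<in> ?D \<and> indicator (A n) a * ?f a \<noteq> 0. indicator (A n) a * ?f a)"
        by (rule lebesgue_integral_count_space_finite_support)
          (auto intro!: finite_subset[OF _ finA[of n]] simp: indicator_def split: if_splits)
      also have "\<dots> = (\<Sum>a\<in>A n. ?f a)"
        using finA[of n] by (intro sum.mono_neutral_cong_left) (auto simp: A_def indicator_def split: if_splits)
      finally show ?thesis .
    qed
    ultimately show "(\<lambda>n. \<Sum>a\<in>A n. ?f a) \<longlonglongrightarrow> chaos_sum k \<epsilon> F \<omega>"
      by (simp add: chaos_sum_def)
  qed
  show ?thesis
  proof (rule nn_integral_le_Liminf[where u="\<lambda>n \<omega>. ennreal ((\<Sum>a\<in>A n. F a * (\<Prod>j<k. \<epsilon> (a j) \<omega>))\<^sup>2)"])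
    show "AE \<omega> in M. (\<lambda>n. ennreal ((\<Sum>a\<in>A n. F a * (\<Prod>j<k. \<epsilon> (a j) \<omega>))\<^sup>2))
        \<longlonglongrightarrow> ennreal ((chaos_sum k \<epsilon> F \<omega>)\<^sup>2)"
      using lim by eventually_elim (intro tendsto_ennrealI tendsto_power)
    fix n
    have "A n \<subseteq> ?D" by (auto simp: A_def)
    from nn_integral_finite_chaos_le[OF finA this, of F]
    show "mean_sq M (\<lambda>\<omega>. \<Sum>a\<in>A n. F a * (\<Prod>j<k. \<epsilon> (a j) \<omega>)) \<le> ennreal (real (k ^ k) * C)"
      by (rule order_trans) (auto intro!: ennreal_leI mult_left_mono C finA \<open>A n \<subseteq> ?D\<close>)
  qed simp
qed

text \<open>Only almost sure: where one of the two series diverges, its default value 0 can destroy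
  linearity.\<close>

lemma AE_chaos_sum_diff:
  assumes "integrable (count_space (off_diagonal k UNIV)) F"
    and "integrable (count_space (off_diagonal k UNIV)) G"
  shows "AE \<omega> in M. chaos_sum k \<epsilon> (\<lambda>a. F a - G a) \<omega> = chaos_sum k \<epsilon> F \<omega> - chaos_sum k \<epsilon> G \<omega>"
  using AE_chaos_integrable[OF assms(1)] AE_chaos_integrable[OF assms(2)]
  by eventually_elim (simp add: chaos_sum_def left_diff_distrib)

lemma AE_chaos_sum_sum:
  assumes "finite I" "\<And>i. i \<in> I \<Longrightarrow> integrable (count_space (off_diagonal k UNIV)) (F i)"
  shows "AE \<omega> in M. chaos_sum k \<epsilon> (\<lambda>a. \<Sum>i\<in>I. F i a) \<omega> = (\<Sum>i\<in>I. chaos_sum k \<epsilon> (F i) \<omega>)"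
proof -
  have "AE \<omega> in M. \<forall>i\<in>I. integrable (count_space (off_diagonal k UNIV)) (\<lambda>a. F i a * (\<Prod>j<k. \<epsilon> (a j) \<omega>))"
    using assms by (intro AE_finite_allI AE_chaos_integrable) auto
  then show ?thesis
    by eventually_elim (simp add: chaos_sum_def sum_distrib_right)
qed

lemma chaos_sum_cmult: "chaos_sum k \<epsilon> (\<lambda>a. c * F a) \<omega> = c * chaos_sum k \<epsilon> F \<omega>"
  by (simp add: chaos_sum_def mult.assoc)

text \<open>The reflection i -> n - i replaces lags by noise indices, so that all n share one family
  of monomials and summation over n acts on the coefficients alone. Reflected tuples are restricted
  to {..<k} to stay extensional.\<close>

lemma discrete_chaos_eq_chaos_sum:
  "discrete_chaos \<epsilon> d \<mu> k n \<omega> = chaos_sum k \<epsilon> (\<lambda>a. \<Prod>j<k. tempered_power d \<mu> (real_of_int (n - a j))) \<omega>"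
proof -
  let ?D = "off_diagonal k (UNIV :: int set)"
  let ?h = "\<lambda>i. \<lambda>j\<in>{..<k}. n - i j"
  have bij: "bij_betw ?h ?D ?D"
    by (rule bij_betwI[of _ _ _ ?h]) (auto simp: off_diagonal_def inj_on_def PiE_def extensional_def fun_eq_iff)
  show ?thesis
    unfolding chaos_sum_def discrete_chaos_def infsum_eq_lebesgue_integral_count_space[symmetric]
    by (subst infsum_reindex_bij_betw[OF bij, symmetric]) simp
qed

end

section \<open>The kernel of the Hermite process\<close>

lemma tempered_power_measurable [measurable]: "tempered_power d lam \<in> borel_measurable borel"
  unfolding tempered_power_def[abs_def] by measurable

lemma tempered_power_nonneg [simp]: "0 \<le> tempered_power d lam x"
  by (simp add: tempered_power_def)

text \<open>With tempering parameter 0, \<open>tempered_power a 0\<close> is the plain truncated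
  power x_+^(a-1), the form in which all majorants are written.\<close>

lemma nn_integral_power_from_0:
  assumes "a > 0" "c \<ge> 0"
  shows "(\<integral>\<^sup>+x. ennreal (tempered_power a 0 x) * indicator {..c} x \<partial>lborel) = ennreal (c powr a / a)"
proof -
  have "((\<lambda>x. x powr (a - 1)) has_integral (c powr (a - 1 + 1) / (a - 1 + 1))) {0..c}"
    using assms by (intro has_integral_powr_from_0) auto
  then have "(\<integral>\<^sup>+x. ennreal (x powr (a - 1)) * indicator {0..c} x \<partial>lborel) = ennreal (c powr a / a)"
    using nn_integral_has_integral_lebesgue'[of "{0..c}" "\<lambda>x. x powr (a - 1)"] by simp
  also have "(\<integral>\<^sup>+x. ennreal (x powr (a - 1)) * indicator {0..c} x \<partial>lborel)
      = (\<integral>\<^sup>+x. ennreal (tempered_power a 0 x) * indicator {..c} x \<partial>lborel)"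
    by (intro nn_integral_cong) (auto simp: tempered_power_def indicator_def)
  finally show ?thesis .
qed

lemma nn_integral_power_to_infinity:
  assumes "a < -1" "(c :: real) > 0"
  shows "(\<integral>\<^sup>+x. ennreal (x powr a) * indicator {c..} x \<partial>lborel) = ennreal (- (c powr (a + 1)) / (a + 1))"
  using has_integral_powr_to_inf[OF assms]
  by (intro nn_integral_has_integral_lebesgue') auto

text \<open>1 / e comes from x^(e-1) on (0, h] and 1 / (1 - 2 e) from x^(2 e - 2) on [h, infinity);
  the sum bounds the Beta value B(e, 1 - 2 e) that the correlation integral has at h = 1.\<close>

definition corr_const :: "real \<Rightarrow> real" where "corr_const e = 1 / e + 1 / (1 - 2 * e)"

text \<open>For x below h the factor at x + h is at most h^(e-1), for x above h it is at most
  x^(e-1), because the exponent is negative. Integrability at 0 comes from e > 0 and at infinity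
  from e < 1/2.\<close>

lemma nn_integral_power_correlation:
  assumes e: "0 < e" "e < 1/2" and h: "h > 0"
  shows "(\<integral>\<^sup>+x. ennreal (tempered_power e 0 x * tempered_power e 0 (x + h)) \<partial>lborel)
    \<le> ennreal (corr_const e * h powr (2 * e - 1))"
proof -
  have "(\<integral>\<^sup>+x. ennreal (tempered_power e 0 x * tempered_power e 0 (x + h)) \<partial>lborel)
     \<le> (\<integral>\<^sup>+x. ennreal (h powr (e - 1)) * (ennreal (tempered_power e 0 x) * indicator {..h} x)
          + ennreal (x powr (2 * e - 2)) * indicator {h..} x \<partial>lborel)"
  proof (intro nn_integral_mono)
    fix x :: real
    consider "x \<le> 0" | "0 < x" "x \<le> h" | "x > h" "x > 0" using h by linarith
    then show "ennreal (tempered_power e 0 x * tempered_power e 0 (x + h))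
      \<le> ennreal (h powr (e - 1)) * (ennreal (tempered_power e 0 x) * indicator {..h} x)
          + ennreal (x powr (2 * e - 2)) * indicator {h..} x"
    proof cases
      case 2
      have "tempered_power e 0 (x + h) \<le> h powr (e - 1)"
        using 2 h e by (simp add: tempered_power_def) (intro powr_mono2', auto)
      then have "tempered_power e 0 x * tempered_power e 0 (x + h) \<le> h powr (e - 1) * tempered_power e 0 x"
        by (subst mult.commute) (intro mult_right_mono, auto)
      then have "ennreal (tempered_power e 0 x * tempered_power e 0 (x + h))
          \<le> ennreal (h powr (e - 1)) * ennreal (tempered_power e 0 x)"
        by (simp add: ennreal_leI flip: ennreal_mult)
      then show ?thesis using 2 by (simp add: add_increasing2)
    next
      case 3
      have "tempered_power e 0 (x + h) \<le> x powr (e - 1)"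
        using 3 h e by (simp add: tempered_power_def) (intro powr_mono2', auto)
      then have "tempered_power e 0 x * tempered_power e 0 (x + h) \<le> x powr (e - 1) * x powr (e - 1)"
        using 3 by (intro mult_mono) (auto simp: tempered_power_def)
      also have "\<dots> = x powr (2 * e - 2)" by (simp flip: powr_add)
      finally have "ennreal (tempered_power e 0 x * tempered_power e 0 (x + h)) \<le> ennreal (x powr (2 * e - 2))"
        by (rule ennreal_leI)
      then show ?thesis using 3 by simp
    qed (auto simp: tempered_power_def)
  qed
  also have "\<dots> = ennreal (h powr (e - 1)) * (\<integral>\<^sup>+x. ennreal (tempered_power e 0 x) * indicator {..h} x \<partial>lborel)
      + (\<integral>\<^sup>+x. ennreal (x powr (2 * e - 2)) * indicator {h..} x \<partial>lborel)"
    by (subst nn_integral_add) (auto simp: nn_integral_cmult)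
  also have "\<dots> = ennreal (h powr (e - 1)) * ennreal (h powr e / e)
      + ennreal (- (h powr (2 * e - 2 + 1)) / (2 * e - 2 + 1))"
    using e h by (subst nn_integral_power_from_0, simp, simp, subst nn_integral_power_to_infinity) auto
  also have "\<dots> = ennreal (h powr (e - 1) * (h powr e / e) + - (h powr (2 * e - 2 + 1)) / (2 * e - 2 + 1))"
    using e h by (subst ennreal_plus) (auto simp: ennreal_mult[symmetric] divide_nonneg_neg)
  also have "h powr (e - 1) * (h powr e / e) + - (h powr (2 * e - 2 + 1)) / (2 * e - 2 + 1)
      = corr_const e * h powr (2 * e - 1)"
  proof -
    have "h powr (e - 1) * h powr e = h powr (2 * e - 1)" by (simp flip: powr_add)
    then have 1: "h powr (e - 1) * (h powr e / e) = h powr (2 * e - 1) / e" by simp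
    have 2: "- (h powr (2 * e - 2 + 1)) / (2 * e - 2 + 1) = h powr (2 * e - 1) / (1 - 2 * e)"
      using e by (simp add: field_simps)
    show ?thesis unfolding 1 2 by (simp add: corr_const_def distrib_right)
  qed
  finally show ?thesis .
qed

lemma nn_integral_power_correlation_shifted:
  assumes e: "0 < e" "e < 1/2" and h: "s \<noteq> s'"
  shows "(\<integral>\<^sup>+y. ennreal (tempered_power e 0 (s - y) * tempered_power e 0 (s' - y)) \<partial>lborel)
    \<le> ennreal (corr_const e * \<bar>s - s'\<bar> powr (2 * e - 1))"
proof -
  have *: "(\<integral>\<^sup>+y. ennreal (tempered_power e 0 (s - y) * tempered_power e 0 (s' - y)) \<partial>lborel)
    \<le> ennreal (corr_const e * \<bar>s - s'\<bar> powr (2 * e - 1))" if "s < s'" for s s'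
  proof -
    have "(\<integral>\<^sup>+y. ennreal (tempered_power e 0 (s - y) * tempered_power e 0 (s' - y)) \<partial>lborel)
      = (\<integral>\<^sup>+x. ennreal (tempered_power e 0 x * tempered_power e 0 (x + (s' - s))) \<partial>lborel)"
      by (subst nn_integral_real_affine[where c="-1" and t=s]) (auto simp: algebra_simps)
    also have "\<dots> \<le> ennreal (corr_const e * (s' - s) powr (2 * e - 1))"
      using that by (intro nn_integral_power_correlation e) auto
    finally show ?thesis using that by simp
  qed
  show ?thesis
    using *[of s s'] *[of s' s] h by (cases "s < s'") (auto simp: mult.commute abs_minus_commute)
qed

text \<open>Each side of s contributes at most the integral of u^(-\<beta>) over (0, b - a]; hence
  the factor 2.\<close>

lemma nn_integral_abs_power_le:
  assumes b: "\<beta> < 1" and ab: "a \<le> (b :: real)" and s: "s \<in> {a..b}"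
  shows "(\<integral>\<^sup>+s'. ennreal (\<bar>s - s'\<bar> powr - \<beta>) * indicator {a<..b} s' \<partial>lborel)
    \<le> ennreal (2 * (b - a) powr (1 - \<beta>) / (1 - \<beta>))"
proof -
  let ?q = "\<lambda>u. ennreal (tempered_power (1 - \<beta>) 0 u) * indicator {..b - a} u"
  have "(\<integral>\<^sup>+s'. ennreal (\<bar>s - s'\<bar> powr - \<beta>) * indicator {a<..b} s' \<partial>lborel)
    \<le> (\<integral>\<^sup>+s'. ?q (s - s') + ?q (s' - s) \<partial>lborel)"
    using s by (intro nn_integral_mono) (auto simp: indicator_def tempered_power_def abs_if)
  also have "\<dots> = (\<integral>\<^sup>+s'. ?q (s - s') \<partial>lborel) + (\<integral>\<^sup>+s'. ?q (s' - s) \<partial>lborel)"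
    by (subst nn_integral_add) auto
  also have "(\<integral>\<^sup>+s'. ?q (s - s') \<partial>lborel) = (\<integral>\<^sup>+u. ?q u \<partial>lborel)"
    by (subst nn_integral_real_affine[where c="-1" and t=s]) auto
  also have "(\<integral>\<^sup>+s'. ?q (s' - s) \<partial>lborel) = (\<integral>\<^sup>+u. ?q u \<partial>lborel)"
    by (subst nn_integral_real_affine[where c="1" and t=s]) auto
  also have "(\<integral>\<^sup>+u. ?q u \<partial>lborel) = ennreal ((b - a) powr (1 - \<beta>) / (1 - \<beta>))"
    using b ab by (intro nn_integral_power_from_0) auto
  finally show ?thesis using b ab by (simp flip: ennreal_plus)
qed

section \<open>Square norm of the untempered kernel over an interval\<close>

interpretation lborel_product: product_sigma_finite "\<lambda>_::nat. lborel :: real measure"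
  by standard

lemma sigma_finite_lebesgue_pow: "sigma_finite_measure (lebesgue_pow k)"
  unfolding lebesgue_pow_def by (rule lborel_product.sigma_finite) auto

lemma sets_lebesgue_pow [measurable_cong]: "sets (lebesgue_pow k) = sets (\<Pi>\<^sub>M i\<in>{..<k}. borel)"
  unfolding lebesgue_pow_def by (intro sets_PiM_cong) auto

lemma nn_integral_lebesgue_pow_prod:
  assumes "\<And>i. i < k \<Longrightarrow> f i \<in> borel_measurable borel"
  shows "(\<integral>\<^sup>+y. (\<Prod>i<k. f i (y i)) \<partial>lebesgue_pow k) = (\<Prod>i<k. \<integral>\<^sup>+x. f i x \<partial>lborel)"
  unfolding lebesgue_pow_def using assms by (intro lborel_product.product_nn_integral_prod) auto

text \<open>Valued in \<open>ennreal\<close>, since the integral may diverge at single points, for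
  instance where coordinates of y coincide; finiteness almost everywhere is a consequence of the
  square bound.\<close>

definition hermite_majorant :: "nat \<Rightarrow> real \<Rightarrow> real \<Rightarrow> real \<Rightarrow> (nat \<Rightarrow> real) \<Rightarrow> ennreal" where
  "hermite_majorant k e a b y =
    (\<integral>\<^sup>+s. ennreal (\<Prod>i<k. tempered_power e 0 (s - y i)) * indicator {a<..b} s \<partial>lborel)"

lemma prod_tempered_measurable [measurable]:
  "(\<lambda>(y, s). \<Prod>i<k. tempered_power d lam (s - y i)) \<in> borel_measurable (lebesgue_pow k \<Otimes>\<^sub>M borel)"
  by measurable

lemma hermite_majorant_measurable [measurable]:
  "hermite_majorant k e a b \<in> borel_measurable (lebesgue_pow k)"
  unfolding hermite_majorant_def[abs_def] by measurable

lemma hermite_majorant_mono: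
  "{a<..b} \<subseteq> {a'<..b'} \<Longrightarrow> hermite_majorant k e a b y \<le> hermite_majorant k e a' b' y"
  unfolding hermite_majorant_def by (intro nn_integral_mono mult_left_mono) (auto simp: indicator_def)

text \<open>Squaring the inner integral and exchanging the order of integration leaves the \<open>k\<close>-th power of
  a one-dimensional correlation integral.\<close>

lemma nn_integral_hermite_majorant_square:
  assumes k: "k \<ge> 1" and e: "1/2 - 1 / (2 * real k) < e" "e < 1/2" and ab: "a \<le> b"
  shows "(\<integral>\<^sup>+y. (hermite_majorant k e a b y)\<^sup>2 \<partial>lebesgue_pow k)
    \<le> ennreal (2 * corr_const e ^ k / (1 - real k * (1 - 2 * e)) * (b - a) powr (2 - real k * (1 - 2 * e)))"
proof -
  let ?L = "lebesgue_pow k"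
  let ?p = "tempered_power e 0"
  interpret L: sigma_finite_measure ?L by (rule sigma_finite_lebesgue_pow)
  interpret P: pair_sigma_finite ?L lborel ..
  \<comment> \<open>The k-th power of |s - s'|^(2 e - 1) is |s - s'|^(-\<beta>), and \<beta> < 1
    restates the lower bound on e.\<close>
  define \<beta> where "\<beta> = real k * (1 - 2 * e)"
  have "1 / (2 * real k) \<le> 1/2" using k by simp
  then have e0: "e > 0" using e by linarith
  have "1 - 2 * e < 1 / real k" using e by (simp add: field_simps)
  then have \<beta>: "\<beta> < 1" using k by (simp add: \<beta>_def field_simps)
  have c0: "corr_const e \<ge> 0" using e e0 by (simp add: corr_const_def)
  let ?F = "\<lambda>y s. ennreal (\<Prod>i<k. ?p (s - y i)) * indicator {a<..b} s"
  have "(\<integral>\<^sup>+y. (hermite_majorant k e a b y)\<^sup>2 \<partial>?L)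
      = (\<integral>\<^sup>+y. (\<integral>\<^sup>+s. (\<integral>\<^sup>+s'. ?F y s * ?F y s' \<partial>lborel) \<partial>lborel) \<partial>?L)"
    unfolding power2_eq_square hermite_majorant_def
    by (intro nn_integral_cong) (simp add: nn_integral_cmult nn_integral_multc)
  also have "\<dots> = (\<integral>\<^sup>+s. (\<integral>\<^sup>+y. (\<integral>\<^sup>+s'. ?F y s * ?F y s' \<partial>lborel) \<partial>?L) \<partial>lborel)"
    by (rule P.Fubini'[symmetric]) measurable
  also have "\<dots> = (\<integral>\<^sup>+s. (\<integral>\<^sup>+s'. (\<integral>\<^sup>+y. ?F y s * ?F y s' \<partial>?L) \<partial>lborel) \<partial>lborel)"
    by (intro nn_integral_cong P.Fubini'[symmetric]) measurable
  also have "\<dots> \<le> (\<integral>\<^sup>+s. (\<integral>\<^sup>+s'. ennreal (corr_const e ^ k) *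
      (ennreal (\<bar>s - s'\<bar> powr - \<beta>) * indicator {a<..b} s') * indicator {a<..b} s \<partial>lborel) \<partial>lborel)"
  proof (rule nn_integral_mono, rule nn_integral_mono_AE)
    fix s :: real
    \<comment> \<open>The correlation bound fails for s' = s, where the right-hand power is 0 by
      convention, so the inner estimate is claimed almost everywhere.\<close>
    have "AE s' in lborel. s' \<noteq> s" by (rule AE_lborel_singleton)
    then show "AE s' in lborel. (\<integral>\<^sup>+y. ?F y s * ?F y s' \<partial>?L) \<le> ennreal (corr_const e ^ k) *
      (ennreal (\<bar>s - s'\<bar> powr - \<beta>) * indicator {a<..b} s') * indicator {a<..b} s"
    proof eventually_elim
      fix s' assume ss: "s' \<noteq> s"
      have "(\<integral>\<^sup>+y. ?F y s * ?F y s' \<partial>?L)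
          = (\<integral>\<^sup>+y. (\<Prod>i<k. ennreal (?p (s - y i) * ?p (s' - y i))) * (indicator {a<..b} s * indicator {a<..b} s') \<partial>?L)"
        by (intro nn_integral_cong)
          (simp add: prod_ennreal prod.distrib prod_nonneg ennreal_mult mult_ac)
      also have "\<dots> = (\<integral>\<^sup>+y. (\<Prod>i<k. ennreal (?p (s - y i) * ?p (s' - y i))) \<partial>?L) * (indicator {a<..b} s * indicator {a<..b} s')"
        by (rule nn_integral_multc) measurable
      also have "(\<integral>\<^sup>+y. (\<Prod>i<k. ennreal (?p (s - y i) * ?p (s' - y i))) \<partial>?L)
          = (\<Prod>i<k. \<integral>\<^sup>+x. ennreal (?p (s - x) * ?p (s' - x)) \<partial>lborel)"
        by (rule nn_integral_lebesgue_pow_prod) measurable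
      also have "\<dots> \<le> (\<Prod>i<k. ennreal (corr_const e * \<bar>s - s'\<bar> powr (2 * e - 1)))"
        using ss by (intro prod_mono_ennreal nn_integral_power_correlation_shifted e0 e) auto
      also have "\<dots> = ennreal (corr_const e ^ k * \<bar>s - s'\<bar> powr - \<beta>)"
        using ss c0 by (simp add: ennreal_power power_mult_distrib \<beta>_def powr_power algebra_simps)
      finally show "(\<integral>\<^sup>+y. ?F y s * ?F y s' \<partial>?L) \<le> ennreal (corr_const e ^ k) *
          (ennreal (\<bar>s - s'\<bar> powr - \<beta>) * indicator {a<..b} s') * indicator {a<..b} s"
        using c0 by (simp add: ennreal_mult mult_ac mult_left_mono mult_right_mono)
    qed
  qed
  also have "\<dots> = (\<integral>\<^sup>+s. ennreal (corr_const e ^ k) *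
      (\<integral>\<^sup>+s'. ennreal (\<bar>s - s'\<bar> powr - \<beta>) * indicator {a<..b} s' \<partial>lborel) * indicator {a<..b} s \<partial>lborel)"
    by (intro nn_integral_cong) (simp add: nn_integral_cmult nn_integral_multc)
  also have "\<dots> \<le> (\<integral>\<^sup>+s. ennreal (corr_const e ^ k) *
      ennreal (2 * (b - a) powr (1 - \<beta>) / (1 - \<beta>)) * indicator {a<..b} s \<partial>lborel)"
  proof (intro nn_integral_mono)
    fix s :: real
    show "ennreal (corr_const e ^ k) *
      (\<integral>\<^sup>+s'. ennreal (\<bar>s - s'\<bar> powr - \<beta>) * indicator {a<..b} s' \<partial>lborel) * indicator {a<..b} s
      \<le> ennreal (corr_const e ^ k) * ennreal (2 * (b - a) powr (1 - \<beta>) / (1 - \<beta>)) * indicator {a<..b} s"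
      using nn_integral_abs_power_le[OF \<beta> ab, of s]
      by (cases "s \<in> {a<..b}") (auto intro: mult_left_mono)
  qed
  also have "\<dots> = ennreal (corr_const e ^ k * (2 * (b - a) powr (1 - \<beta>) / (1 - \<beta>)) * (b - a))"
    using ab \<beta> c0 by (subst nn_integral_cmult_indicator) (auto simp: ennreal_mult[symmetric])
  also have "corr_const e ^ k * (2 * (b - a) powr (1 - \<beta>) / (1 - \<beta>)) * (b - a)
      = 2 * corr_const e ^ k / (1 - \<beta>) * (b - a) powr (2 - \<beta>)"
  proof (cases "a = b")
    case False
    then have "(b - a) powr (2 - \<beta>) = (b - a) powr (1 - \<beta>) * (b - a)"
      using ab powr_add[of "b - a" "1 - \<beta>" 1] by simp
    then show ?thesis by simp
  qed simp
  finally show ?thesis unfolding \<beta>_def .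
qed

text \<open>The surplus power x^(d-e) is absorbed by the exponential. This is how large d is traded
  for an exponent below 1/2, at the price of a constant.\<close>

lemma tempered_power_le:
  assumes "e \<le> d" "lam > 0"
  shows "\<exists>C>0. \<forall>x. tempered_power d lam x \<le> C * tempered_power e 0 x"
proof (cases "e = d")
  case True
  then show ?thesis
    using assms by (intro exI[of _ 1]) (auto simp: tempered_power_def intro!: mult_left_le)
next
  case False
  define \<delta> where "\<delta> = d - e"
  have \<delta>: "\<delta> > 0" using False assms by (simp add: \<delta>_def)
  \<comment> \<open>From ln z <= z at z = lam x / \<delta> follows z^\<delta> <= exp (lam x), that
    is, x^\<delta> exp (- lam x) <= C; the true maximum is smaller by the factor exp (-
    \<delta>).\<close>
  define C where "C = (\<delta> / lam) powr \<delta>"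
  have "tempered_power d lam x \<le> C * tempered_power e 0 x" for x
  proof (cases "x > 0")
    case True
    have "ln (lam * x / \<delta>) \<le> lam * x / \<delta> - 1" using True assms \<delta> by (intro ln_le_minus_one) auto
    then have "ln (lam * x / \<delta>) \<le> lam * x / \<delta>" by simp
    then have "\<delta> * ln (lam * x / \<delta>) \<le> lam * x" using \<delta> by (simp add: field_simps)
    then have "(lam * x / \<delta>) powr \<delta> \<le> exp (lam * x)"
      using True assms \<delta> by (simp add: powr_def)
    then have "x powr \<delta> \<le> C * exp (lam * x)"
      using True assms \<delta> by (simp add: C_def powr_mult powr_divide field_simps)
    then have "x powr \<delta> * exp (- lam * x) \<le> C"
      by (simp add: exp_minus field_simps)
    then have "x powr (e - 1) * (x powr \<delta> * exp (- lam * x)) \<le> x powr (e - 1) * C"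
      by (intro mult_left_mono) auto
    moreover have "x powr (d - 1) = x powr (e - 1) * x powr \<delta>"
      by (simp add: \<delta>_def flip: powr_add)
    ultimately show ?thesis using True by (simp add: tempered_power_def mult_ac del: mult_le_cancel_left)
  qed (simp add: tempered_power_def)
  moreover have "C > 0" using \<delta> assms by (simp add: C_def)
  ultimately show ?thesis by blast
qed

section \<open>Rounding to the grid of mesh 1/N\<close>

definition grid_up :: "nat \<Rightarrow> real \<Rightarrow> real" where
  "grid_up N x = of_int \<lceil>real N * x\<rceil> / real N"

lemma grid_up_measurable [measurable]: "grid_up N \<in> borel_measurable borel"
  unfolding grid_up_def[abs_def] by measurable

lemma grid_up_bounds:
  assumes "N > 0"
  shows "x \<le> grid_up N x" "grid_up N x < x + 1 / real N"
proof -
  show "x \<le> grid_up N x" using assms by (simp add: grid_up_def field_simps)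
  have "of_int \<lceil>real N * x\<rceil> < real N * x + 1" by linarith
  then show "grid_up N x < x + 1 / real N" using assms by (simp add: grid_up_def field_simps)
qed

lemma grid_up_tendsto: "(\<lambda>N. grid_up N x) \<longlonglongrightarrow> x"
proof (rule tendsto_sandwich)
  show "eventually (\<lambda>N. x \<le> grid_up N x) sequentially"
    "eventually (\<lambda>N. grid_up N x \<le> x + 1 / real N) sequentially"
    by (auto intro!: eventually_mono[OF eventually_gt_at_top[of 0]] grid_up_bounds(1) less_imp_le[OF grid_up_bounds(2)])
  show "(\<lambda>N. x + 1 / real N) \<longlonglongrightarrow> x"
    using tendsto_add[OF tendsto_const lim_1_over_n, of x] by simp
qed auto

text \<open>If the rounded points are not strictly ordered the left side is 0, which removes the
  singularity. Otherwise they differ by at least 1/N, so s - y is at most twice the rounded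
  distance, and the negative exponent e - 1 yields the factor 2^(1-e).\<close>

lemma tempered_power_grid_le:
  assumes "N > 0" "e < 1"
  shows "tempered_power e 0 (grid_up N s - grid_up N y) \<le> 2 powr (1 - e) * tempered_power e 0 (s - y)"
proof (cases "grid_up N s - grid_up N y > 0")
  case True
  then have lt: "\<lceil>real N * y\<rceil> < \<lceil>real N * s\<rceil>" using assms by (simp add: grid_up_def divide_simps)
  then have sy: "s > y"
    using assms by (metis ceiling_mono leD linorder_not_le mult_left_mono of_nat_0_le_iff)
  have "real_of_int \<lceil>real N * y\<rceil> + 1 \<le> real_of_int \<lceil>real N * s\<rceil>" using lt by linarith
  then have "1 / real N \<le> grid_up N s - grid_up N y"
    using assms by (simp add: grid_up_def field_simps)
  moreover have "s - y < grid_up N s - grid_up N y + 1 / real N"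
    using grid_up_bounds[OF assms(1), of s] grid_up_bounds[OF assms(1), of y] by linarith
  ultimately have "s - y \<le> 2 * (grid_up N s - grid_up N y)"
    by (smt (verit))
  then have "(s - y) / 2 \<le> grid_up N s - grid_up N y" by simp
  then have "(grid_up N s - grid_up N y) powr (e - 1) \<le> ((s - y) / 2) powr (e - 1)"
    using sy assms by (intro powr_mono2') auto
  also have "\<dots> = 2 powr (1 - e) * (s - y) powr (e - 1)"
    using sy by (simp add: powr_divide powr_diff field_simps)
  finally show ?thesis using True sy by (simp add: tempered_power_def)
qed (simp add: tempered_power_def)

lemma isCont_tempered_power: "x \<noteq> 0 \<Longrightarrow> isCont (tempered_power d lam) x"
proof -
  assume "x \<noteq> 0"
  then consider "x > 0" | "x < 0" by linarith
  then show ?thesis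
  proof cases
    case 1
    have "isCont (\<lambda>x. x powr (d - 1) * exp (- lam * x)) x" using 1 by (intro continuous_intros) auto
    moreover have "eventually (\<lambda>y. tempered_power d lam y = y powr (d - 1) * exp (- lam * y)) (nhds x)"
      using eventually_nhds_in_open[of "{0<..}" x] 1 by (auto elim!: eventually_mono simp: tempered_power_def)
    ultimately show ?thesis by (subst isCont_cong)
  next
    case 2
    have "eventually (\<lambda>y. tempered_power d lam y = 0) (nhds x)"
      using eventually_nhds_in_open[of "{..<0}" x] 2 by (auto elim!: eventually_mono simp: tempered_power_def)
    then show ?thesis by (subst isCont_cong) auto
  qed
qed

section \<open>A maximal inequality in mean square\<close>

text \<open>Minkowski's inequality in L2, from (u + v)^2 <= (1 + y/x) u^2 + (1 + x/y) v^2, whose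
  weights turn the bounds x^2 and y^2 into exactly (x + y)^2.\<close>

lemma nn_integral_square_triangle:
  fixes U V :: "'a \<Rightarrow> real"
  assumes [measurable]: "U \<in> borel_measurable M" "V \<in> borel_measurable M"
    and U: "mean_sq M U \<le> ennreal (x\<^sup>2)"
    and V: "mean_sq M V \<le> ennreal (y\<^sup>2)"
    and xy: "0 < x" "0 < y"
  shows "mean_sq M (\<lambda>\<omega>. U \<omega> + V \<omega>) \<le> ennreal ((x + y)\<^sup>2)"
proof -
  have le: "(u + v)\<^sup>2 \<le> (1 + y / x) * u\<^sup>2 + (1 + x / y) * v\<^sup>2" for u v
  proof -
    have "0 \<le> (y * u - x * v)\<^sup>2 / (x * y)" using xy by simp
    also have "\<dots> = (1 + y / x) * u\<^sup>2 + (1 + x / y) * v\<^sup>2 - (u + v)\<^sup>2"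
      using xy by (simp add: field_simps power2_eq_square)
    finally show ?thesis by simp
  qed
  have "mean_sq M (\<lambda>\<omega>. U \<omega> + V \<omega>)
      \<le> (\<integral>\<^sup>+\<omega>. ennreal (1 + y / x) * ennreal ((U \<omega>)\<^sup>2) + ennreal (1 + x / y) * ennreal ((V \<omega>)\<^sup>2) \<partial>M)"
    using xy by (intro nn_integral_mono)
      (simp add: le ennreal_leI flip: ennreal_mult ennreal_plus)
  also have "\<dots> = ennreal (1 + y / x) * mean_sq M U
      + ennreal (1 + x / y) * mean_sq M V"
    by (simp add: nn_integral_add nn_integral_cmult)
  also have "\<dots> \<le> ennreal (1 + y / x) * ennreal (x\<^sup>2) + ennreal (1 + x / y) * ennreal (y\<^sup>2)"
    by (intro add_mono mult_left_mono U V) auto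
  also have "\<dots> = ennreal ((1 + y / x) * x\<^sup>2 + (1 + x / y) * y\<^sup>2)"
    using xy by (simp flip: ennreal_mult ennreal_plus)
  also have "(1 + y / x) * x\<^sup>2 + (1 + x / y) * y\<^sup>2 = (x + y)\<^sup>2"
    using xy by (simp add: field_simps power2_eq_square)
  finally show ?thesis .
qed

text \<open>The negative term makes the induction on \<open>r\<close> close: it absorbs the increments between even and
  odd indices.\<close>

lemma maximal_dyadic:
  fixes S :: "nat \<Rightarrow> 'a \<Rightarrow> real" and \<gamma> :: real
  assumes \<gamma>: "\<gamma> > 1/2" and A: "A > 0"
    and "\<And>n. S n \<in> borel_measurable M"
    and "\<And>m n. m \<le> n \<Longrightarrow> n \<le> 2 ^ r \<Longrightarrow>
      mean_sq M (\<lambda>\<omega>. S n \<omega> - S m \<omega>) \<le> ennreal ((A * real (n - m) powr \<gamma>)\<^sup>2)"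
  defines "K \<equiv> 1 / (2 powr \<gamma> - sqrt 2)"
  shows "\<exists>U\<in>borel_measurable M. (\<forall>a\<le>2 ^ r. \<forall>\<omega>. \<bar>S a \<omega> - S 0 \<omega>\<bar> \<le> U \<omega>) \<and>
    mean_sq M U \<le> ennreal ((A * ((K + 1) * 2 powr (r * \<gamma>) - K * 2 powr (r / 2)))\<^sup>2)"
  using A assms(3,4)
proof (induction r arbitrary: S A)
  case 0
  note [measurable] = "0.prems"(2)
  show ?case
  proof (intro bexI conjI allI impI)
    fix a \<omega> assume "a \<le> (2::nat) ^ 0"
    then have "a = 0 \<or> a = 1" by auto
    then show "\<bar>S a \<omega> - S 0 \<omega>\<bar> \<le> \<bar>S 1 \<omega> - S 0 \<omega>\<bar>" by auto
  next
    show "(\<integral>\<^sup>+\<omega>. ennreal (\<bar>S 1 \<omega> - S 0 \<omega>\<bar>\<^sup>2) \<partial>M)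
        \<le> ennreal ((A * ((K + 1) * 2 powr (real 0 * \<gamma>) - K * 2 powr (real 0 / 2)))\<^sup>2)"
      using "0.prems"(3)[of 0 1] by simp
  qed measurable
next
  case (Suc r)
  note [measurable] = Suc.prems(2)
  \<comment> \<open>\<gamma> > 1/2 makes the denominator of K positive, and K solves K 2^\<gamma> =
    K sqrt 2 + 1, the equation that closes the recursion.\<close>
  have s2: "sqrt 2 < 2 powr \<gamma>"
    using \<gamma> by (simp add: powr_half_sqrt[symmetric])
  then have K: "K > 0" and Keq: "K * 2 powr \<gamma> = K * sqrt 2 + 1"
    by (auto simp: K_def field_simps)
  have le: "2 powr (real r / 2) \<le> 2 powr (real r * \<gamma>)"
    using \<gamma> mult_left_mono[of "1/2" \<gamma> "real r"] by simp
  have pos: "(K + 1) * 2 powr (real r * \<gamma>) - K * 2 powr (real r / 2) > 0"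
  proof -
    have "K * 2 powr (real r / 2) \<le> K * 2 powr (real r * \<gamma>)"
      using K le by (intro mult_left_mono) auto
    moreover have "K * 2 powr (real r * \<gamma>) < (K + 1) * 2 powr (real r * \<gamma>)"
      by (simp add: algebra_simps)
    ultimately show ?thesis by linarith
  qed
  \<comment> \<open>The induction hypothesis is applied to the even-indexed subsequence, where n - m
    steps span 2 (n - m) original ones: A becomes A 2^\<gamma>.\<close>
  have "\<exists>U\<in>borel_measurable M. (\<forall>a\<le>2 ^ r. \<forall>\<omega>. \<bar>S (2 * a) \<omega> - S (2 * 0) \<omega>\<bar> \<le> U \<omega>) \<and>
    mean_sq M U
      \<le> ennreal ((A * 2 powr \<gamma> * ((K + 1) * 2 powr (r * \<gamma>) - K * 2 powr (r / 2)))\<^sup>2)"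
  proof (rule Suc.IH)
    fix m n :: nat assume mn: "m \<le> n" "n \<le> 2 ^ r"
    have "mean_sq M (\<lambda>\<omega>. S (2 * n) \<omega> - S (2 * m) \<omega>)
        \<le> ennreal ((A * real (2 * n - 2 * m) powr \<gamma>)\<^sup>2)"
      using mn by (intro Suc.prems(3)) auto
    also have "real (2 * n - 2 * m) powr \<gamma> = 2 powr \<gamma> * real (n - m) powr \<gamma>"
      by (simp add: powr_mult flip: diff_mult_distrib2)
    finally show "mean_sq M (\<lambda>\<omega>. S (2 * n) \<omega> - S (2 * m) \<omega>)
        \<le> ennreal ((A * 2 powr \<gamma> * real (n - m) powr \<gamma>)\<^sup>2)" by (simp add: mult.assoc)
  qed (use Suc.prems in auto)
  then obtain U where [measurable]: "U \<in> borel_measurable M"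
    and U: "\<And>a \<omega>. a \<le> 2 ^ r \<Longrightarrow> \<bar>S (2 * a) \<omega> - S 0 \<omega>\<bar> \<le> U \<omega>"
    and IU: "mean_sq M U
      \<le> ennreal ((A * 2 powr \<gamma> * ((K + 1) * 2 powr (r * \<gamma>) - K * 2 powr (r / 2)))\<^sup>2)"
    by auto
  \<comment> \<open>The l2 norm of the odd steps dominates their maximum, and its mean square is at
    most 2^r single-step bounds A^2; the resulting growth 2^(r/2) is affordable because \<gamma> >
    1/2.\<close>
  define V where "V \<omega> = sqrt (\<Sum>b<2 ^ r. (S (2 * b + 1) \<omega> - S (2 * b) \<omega>)\<^sup>2)" for \<omega>
  have [measurable]: "V \<in> borel_measurable M" unfolding V_def by measurable
  have V: "\<bar>S (2 * b + 1) \<omega> - S (2 * b) \<omega>\<bar> \<le> V \<omega>" if "b < 2 ^ r" for b \<omega>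
    unfolding V_def
    by (rule real_le_rsqrt) (use that in \<open>auto intro!: member_le_sum[of b "{..<2^r}" "\<lambda>b. (S (2 * b + 1) \<omega> - S (2 * b) \<omega>)\<^sup>2", simplified]\<close>)
  have V0: "V \<omega> \<ge> 0" for \<omega> unfolding V_def by (auto intro: sum_nonneg)
  have "mean_sq M V
      = (\<Sum>b<2 ^ r. \<integral>\<^sup>+\<omega>. ennreal ((S (2 * b + 1) \<omega> - S (2 * b) \<omega>)\<^sup>2) \<partial>M)"
    by (subst nn_integral_sum[symmetric]) (auto simp: V_def sum_nonneg)
  also have "\<dots> \<le> (\<Sum>b<(2::nat) ^ r. ennreal (A\<^sup>2))"
  proof (rule sum_mono)
    fix b assume "b \<in> {..<(2::nat) ^ r}"
    then have "b + 1 \<le> 2 ^ r" by simp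
    then have "2 * b + 1 \<le> 2 ^ Suc r" by simp
    then show "mean_sq M (\<lambda>\<omega>. S (2 * b + 1) \<omega> - S (2 * b) \<omega>) \<le> ennreal (A\<^sup>2)"
      using Suc.prems(3)[of "2 * b" "2 * b + 1"] by simp
  qed
  also have "\<dots> = ennreal (2 ^ r * A\<^sup>2)"
    by (simp add: ennreal_of_nat_eq_real_of_nat flip: ennreal_mult)
  also have "2 ^ r * A\<^sup>2 = (A * 2 powr (real r / 2))\<^sup>2"
    by (simp add: power_mult_distrib powr_realpow[symmetric] flip: powr_numeral)
      (simp add: powr_powr mult.commute)
  finally have IV: "mean_sq M V \<le> ennreal ((A * 2 powr (real r / 2))\<^sup>2)" .
  show ?case
  proof (intro bexI[of _ "\<lambda>\<omega>. U \<omega> + V \<omega>"] conjI allI impI)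
    fix a \<omega> assume a: "a \<le> (2::nat) ^ Suc r"
    show "\<bar>S a \<omega> - S 0 \<omega>\<bar> \<le> U \<omega> + V \<omega>"
    proof (cases "even a")
      case True
      then obtain b where "a = 2 * b" by auto
      with a U[of b \<omega>] V0[of \<omega>] show ?thesis by simp
    next
      case False
      then obtain b where b: "a = 2 * b + 1" using oddE by blast
      with a have "b < 2 ^ r" by simp
      from U[of b \<omega>] V[OF this, of \<omega>] this show ?thesis by (simp add: b)
    qed
  next
    have "mean_sq M (\<lambda>\<omega>. U \<omega> + V \<omega>)
        \<le> ennreal ((A * 2 powr \<gamma> * ((K + 1) * 2 powr (r * \<gamma>) - K * 2 powr (r / 2))
          + A * 2 powr (real r / 2))\<^sup>2)"
      by (rule nn_integral_square_triangle[OF _ _ IU IV]) (use Suc.prems(1) pos in auto)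
    also have "A * 2 powr \<gamma> * ((K + 1) * 2 powr (r * \<gamma>) - K * 2 powr (r / 2)) + A * 2 powr (real r / 2)
        = A * ((K + 1) * 2 powr (Suc r * \<gamma>) - K * 2 powr (Suc r / 2))"
    proof -
      have 1: "2 powr (Suc r * \<gamma>) = 2 powr \<gamma> * 2 powr (r * \<gamma>)"
        by (simp add: algebra_simps flip: powr_add)
      have 2: "2 powr (Suc r / 2) = sqrt 2 * 2 powr (r / 2)"
        by (simp add: algebra_simps add_divide_distrib flip: powr_add powr_half_sqrt)
      show ?thesis unfolding 1 2 using Keq by algebra
    qed
    finally show "mean_sq M (\<lambda>\<omega>. U \<omega> + V \<omega>)
        \<le> ennreal ((A * ((K + 1) * 2 powr (Suc r * \<gamma>) - K * 2 powr (Suc r / 2)))\<^sup>2)" .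
  qed measurable
qed

text \<open>The first factor is the leading coefficient K + 1 of the dyadic bound; 2^\<gamma>
  accounts for enlarging the length to a power of two that is at most twice as large.\<close>

definition maximal_const :: "real \<Rightarrow> real" where
  "maximal_const \<gamma> = (1 / (2 powr \<gamma> - sqrt 2) + 1) * 2 powr \<gamma>"

text \<open>The dyadic case applies after extending the sequence constantly beyond v, up to the
  least power of two that is not below v - u.\<close>

lemma maximal_inequality:
  fixes S :: "nat \<Rightarrow> 'a \<Rightarrow> real" and \<gamma> :: real
  assumes \<gamma>: "\<gamma> > 1/2" and A: "A > 0"
    and meas [measurable]: "\<And>n. S n \<in> borel_measurable M"
    and incr: "\<And>m n. u \<le> m \<Longrightarrow> m \<le> n \<Longrightarrow> n \<le> v \<Longrightarrow>
      mean_sq M (\<lambda>\<omega>. S n \<omega> - S m \<omega>) \<le> ennreal ((A * real (n - m) powr \<gamma>)\<^sup>2)"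
    and uv: "u \<le> v"
  shows "\<exists>U\<in>borel_measurable M. (\<forall>n\<in>{u..v}. \<forall>\<omega>. \<bar>S n \<omega> - S u \<omega>\<bar> \<le> U \<omega>) \<and>
    mean_sq M U \<le> ennreal ((A * maximal_const \<gamma> * real (v - u) powr \<gamma>)\<^sup>2)"
proof (cases "u = v")
  case True
  then show ?thesis by (intro bexI[of _ "\<lambda>_. 0"]) auto
next
  case False
  define L where "L = v - u"
  have L: "L \<ge> 1" using False uv by (simp add: L_def)
  define r where "r = (LEAST r. L \<le> 2 ^ r)"
  have "L \<le> 2 ^ L" by (simp add: less_imp_le)
  then have r: "L \<le> 2 ^ r" unfolding r_def by (rule LeastI)
  have r2: "2 ^ r \<le> 2 * L"
  proof (cases r)
    case (Suc q)
    then have "\<not> L \<le> 2 ^ q" using not_less_Least[of q "\<lambda>r. L \<le> 2 ^ r"] by (simp add: r_def)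
    then show ?thesis by (simp add: Suc)
  qed (use L in simp)
  define K where "K = 1 / (2 powr \<gamma> - sqrt 2)"
  have s2: "sqrt 2 < 2 powr \<gamma>"
    using \<gamma> by (simp add: powr_half_sqrt[symmetric])
  then have K: "K > 0" by (simp add: K_def)
  define S' where "S' a = S (min (u + a) v)" for a
  have [measurable]: "S' a \<in> borel_measurable M" for a by (simp add: S'_def)
  have "\<exists>U\<in>borel_measurable M. (\<forall>a\<le>2 ^ r. \<forall>\<omega>. \<bar>S' a \<omega> - S' 0 \<omega>\<bar> \<le> U \<omega>) \<and>
    mean_sq M U \<le> ennreal ((A * ((K + 1) * 2 powr (r * \<gamma>) - K * 2 powr (r / 2)))\<^sup>2)"
    unfolding K_def
  proof (rule maximal_dyadic[OF \<gamma> A])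
    fix m n :: nat assume mn: "m \<le> n"
    have "mean_sq M (\<lambda>\<omega>. S' n \<omega> - S' m \<omega>)
        \<le> ennreal ((A * real (min (u + n) v - min (u + m) v) powr \<gamma>)\<^sup>2)"
      unfolding S'_def using mn uv by (intro incr) auto
    also have "\<dots> \<le> ennreal ((A * real (n - m) powr \<gamma>)\<^sup>2)"
      using mn A \<gamma> by (intro ennreal_leI power_mono mult_left_mono powr_mono2) auto
    finally show "mean_sq M (\<lambda>\<omega>. S' n \<omega> - S' m \<omega>) \<le> ennreal ((A * real (n - m) powr \<gamma>)\<^sup>2)" .
  qed simp
  then obtain U where [measurable]: "U \<in> borel_measurable M"
    and U: "\<And>a \<omega>. a \<le> 2 ^ r \<Longrightarrow> \<bar>S' a \<omega> - S' 0 \<omega>\<bar> \<le> U \<omega>"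
    and IU: "mean_sq M U
      \<le> ennreal ((A * ((K + 1) * 2 powr (r * \<gamma>) - K * 2 powr (r / 2)))\<^sup>2)"
    by auto
  show ?thesis
  proof (intro bexI[of _ U] conjI ballI allI)
    fix n \<omega> assume n: "n \<in> {u..v}"
    then have "n - u \<le> 2 ^ r" using r by (auto simp: L_def)
    from U[OF this, of \<omega>] n uv show "\<bar>S n \<omega> - S u \<omega>\<bar> \<le> U \<omega>"
      by (simp add: S'_def)
  next
    have "(K + 1) * 2 powr (r * \<gamma>) - K * 2 powr (r / 2) \<le> (K + 1) * (2 ^ r) powr \<gamma>"
      using K by (simp add: powr_realpow[symmetric] powr_powr)
    also have "\<dots> \<le> (K + 1) * (2 * real L) powr \<gamma>"
    proof (intro mult_left_mono powr_mono2)
      have "real (2 ^ r) \<le> real (2 * L)" using r2 by (simp only: of_nat_le_iff)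
      then show "2 ^ r \<le> 2 * real L" by simp
    qed (use \<gamma> K in auto)
    also have "\<dots> = maximal_const \<gamma> * real L powr \<gamma>"
      by (simp add: powr_mult maximal_const_def K_def)
    finally have up: "(K + 1) * 2 powr (r * \<gamma>) - K * 2 powr (r / 2) \<le> maximal_const \<gamma> * real L powr \<gamma>" .
    have le: "2 powr (real r / 2) \<le> 2 powr (real r * \<gamma>)"
      using \<gamma> mult_left_mono[of "1/2" \<gamma> "real r"] by simp
    have "K * 2 powr (real r / 2) \<le> (K + 1) * 2 powr (real r * \<gamma>)"
      using K le by (intro mult_mono) auto
    then have lo: "0 \<le> (K + 1) * 2 powr (r * \<gamma>) - K * 2 powr (r / 2)" by simp
    have "mean_sq M U
      \<le> ennreal ((A * (maximal_const \<gamma> * real L powr \<gamma>))\<^sup>2)"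
      using lo up A by (intro order_trans[OF IU] ennreal_leI power_mono mult_left_mono) auto
    then show "mean_sq M U \<le> ennreal ((A * maximal_const \<gamma> * real (v - u) powr \<gamma>)\<^sup>2)"
      by (simp add: L_def mult.assoc)
  qed measurable
qed

section \<open>Weak convergence in metric spaces\<close>

lemma space_borel_of_topology [simp]: "space (borel_of_topology T) = topspace T"
  unfolding borel_of_topology_def by (rule space_measure_of) (auto dest: openin_subset)

lemma sets_borel_of_topology_open: "openin T U \<Longrightarrow> U \<in> sets (borel_of_topology T)"
  unfolding borel_of_topology_def by (subst sets_measure_of) (auto dest: openin_subset)

lemma measurable_borel_of_topologyI:
  assumes "\<And>\<omega>. \<omega> \<in> space M \<Longrightarrow> X \<omega> \<in> topspace T"
    and "\<And>U. openin T U \<Longrightarrow> X -` U \<inter> space M \<in> sets M"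
  shows "X \<in> M \<rightarrow>\<^sub>M borel_of_topology T"
  unfolding borel_of_topology_def
  by (rule measurable_measure_of) (use assms in \<open>auto dest: openin_subset\<close>)

lemma borel_measurable_continuous_map:
  assumes "continuous_map T (euclidean :: real topology) f"
  shows "f \<in> borel_measurable (borel_of_topology T)"
proof (rule borel_measurableI)
  fix S :: "real set" assume "open S"
  then have "openin T {x \<in> topspace T. f x \<in> S}"
    using assms by (intro openin_continuous_map_preimage) auto
  then show "f -` S \<inter> space (borel_of_topology T) \<in> sets (borel_of_topology T)"
    using sets_borel_of_topology_open by (auto simp: vimage_def Int_def conj_commute)
qed

section \<open>Measurable limits and Lipschitz test functions\<close>

context Metric_space
begin

lemma continuous_map_lipschitz:
  assumes "\<And>x y. x \<in> M \<Longrightarrow> y \<in> M \<Longrightarrow> \<bar>f x - f y\<bar> \<le> L * d x y"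
  shows "continuous_map mtopology (euclidean :: real topology) f"
  unfolding continuous_map_def
proof safe
  fix S :: "real set" assume "openin euclidean S"
  then have S: "open S" by simp
  show "openin mtopology {x \<in> topspace mtopology. f x \<in> S}"
    unfolding openin_mtopology
  proof safe
    fix x assume x: "x \<in> topspace mtopology" "f x \<in> S"
    then obtain e where e: "e > 0" "\<And>r. \<bar>r - f x\<bar> < e \<Longrightarrow> r \<in> S"
      using S unfolding open_dist dist_real_def by blast
    \<comment> \<open>L may be 0 or negative, so it is replaced by a positive constant before
      dividing.\<close>
    define L' where "L' = max L 1"
    show "\<exists>r>0. mball x r \<subseteq> {x \<in> topspace mtopology. f x \<in> S}"
    proof (intro exI[of _ "e / L'"] conjI subsetI)
      fix y assume y: "y \<in> mball x (e / L')"
      have "\<bar>f y - f x\<bar> \<le> L * d x y" using y assms[of y x] by (auto simp: commute)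
      also have "\<dots> \<le> L' * d x y" by (intro mult_right_mono) (auto simp: L'_def)
      also have "\<dots> < e" using y by (auto simp: L'_def field_simps)
      finally show "y \<in> {x \<in> topspace mtopology. f x \<in> S}" using e y by auto
    qed (use e in \<open>auto simp: L'_def\<close>)
  qed auto
qed auto

text \<open>The limit lies in an open U iff, for some j, all late members lie in the set W j of
  points whose ball of radius 1/(j+1) stays inside U. Each W j is closed and only countable
  operations occur, which gives measurability also in a nonseparable space.\<close>

lemma measurable_metric_limit:
  assumes Y: "\<And>m. Y m \<in> N \<rightarrow>\<^sub>M borel_of_topology mtopology"
    and Z: "\<And>\<omega>. \<omega> \<in> space N \<Longrightarrow> Z \<omega> \<in> M"
    and lim: "\<And>\<omega>. \<omega> \<in> space N \<Longrightarrow> (\<lambda>m. d (Y m \<omega>) (Z \<omega>)) \<longlonglongrightarrow> 0"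
  shows "Z \<in> N \<rightarrow>\<^sub>M borel_of_topology mtopology"
proof (rule measurable_borel_of_topologyI)
  fix U assume U: "openin mtopology U"
  then have UM: "U \<subseteq> M" using openin_subset[of mtopology U] by simp
  define W where "W j = {x\<in>M. mball x (inverse (real (Suc j))) \<subseteq> U}" for j
  have YM: "Y m \<omega> \<in> M" if "\<omega> \<in> space N" for m \<omega>
    using measurable_space[OF Y that] by simp
  have W: "W j \<in> sets (borel_of_topology mtopology)" for j
  proof -
    let ?r = "inverse (real (Suc j))"
    have "W j = M - (\<Union>y\<in>M - U. mball y ?r)"
      by (auto simp: W_def commute)
    moreover have "openin mtopology (\<Union>y\<in>M - U. mball y ?r)" by auto
    then have "space (borel_of_topology mtopology) - (\<Union>y\<in>M - U. mball y ?r) \<in> sets (borel_of_topology mtopology)"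
      by (intro sets.compl_sets sets_borel_of_topology_open)
    ultimately show ?thesis by simp
  qed
  have "Z -` U \<inter> space N = (\<Union>j m. \<Inter>n\<in>{m..}. Y n -` W j \<inter> space N)"
  proof (intro equalityI subsetI)
    fix \<omega> assume "\<omega> \<in> Z -` U \<inter> space N"
    then have w: "\<omega> \<in> space N" "Z \<omega> \<in> U" by auto
    with U obtain r where r: "r > 0" "mball (Z \<omega>) r \<subseteq> U"
      unfolding openin_mtopology by blast
    obtain j where j: "inverse (real (Suc j)) < r / 2" using reals_Archimedean[of "r/2"] r by auto
    have "eventually (\<lambda>m. d (Y m \<omega>) (Z \<omega>) < r / 2) sequentially"
      using lim[OF w(1)] r by (intro order_tendstoD) auto
    then obtain m where m: "\<And>n. n \<ge> m \<Longrightarrow> d (Y n \<omega>) (Z \<omega>) < r / 2"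
      by (auto simp: eventually_sequentially)
    have "Y n \<omega> \<in> W j" if "n \<ge> m" for n
    proof -
      have "mball (Y n \<omega>) (inverse (real (Suc j))) \<subseteq> mball (Z \<omega>) r"
      proof
        fix y assume y: "y \<in> mball (Y n \<omega>) (inverse (real (Suc j)))"
        then have "d (Z \<omega>) y \<le> d (Z \<omega>) (Y n \<omega>) + d (Y n \<omega>) y"
          using YM Z w by (intro triangle) auto
        then show "y \<in> mball (Z \<omega>) r"
          using m[OF that] y j Z[OF w(1)] by (auto simp: commute)
      qed
      then show ?thesis using r YM[OF w(1)] by (auto simp: W_def)
    qed
    then show "\<omega> \<in> (\<Union>j m. \<Inter>n\<in>{m..}. Y n -` W j \<inter> space N)" using w by blast
  next
    fix \<omega> assume "\<omega> \<in> (\<Union>j m. \<Inter>n\<in>{m..}. Y n -` W j \<inter> space N)"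
    then obtain j m where "\<omega> \<in> (\<Inter>n\<in>{m..}. Y n -` W j \<inter> space N)" by auto
    then have w: "\<omega> \<in> space N" and n: "\<And>n. n \<ge> m \<Longrightarrow> Y n \<omega> \<in> W j" by auto
    have "eventually (\<lambda>n. d (Y n \<omega>) (Z \<omega>) < inverse (real (Suc j)) \<and> n \<ge> m) sequentially"
      using lim[OF w] by (intro eventually_conj order_tendstoD eventually_ge_at_top) auto
    then obtain q where q: "d (Y q \<omega>) (Z \<omega>) < inverse (real (Suc j))" "q \<ge> m"
      by (auto simp: eventually_sequentially)
    then have "Z \<omega> \<in> mball (Y q \<omega>) (inverse (real (Suc j)))" using w Z YM by auto
    then have "Z \<omega> \<in> U" using n[OF q(2)] by (auto simp: W_def)
    then show "\<omega> \<in> Z -` U \<inter> space N" using w by simp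
  qed
  moreover have "(\<Union>j m. \<Inter>n\<in>{m..}. Y n -` W j \<inter> space N) \<in> sets N"
  proof -
    have "(\<Inter>n\<in>{m..}. Y n -` W j \<inter> space N) \<in> sets N" for j m
      using measurable_sets[OF Y W] by (intro sets.countable_INT') auto
    then show ?thesis by (intro sets.countable_UN image_subsetI) auto
  qed
  ultimately show "Z -` U \<inter> space N \<in> sets N" by simp
qed (use Z in auto)

text \<open>The Pasch-Hausdorff envelope: the largest minorant of a bounded f that is Lipschitz with
  constant j.\<close>

definition lipschitz_minorant :: "('a \<Rightarrow> real) \<Rightarrow> nat \<Rightarrow> 'a \<Rightarrow> real" where
  "lipschitz_minorant f j x = (INF y\<in>M. f y + real j * d x y)"

lemma
  assumes f: "continuous_map mtopology (euclidean :: real topology) f"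
    and B: "\<And>x. x \<in> M \<Longrightarrow> \<bar>f x\<bar> \<le> B"
  shows lipschitz_minorant_le: "x \<in> M \<Longrightarrow> lipschitz_minorant f j x \<le> f x"
    and lipschitz_minorant_bound: "x \<in> M \<Longrightarrow> \<bar>lipschitz_minorant f j x\<bar> \<le> B"
    and lipschitz_minorant_lipschitz: "x \<in> M \<Longrightarrow> y \<in> M \<Longrightarrow>
      \<bar>lipschitz_minorant f j x - lipschitz_minorant f j y\<bar> \<le> real j * d x y"
    and lipschitz_minorant_tendsto: "x \<in> M \<Longrightarrow> (\<lambda>j. lipschitz_minorant f j x) \<longlonglongrightarrow> f x"
proof -
  have bdd: "bdd_below ((\<lambda>y. f y + real j * d x y) ` M)" for x j
    using B by (intro bdd_belowI2[of _ "-B"]) (fastforce intro: add_increasing2)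
  show le: "lipschitz_minorant f j x \<le> f x" if "x \<in> M" for x j
    using cINF_lower[OF bdd[of j x] that] that by (simp add: lipschitz_minorant_def)
  have ge: "- B \<le> lipschitz_minorant f j x" if "x \<in> M" for x j
    unfolding lipschitz_minorant_def using that B by (intro cINF_greatest) (fastforce intro: add_increasing2)+
  show "\<bar>lipschitz_minorant f j x\<bar> \<le> B" if "x \<in> M" for x j
    using ge[OF that] le[OF that] B[OF that] by (smt (verit))
  have one: "lipschitz_minorant f j x \<le> lipschitz_minorant f j y + real j * d x y" if xy: "x \<in> M" "y \<in> M" for x y j
  proof -
    have "lipschitz_minorant f j x - real j * d x y \<le> lipschitz_minorant f j y"
      unfolding lipschitz_minorant_def[of f j y]
    proof (rule cINF_greatest)
      fix z assume z: "z \<in> M"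
      have "lipschitz_minorant f j x \<le> f z + real j * d x z"
        unfolding lipschitz_minorant_def by (rule cINF_lower[OF bdd z])
      also have "real j * d x z \<le> real j * (d x y + d y z)"
        using xy z by (intro mult_left_mono triangle) auto
      finally show "lipschitz_minorant f j x - real j * d x y \<le> f z + real j * d y z"
        by (simp add: algebra_simps)
    qed (use xy in auto)
    then show ?thesis by simp
  qed
  show "\<bar>lipschitz_minorant f j x - lipschitz_minorant f j y\<bar> \<le> real j * d x y" if "x \<in> M" "y \<in> M" for x y j
    using one[OF that, of j] one[OF that(2,1), of j] by (auto simp: commute)
  show "(\<lambda>j. lipschitz_minorant f j x) \<longlonglongrightarrow> f x" if x: "x \<in> M" for x
  proof (rule order_tendstoI)
    fix a assume "a < f x"
    define e where "e = (f x - a) / 2"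
    have e: "e > 0" using \<open>a < f x\<close> by (simp add: e_def)
    have "openin mtopology {y \<in> topspace mtopology. f y \<in> {f x - e<..}}"
      using f by (intro openin_continuous_map_preimage) auto
    moreover have "x \<in> {y \<in> topspace mtopology. f y \<in> {f x - e<..}}" using x e by simp
    ultimately obtain r where r: "r > 0" "mball x r \<subseteq> {y \<in> topspace mtopology. f y \<in> {f x - e<..}}"
      unfolding openin_mtopology by blast
    \<comment> \<open>J makes points outside the ball harmless: at distance r or more the penalty is
      at least 2 B, the largest possible drop of f.\<close>
    obtain J :: nat where J: "2 * B / r \<le> real J" using real_arch_simple by blast
    have "a < lipschitz_minorant f j x" if "j \<ge> J" for j
    proof -
      have "f x - e \<le> lipschitz_minorant f j x"
        unfolding lipschitz_minorant_def
      proof (rule cINF_greatest)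
        fix y assume y: "y \<in> M"
        show "f x - e \<le> f y + real j * d x y"
        proof (cases "d x y < r")
          case True
          then have "f x - e < f y" using r(2) x y by auto
          then show ?thesis using nonneg[of x y] by (intro add_increasing2) auto
        next
          case False
          have "2 * B \<le> real J * r" using J r by (simp add: field_simps)
          also have "\<dots> \<le> real j * d x y" using False that r by (intro mult_mono) auto
          finally show ?thesis using B[OF x] B[OF y] e by (smt (verit))
        qed
      qed (use x in auto)
      then show ?thesis using e by (simp add: e_def field_simps)
    qed
    then show "eventually (\<lambda>j. a < lipschitz_minorant f j x) sequentially"
      by (auto simp: eventually_sequentially)
  next
    fix a assume "f x < a"
    then show "eventually (\<lambda>j. lipschitz_minorant f j x < a) sequentially"
      by (intro always_eventually allI le_less_trans[OF le[OF x]])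
  qed
qed

text \<open>A bounded continuous f is the pointwise limit of Lipschitz functions below it, which
  bounds the integrals from below in the limit; the same argument for - f bounds them from
  above.\<close>

lemma weakly_converges_to_lipschitzI:
  fixes P :: "'p measure" and P' :: "'q measure"
  assumes P: "prob_space P" and P': "prob_space P'"
    and X: "\<And>N. X N \<in> P \<rightarrow>\<^sub>M borel_of_topology mtopology"
    and Z: "Z \<in> P' \<rightarrow>\<^sub>M borel_of_topology mtopology"
    and lip: "\<And>f B L. (\<And>x. x \<in> M \<Longrightarrow> \<bar>f x\<bar> \<le> B) \<Longrightarrow>
      (\<And>x y. x \<in> M \<Longrightarrow> y \<in> M \<Longrightarrow> \<bar>f x - f y\<bar> \<le> L * d x y) \<Longrightarrow>
      (\<lambda>N. \<integral>\<omega>. f (X N \<omega>) \<partial>P) \<longlonglongrightarrow> (\<integral>\<omega>. f (Z \<omega>) \<partial>P')"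
  shows "weakly_converges_to mtopology P X P' Z"
proof -
  interpret P: prob_space P by fact
  interpret P': prob_space P' by fact
  have XM: "X N \<omega> \<in> M" if "\<omega> \<in> space P" for N \<omega> using measurable_space[OF X that] by simp
  have ZM: "Z \<omega> \<in> M" if "\<omega> \<in> space P'" for \<omega> using measurable_space[OF Z that] by simp
  have lower: "eventually (\<lambda>N. a < (\<integral>\<omega>. f (X N \<omega>) \<partial>P)) sequentially"
    if f: "continuous_map mtopology (euclidean :: real topology) f"
      and B: "\<And>x. x \<in> M \<Longrightarrow> \<bar>f x\<bar> \<le> B" and a: "a < (\<integral>\<omega>. f (Z \<omega>) \<partial>P')" for f B a
  proof -
    let ?g = "lipschitz_minorant f"
    note g = lipschitz_minorant_le[OF f B] lipschitz_minorant_bound[OF f B]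
      lipschitz_minorant_lipschitz[OF f B] lipschitz_minorant_tendsto[OF f B]
    have [measurable]: "?g j \<in> borel_measurable (borel_of_topology mtopology)" for j
      by (rule borel_measurable_continuous_map[OF continuous_map_lipschitz[OF g(3)]])
    have [measurable]: "f \<in> borel_measurable (borel_of_topology mtopology)"
      by (rule borel_measurable_continuous_map[OF f])
    note [measurable] = X Z
    have "(\<lambda>j. \<integral>\<omega>. ?g j (Z \<omega>) \<partial>P') \<longlonglongrightarrow> (\<integral>\<omega>. f (Z \<omega>) \<partial>P')"
      by (rule integral_dominated_convergence[where w="\<lambda>_. B"]) (auto intro!: AE_I2 g ZM)
    then obtain j where j: "a < (\<integral>\<omega>. ?g j (Z \<omega>) \<partial>P')"
      using order_tendstoD(1)[OF _ a] eventually_happens'[OF sequentially_bot] by blast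
    have "(\<lambda>N. \<integral>\<omega>. ?g j (X N \<omega>) \<partial>P) \<longlonglongrightarrow> (\<integral>\<omega>. ?g j (Z \<omega>) \<partial>P')"
      by (rule lip[OF g(2,3)])
    from order_tendstoD(1)[OF this j] show ?thesis
    proof eventually_elim
      fix N assume "a < (\<integral>\<omega>. ?g j (X N \<omega>) \<partial>P)"
      also have "\<dots> \<le> (\<integral>\<omega>. f (X N \<omega>) \<partial>P)"
        by (rule integral_mono)
          (auto intro!: g XM B P.integrable_const_bound[where B=B] AE_I2)
      finally show "a < (\<integral>\<omega>. f (X N \<omega>) \<partial>P)" .
    qed
  qed
  have "(\<lambda>N. \<integral>\<omega>. f (X N \<omega>) \<partial>P) \<longlonglongrightarrow> (\<integral>\<omega>. f (Z \<omega>) \<partial>P')"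
    if f: "continuous_map mtopology (euclidean :: real topology) f"
      and bdd: "bounded (f ` topspace mtopology)" for f
  proof -
    obtain B where B: "\<And>x. x \<in> M \<Longrightarrow> \<bar>f x\<bar> \<le> B"
      using bdd by (auto simp: bounded_iff)
    have f': "continuous_map mtopology (euclidean :: real topology) (\<lambda>x. - f x)"
      using f by (rule continuous_map_minus)
    show ?thesis
    proof (rule order_tendstoI)
      fix a assume "a < (\<integral>\<omega>. f (Z \<omega>) \<partial>P')"
      from lower[OF f B this] show "eventually (\<lambda>N. a < (\<integral>\<omega>. f (X N \<omega>) \<partial>P)) sequentially" .
    next
      fix a assume "(\<integral>\<omega>. f (Z \<omega>) \<partial>P') < a"
      then have "- a < (\<integral>\<omega>. - f (Z \<omega>) \<partial>P')" by simp
      from lower[OF f' _ this, of B] B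
      show "eventually (\<lambda>N. (\<integral>\<omega>. f (X N \<omega>) \<partial>P) < a) sequentially" by simp
    qed
  qed
  then show ?thesis unfolding weakly_converges_to_def using X Z by blast
qed

end

section \<open>Discretized kernels\<close>

text \<open>The cells ((n - 1)/N, n/N] are the level sets of the ceiling of N s, so sums over n
  become integrals on which dominated convergence can act.\<close>

lemma nn_integral_grid_step:
  fixes h :: "int \<Rightarrow> real"
  assumes N: "N > 0" and h: "\<And>n. h n \<ge> 0"
  shows "(\<integral>\<^sup>+s. ennreal (h \<lceil>real N * s\<rceil>) * indicator {of_int n1 / real N<..of_int n2 / real N} s \<partial>lborel)
    = ennreal ((\<Sum>n\<in>{n1<..n2}. h n) / real N)"
proof -
  have cell: "s \<in> {(of_int n - 1) / real N<..of_int n / real N} \<longleftrightarrow> n = \<lceil>real N * s\<rceil>" for n s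
    using N by (auto simp: field_simps ceiling_unique[symmetric]) linarith+
  have range: "s \<in> {of_int n1 / real N<..of_int n2 / real N} \<longleftrightarrow> \<lceil>real N * s\<rceil> \<in> {n1<..n2}" for s
    using N by (auto simp: field_simps less_ceiling_iff ceiling_le_iff)
  have "(\<integral>\<^sup>+s. ennreal (h \<lceil>real N * s\<rceil>) * indicator {of_int n1 / real N<..of_int n2 / real N} s \<partial>lborel)
    = (\<integral>\<^sup>+s. (\<Sum>n\<in>{n1<..n2}. ennreal (h n) * indicator {(of_int n - 1) / real N<..of_int n / real N} s) \<partial>lborel)"
  proof (intro nn_integral_cong)
    fix s :: real
    have "(\<Sum>n\<in>{n1<..n2}. ennreal (h n) * indicator {(of_int n - 1) / real N<..of_int n / real N} s)
        = (\<Sum>n\<in>{n1<..n2}. if n = \<lceil>real N * s\<rceil> then ennreal (h n) else 0)"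
      by (intro sum.cong refl) (simp only: indicator_def cell, simp)
    then show "ennreal (h \<lceil>real N * s\<rceil>) * indicator {of_int n1 / real N<..of_int n2 / real N} s
        = (\<Sum>n\<in>{n1<..n2}. ennreal (h n) * indicator {(of_int n - 1) / real N<..of_int n / real N} s)"
      by (simp only: indicator_def range) simp
  qed
  also have "\<dots> = (\<Sum>n\<in>{n1<..n2}. ennreal (h n) * ennreal (1 / real N))"
    using N by (subst nn_integral_sum) (auto simp: nn_integral_cmult_indicator diff_divide_distrib divide_right_mono intro!: sum.cong)
  also have "\<dots> = ennreal ((\<Sum>n\<in>{n1<..n2}. h n) / real N)"
    using h by (simp add: sum_distrib_right sum_divide_distrib flip: ennreal_mult)
  finally show ?thesis .
qed

text \<open>Restricted to {..<k} so that it can equal a tuple of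
  \<open>off_diagonal k UNIV\<close>.\<close>

definition grid_cell :: "nat \<Rightarrow> nat \<Rightarrow> (nat \<Rightarrow> real) \<Rightarrow> nat \<Rightarrow> int" where
  "grid_cell k N y = (\<lambda>i\<in>{..<k}. \<lceil>real N * y i\<rceil>)"

text \<open>F is arbitrary: the cell index takes countably many values, so preimages of single
  tuples decide measurability.\<close>

lemma grid_cell_compose_measurable [measurable]:
  fixes F :: "(nat \<Rightarrow> int) \<Rightarrow> real"
  shows "(\<lambda>y. F (grid_cell k N y)) \<in> borel_measurable (lebesgue_pow k)"
proof -
  have "grid_cell k N \<in> lebesgue_pow k \<rightarrow>\<^sub>M count_space ({..<k} \<rightarrow>\<^sub>E UNIV)"
  proof (subst measurable_count_space_eq_countable, safe)
    fix a :: "nat \<Rightarrow> int" assume "a \<in> {..<k} \<rightarrow>\<^sub>E UNIV"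
    then have "grid_cell k N -` {a} \<inter> space (lebesgue_pow k)
        = {y \<in> space (lebesgue_pow k). \<forall>i\<in>{..<k}. \<lceil>real N * y i\<rceil> = a i}"
      by (auto simp: grid_cell_def fun_eq_iff PiE_def extensional_def)
    also have "\<dots> \<in> sets (lebesgue_pow k)" by measurable
    finally show "grid_cell k N -` {a} \<inter> space (lebesgue_pow k) \<in> sets (lebesgue_pow k)" .
  qed (auto simp: grid_cell_def split: if_splits intro!: countable_PiE)
  then show ?thesis by (rule measurable_compose) simp
qed

text \<open>Cells are disjoint and have volume N^(-k), so the sum of squares is N^k times the square
  integral over the cells of A; enlarging to all of R^k gives the inequality.\<close>

lemma sum_square_le_nn_integral_grid:
  fixes F :: "(nat \<Rightarrow> int) \<Rightarrow> real"
  assumes N: "N > 0" and A: "finite A" "A \<subseteq> off_diagonal k UNIV"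
  shows "ennreal (\<Sum>a\<in>A. (F a)\<^sup>2)
    \<le> ennreal (real N ^ k) * mean_sq (lebesgue_pow k) (\<lambda>y. F (grid_cell k N y))"
proof -
  let ?b = "\<lambda>a y. \<Prod>i<k. (indicator {(of_int (a i) - 1) / real N<..of_int (a i) / real N} (y i) :: ennreal)"
  have cell: "x \<in> {(of_int n - 1) / real N<..of_int n / real N} \<longleftrightarrow> n = \<lceil>real N * x\<rceil>" for n x
    using N by (auto simp: field_simps ceiling_unique[symmetric]) linarith+
  have b: "?b a y = (if a = grid_cell k N y then 1 else 0)" if "a \<in> A" for a and y :: "nat \<Rightarrow> real"
  proof -
    have "?b a y = (\<Prod>i<k. if a i = \<lceil>real N * y i\<rceil> then 1 else 0)"
      by (intro prod.cong refl) (simp only: indicator_def cell of_bool_def)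
    also have "\<dots> = (if \<forall>i<k. a i = \<lceil>real N * y i\<rceil> then 1 else 0)"
      by (auto simp: prod_zero_iff)
    also have "(\<forall>i<k. a i = \<lceil>real N * y i\<rceil>) \<longleftrightarrow> a = grid_cell k N y"
      using A(2) that by (auto simp: off_diagonal_def grid_cell_def PiE_def extensional_def fun_eq_iff)
    finally show ?thesis .
  qed
  have int: "(\<integral>\<^sup>+y. ?b a y \<partial>lebesgue_pow k) = ennreal (1 / real N ^ k)" for a
  proof -
    have "(\<integral>\<^sup>+y. ?b a y \<partial>lebesgue_pow k) = (\<Prod>i<k. ennreal (1 / real N))"
      using N by (subst nn_integral_lebesgue_pow_prod)
        (auto simp: diff_divide_distrib divide_right_mono intro!: prod.cong)
    also have "\<dots> = ennreal (1 / real N ^ k)"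
      by (simp add: ennreal_power power_one_over)
    finally show ?thesis .
  qed
  have "ennreal (\<Sum>a\<in>A. (F a)\<^sup>2) = ennreal (real N ^ k) * (\<Sum>a\<in>A. ennreal ((F a)\<^sup>2) * ennreal (1 / real N ^ k))"
  proof -
    have "(\<Sum>a\<in>A. ennreal ((F a)\<^sup>2) * ennreal (1 / real N ^ k)) = ennreal (\<Sum>a\<in>A. (F a)\<^sup>2 * (1 / real N ^ k))"
      by (simp flip: ennreal_mult)
    moreover have "(\<Sum>a\<in>A. (F a)\<^sup>2) = real N ^ k * (\<Sum>a\<in>A. (F a)\<^sup>2 * (1 / real N ^ k))"
      using N by (simp add: sum_distrib_left)
    ultimately show ?thesis by (simp add: ennreal_mult sum_nonneg)
  qed
  also have "(\<Sum>a\<in>A. ennreal ((F a)\<^sup>2) * ennreal (1 / real N ^ k))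
      = (\<integral>\<^sup>+y. (\<Sum>a\<in>A. ennreal ((F a)\<^sup>2) * ?b a y) \<partial>lebesgue_pow k)"
    by (subst nn_integral_sum) (auto simp: nn_integral_cmult int intro!: sum.cong)
  also have "\<dots> \<le> mean_sq (lebesgue_pow k) (\<lambda>y. F (grid_cell k N y))"
  proof (intro nn_integral_mono)
    fix y :: "nat \<Rightarrow> real"
    have "(\<Sum>a\<in>A. ennreal ((F a)\<^sup>2) * ?b a y) = (\<Sum>a\<in>A. if a = grid_cell k N y then ennreal ((F a)\<^sup>2) else 0)"
      by (intro sum.cong refl) (simp add: b)
    also have "\<dots> \<le> ennreal ((F (grid_cell k N y))\<^sup>2)" using A(1) by simp
    finally show "(\<Sum>a\<in>A. ennreal ((F a)\<^sup>2) * ?b a y) \<le> ennreal ((F (grid_cell k N y))\<^sup>2)" .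
  qed
  finally show ?thesis by (simp add: mult_left_mono)
qed

text \<open>Transfers the second moment of a chaos sum to an L2 norm on R^k; one factor sqrt N per
  coordinate, the Brownian scaling, keeps the constant independent of N.\<close>

lemma (in iid_noise) nn_integral_chaos_sum_square_le_grid:
  assumes N: "N > 0" and F: "integrable (count_space (off_diagonal k UNIV)) F"
  shows "mean_sq M (chaos_sum k \<epsilon> F)
    \<le> ennreal (real (k ^ k)) * mean_sq (lebesgue_pow k) (\<lambda>y. sqrt (real N) ^ k * F (grid_cell k N y))"
    (is "_ \<le> _ * ?I")
proof -
  have eq: "ennreal (real N ^ k) * mean_sq (lebesgue_pow k) (\<lambda>y. F (grid_cell k N y)) = ?I"
  proof -
    have "real N ^ k = (sqrt (real N) ^ k)\<^sup>2"
      by (simp flip: power_mult) (simp add: power_mult mult.commute[of k])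
    then have "?I = (\<integral>\<^sup>+y. ennreal (real N ^ k) * ennreal ((F (grid_cell k N y))\<^sup>2) \<partial>lebesgue_pow k)"
      by (simp add: power_mult_distrib ennreal_mult)
    then show ?thesis by (simp add: nn_integral_cmult)
  qed
  show ?thesis
  proof (cases "?I = \<infinity>")
    \<comment> \<open>An infinite right-hand side is trivial because k ^ k is nonzero, also for k =
      0.\<close>
    case True
    have top: "x * top = top" if "x \<noteq> 0" for x :: ennreal using that by (simp add: ennreal_mult_top)
    have "ennreal (real (k ^ k)) \<noteq> 0" by (cases k) simp_all
    then have "ennreal (real (k ^ k)) * ?I = top"
      unfolding True infinity_ennreal_def using top by blast
    then show ?thesis by (metis top_greatest)
  next
    case False
    then obtain C where C: "?I = ennreal C" "C \<ge> 0" by (cases ?I rule: ennreal_cases) auto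
    have "mean_sq M (chaos_sum k \<epsilon> F) \<le> ennreal (real (k ^ k) * C)"
    proof (rule nn_integral_chaos_sum_square_le[OF F])
      fix A assume "finite A" "A \<subseteq> off_diagonal k (UNIV :: int set)"
      from sum_square_le_nn_integral_grid[OF N this, of F] C
      show "(\<Sum>a\<in>A. (F a)\<^sup>2) \<le> C" unfolding eq by (simp add: ennreal_le_iff)
    qed
    also have "\<dots> = ennreal (real (k ^ k)) * ?I" unfolding C(1) using C(2) by (intro ennreal_mult) auto
    finally show ?thesis .
  qed
qed

text \<open>The coefficients of the increment of the normalized partial sum from n1 to n2; keeping
  both ends lets one formula serve increments and sums started at 0.\<close>

definition partial_sum_coeff :: "nat \<Rightarrow> real \<Rightarrow> real \<Rightarrow> real \<Rightarrow> nat \<Rightarrow> int \<Rightarrow> int \<Rightarrow> (nat \<Rightarrow> int) \<Rightarrow> real" where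
  "partial_sum_coeff k H d lam N n1 n2 a =
    1 / real N powr H * (\<Sum>n\<in>{n1<..n2}. \<Prod>j<k. tempered_power d (lam / real N) (real_of_int (n - a j)))"

text \<open>A Riemann sum of mesh 1/N for the kernel over (n1/N, n2/N], with the coordinates of y
  rounded up to the same grid.\<close>

definition discretized_kernel :: "nat \<Rightarrow> real \<Rightarrow> real \<Rightarrow> nat \<Rightarrow> int \<Rightarrow> int \<Rightarrow> (nat \<Rightarrow> real) \<Rightarrow> real" where
  "discretized_kernel k d lam N n1 n2 y =
    (\<Sum>n\<in>{n1<..n2}. \<Prod>j<k. tempered_power d lam (of_int n / real N - grid_up N (y j))) / real N"

lemma tempered_power_scale:
  assumes "N > 0"
  shows "tempered_power d (lam / real N) x = real N powr (d - 1) * tempered_power d lam (x / real N)"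
  using assms by (auto simp: tempered_power_def powr_divide powr_diff zero_less_divide_iff)

text \<open>Homogeneity pulls out N^(k (d - 1)) and turns the tempering lam/N into lam; the powers
  combine to k/2 - H + k (d - 1) = -1 by the relation between H and d, which leaves the Riemann
  factor 1/N.\<close>

lemma partial_sum_coeff_grid_cell:
  assumes N: "N > 0" and H: "H = 1 + real k * d - real k / 2"
  shows "sqrt (real N) ^ k * partial_sum_coeff k H d lam N n1 n2 (grid_cell k N y)
    = discretized_kernel k d lam N n1 n2 y"
proof -
  have prod: "(\<Prod>j<k. tempered_power d (lam / real N) (real_of_int (n - grid_cell k N y j)))
    = real N powr (real k * (d - 1)) * (\<Prod>j<k. tempered_power d lam (of_int n / real N - grid_up N (y j)))" for n
  proof -
    have "(\<Prod>j<k. tempered_power d (lam / real N) (real_of_int (n - grid_cell k N y j)))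
      = (\<Prod>j<k. real N powr (d - 1) * tempered_power d lam (of_int n / real N - grid_up N (y j)))"
      by (intro prod.cong refl) (simp add: tempered_power_scale[OF N] grid_cell_def grid_up_def diff_divide_distrib)
    also have "\<dots> = (real N powr (d - 1)) ^ k * (\<Prod>j<k. tempered_power d lam (of_int n / real N - grid_up N (y j)))"
      by (simp add: prod.distrib)
    also have "(real N powr (d - 1)) ^ k = real N powr (real k * (d - 1))"
      using N by (simp add: powr_power mult.commute)
    finally show ?thesis .
  qed
  have s: "sqrt (real N) ^ k = real N powr (real k / 2)"
    using N by (simp add: powr_half_sqrt[symmetric] powr_power)
  have "real N powr (real k / 2) * (1 / real N powr H) * real N powr (real k * (d - 1)) = 1 / real N"
  proof -
    have "real N powr (real k / 2) * (1 / real N powr H) * real N powr (real k * (d - 1))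
      = real N powr (real k / 2 - H + real k * (d - 1))"
      by (simp add: powr_add powr_diff)
    also have "real k / 2 - H + real k * (d - 1) = - 1" by (simp add: H algebra_simps)
    finally show ?thesis using N by (simp add: powr_minus_divide)
  qed
  then have "real N powr (real k / 2) * (1 / real N powr H * (real N powr (real k * (d - 1)) * S)) = S / real N" for S
    unfolding mult.assoc[symmetric] by simp
  then show ?thesis
    unfolding partial_sum_coeff_def discretized_kernel_def prod s sum_distrib_left[symmetric] .
qed

lemma discretized_kernel_nonneg: "0 \<le> discretized_kernel k d lam N n1 n2 y"
  unfolding discretized_kernel_def by (intro divide_nonneg_nonneg sum_nonneg prod_nonneg) auto

lemma discretized_kernel_measurable [measurable]:
  "discretized_kernel k d lam N n1 n2 \<in> borel_measurable (lebesgue_pow k)"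
  unfolding discretized_kernel_def[abs_def] by measurable

lemma discretized_kernel_eq_nn_integral:
  assumes N: "N > 0"
  shows "ennreal (discretized_kernel k d lam N n1 n2 y)
    = (\<integral>\<^sup>+s. ennreal (\<Prod>j<k. tempered_power d lam (grid_up N s - grid_up N (y j)))
        * indicator {of_int n1 / real N<..of_int n2 / real N} s \<partial>lborel)"
proof -
  let ?h = "\<lambda>n. \<Prod>j<k. tempered_power d lam (of_int n / real N - grid_up N (y j))"
  have "ennreal (discretized_kernel k d lam N n1 n2 y)
    = (\<integral>\<^sup>+s. ennreal (?h \<lceil>real N * s\<rceil>) * indicator {of_int n1 / real N<..of_int n2 / real N} s \<partial>lborel)"
    unfolding discretized_kernel_def by (rule nn_integral_grid_step[OF N, symmetric]) (auto intro!: prod_nonneg)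
  then show ?thesis unfolding grid_up_def .
qed

lemma prod_tempered_power_grid_le:
  assumes e: "e < 1" and C: "C > 0" "\<And>x. tempered_power d lam x \<le> C * tempered_power e 0 x" and N: "N > 0"
  shows "(\<Prod>j<k. tempered_power d lam (grid_up N s - grid_up N (y j)))
    \<le> (C * 2 powr (1 - e)) ^ k * (\<Prod>j<k. tempered_power e 0 (s - y j))"
proof -
  have "(\<Prod>j<k. tempered_power d lam (grid_up N s - grid_up N (y j)))
    \<le> (\<Prod>j<k. C * 2 powr (1 - e) * tempered_power e 0 (s - y j))"
  proof (intro prod_mono conjI)
    fix j
    have "tempered_power d lam (grid_up N s - grid_up N (y j)) \<le> C * tempered_power e 0 (grid_up N s - grid_up N (y j))"
      by (rule C)
    also have "\<dots> \<le> C * (2 powr (1 - e) * tempered_power e 0 (s - y j))"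
      using C(1) by (intro mult_left_mono tempered_power_grid_le N e) auto
    finally show "tempered_power d lam (grid_up N s - grid_up N (y j)) \<le> C * 2 powr (1 - e) * tempered_power e 0 (s - y j)"
      by (simp add: mult.assoc)
  qed auto
  then show ?thesis by (simp add: prod.distrib)
qed

lemma discretized_kernel_le_majorant:
  assumes e: "e < 1" and C: "C > 0" "\<And>x. tempered_power d lam x \<le> C * tempered_power e 0 x" and N: "N > 0"
  shows "ennreal (discretized_kernel k d lam N n1 n2 y)
    \<le> ennreal ((C * 2 powr (1 - e)) ^ k) * hermite_majorant k e (of_int n1 / real N) (of_int n2 / real N) y"
proof -
  have "ennreal (discretized_kernel k d lam N n1 n2 y)
    \<le> (\<integral>\<^sup>+s. ennreal ((C * 2 powr (1 - e)) ^ k) * (ennreal (\<Prod>j<k. tempered_power e 0 (s - y j))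
        * indicator {of_int n1 / real N<..of_int n2 / real N} s) \<partial>lborel)"
    unfolding discretized_kernel_eq_nn_integral[OF N]
    using C(1) by (intro nn_integral_mono)
      (auto simp: indicator_def prod_nonneg intro!: ennreal_leI prod_tempered_power_grid_le e C N simp flip: ennreal_mult)
  also have "\<dots> = ennreal ((C * 2 powr (1 - e)) ^ k) * hermite_majorant k e (of_int n1 / real N) (of_int n2 / real N) y"
    unfolding hermite_majorant_def by (rule nn_integral_cmult) measurable
  finally show ?thesis .
qed

text \<open>The kernel is a Bochner integral with default value 0; finiteness of the majorant at y
  makes its integrand integrable, so it agrees with the nonnegative integral.\<close>

lemma tempered_hermite_kernel_eq_nn_integral:
  assumes k: "k \<ge> 1" and H: "H = 1 + real k * d - real k / 2" and t: "t \<in> {0..1}"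
    and C: "C > 0" "\<And>x. tempered_power d lam x \<le> C * tempered_power e 0 x"
    and fin: "hermite_majorant k e 0 1 y < \<infinity>"
  shows "ennreal (tempered_hermite_kernel k H lam t y)
      = (\<integral>\<^sup>+s. ennreal (\<Prod>j<k. tempered_power d lam (s - y j)) * indicator {0<..<t} s \<partial>lborel)"
    and "tempered_hermite_kernel k H lam t y \<ge> 0"
proof -
  let ?f = "\<lambda>s. indicator {0<..<t} s * (\<Prod>j<k. tempered_power d lam (s - y j))"
  have d: "1 / 2 - (1 - H) / real k = d" using k by (simp add: H field_simps)
  have f0: "?f s \<ge> 0" for s by (intro mult_nonneg_nonneg prod_nonneg) auto
  have ker: "tempered_hermite_kernel k H lam t y = (LINT s|lborel. ?f s)"
    using t unfolding tempered_hermite_kernel_def Let_def d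
    by (simp add: interval_lebesgue_integral_def set_lebesgue_integral_def zero_ereal_def)
  have nn: "(\<integral>\<^sup>+s. ennreal (?f s) \<partial>lborel)
      = (\<integral>\<^sup>+s. ennreal (\<Prod>j<k. tempered_power d lam (s - y j)) * indicator {0<..<t} s \<partial>lborel)"
    by (intro nn_integral_cong) (auto simp: indicator_def)
  have le: "(\<Prod>j<k. tempered_power d lam (s - y j)) \<le> C ^ k * (\<Prod>j<k. tempered_power e 0 (s - y j))" for s
    using prod_mono[of "{..<k}" "\<lambda>j. tempered_power d lam (s - y j)" "\<lambda>j. C * tempered_power e 0 (s - y j)"] C
    by (simp add: prod.distrib)
  have "(\<integral>\<^sup>+s. ennreal (?f s) \<partial>lborel) \<le> (\<integral>\<^sup>+s. ennreal (C ^ k) * (ennreal (\<Prod>j<k. tempered_power e 0 (s - y j)) * indicator {0<..1} s) \<partial>lborel)"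
    using t C(1) le by (intro nn_integral_mono)
      (auto simp: indicator_def prod_nonneg intro!: ennreal_leI simp flip: ennreal_mult)
  also have "\<dots> = ennreal (C ^ k) * hermite_majorant k e 0 1 y"
    unfolding hermite_majorant_def by (rule nn_integral_cmult) measurable
  also have "\<dots> < \<infinity>" using fin by (simp add: ennreal_mult_less_top)
  finally have int: "integrable lborel ?f"
    using f0 by (intro integrableI_nonneg) auto
  show "tempered_hermite_kernel k H lam t y \<ge> 0"
    unfolding ker by (intro Bochner_Integration.integral_nonneg f0)
  show "ennreal (tempered_hermite_kernel k H lam t y)
      = (\<integral>\<^sup>+s. ennreal (\<Prod>j<k. tempered_power d lam (s - y j)) * indicator {0<..<t} s \<partial>lborel)"
    unfolding ker nn[symmetric] using f0 by (intro nn_integral_eq_integral[OF int, symmetric]) auto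
qed

lemma floor_grid_subset:
  assumes N: "N > 0" and t: "t \<in> {0..1}"
  shows "{of_int 0 / real N<..of_int \<lfloor>real N * t\<rfloor> / real N} \<subseteq> {0<..1}"
proof -
  have "real_of_int \<lfloor>real N * t\<rfloor> \<le> real N * t" by simp
  also have "\<dots> \<le> real N * 1" using t by (intro mult_left_mono) auto
  finally have "real_of_int \<lfloor>real N * t\<rfloor> / real N \<le> 1" using N by simp
  then show ?thesis by auto
qed

text \<open>Dominated convergence in s for fixed y, with the integrand of the majorant as dominating
  function. \<open>Suc N\<close> avoids the mesh 1/0.\<close>

lemma discretized_kernel_tendsto:
  assumes k: "k \<ge> 1" and H: "H = 1 + real k * d - real k / 2" and t: "t \<in> {0..1}"
    and e: "e < 1" and C: "C > 0" "\<And>x. tempered_power d lam x \<le> C * tempered_power e 0 x"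
    and fin: "hermite_majorant k e 0 1 y < \<infinity>"
  shows "(\<lambda>N. discretized_kernel k d lam (Suc N) 0 \<lfloor>real (Suc N) * t\<rfloor> y) \<longlonglongrightarrow> tempered_hermite_kernel k H lam t y"
proof -
  note ker = tempered_hermite_kernel_eq_nn_integral[OF k H t C fin]
  let ?K = "ennreal ((C * 2 powr (1 - e)) ^ k)"
  let ?I = "\<lambda>N. {of_int 0 / real N<..of_int \<lfloor>real N * t\<rfloor> / real N}"
  have "(\<lambda>N. \<integral>\<^sup>+s. ennreal (\<Prod>j<k. tempered_power d lam (grid_up (Suc N) s - grid_up (Suc N) (y j)))
        * indicator (?I (Suc N)) s \<partial>lborel)
    \<longlonglongrightarrow> (\<integral>\<^sup>+s. ennreal (\<Prod>j<k. tempered_power d lam (s - y j)) * indicator {0<..<t} s \<partial>lborel)"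
  proof (rule nn_integral_dominated_convergence[where
        w="\<lambda>s. ?K * (ennreal (\<Prod>j<k. tempered_power e 0 (s - y j)) * indicator {0<..1} s)"])
    fix N
    have sub: "?I (Suc N) \<subseteq> {0<..1}" by (rule floor_grid_subset[OF zero_less_Suc t])
    show "AE s in lborel. ennreal (\<Prod>j<k. tempered_power d lam (grid_up (Suc N) s - grid_up (Suc N) (y j)))
        * indicator (?I (Suc N)) s
        \<le> ?K * (ennreal (\<Prod>j<k. tempered_power e 0 (s - y j)) * indicator {0<..1} s)"
    proof (rule AE_I2)
      fix s :: real
      show "ennreal (\<Prod>j<k. tempered_power d lam (grid_up (Suc N) s - grid_up (Suc N) (y j))) * indicator (?I (Suc N)) s
        \<le> ?K * (ennreal (\<Prod>j<k. tempered_power e 0 (s - y j)) * indicator {0<..1} s)"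
      proof (cases "s \<in> ?I (Suc N)")
        case True
        then have "s \<in> {0<..1}" using sub by blast
        then show ?thesis
          using True prod_tempered_power_grid_le[OF e C zero_less_Suc, where s=s and y=y and k=k] C(1)
          by (simp add: ennreal_leI prod_nonneg flip: ennreal_mult)
      qed simp
    qed
  next
    show "(\<integral>\<^sup>+s. ?K * (ennreal (\<Prod>j<k. tempered_power e 0 (s - y j)) * indicator {0<..1} s) \<partial>lborel) < \<infinity>"
      using fin by (subst nn_integral_cmult) (auto simp: hermite_majorant_def ennreal_mult_less_top)
  next
    \<comment> \<open>The integrand may jump or blow up where s meets some y j, and the indicator
      jumps at s = t; these finitely many points are dropped.\<close>
    have "AE s in lborel. s \<notin> insert t (y ` {..<k})"
      by (rule AE_not_in[OF countable_imp_null_set_lborel]) auto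
    then show "AE s in lborel. (\<lambda>N. ennreal (\<Prod>j<k. tempered_power d lam (grid_up (Suc N) s - grid_up (Suc N) (y j)))
        * indicator (?I (Suc N)) s) \<longlonglongrightarrow> ennreal (\<Prod>j<k. tempered_power d lam (s - y j)) * indicator {0<..<t} s"
    proof eventually_elim
      fix s assume s: "s \<notin> insert t (y ` {..<k})"
      have 1: "(\<lambda>N. ennreal (\<Prod>j<k. tempered_power d lam (grid_up (Suc N) s - grid_up (Suc N) (y j))))
          \<longlonglongrightarrow> ennreal (\<Prod>j<k. tempered_power d lam (s - y j))"
      proof (intro tendsto_ennrealI tendsto_prod)
        fix j assume "j \<in> {..<k}"
        then have "s - y j \<noteq> 0" using s by auto
        moreover have "(\<lambda>N. grid_up (Suc N) s - grid_up (Suc N) (y j)) \<longlonglongrightarrow> s - y j"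
          by (intro tendsto_diff LIMSEQ_Suc grid_up_tendsto)
        ultimately show "(\<lambda>N. tempered_power d lam (grid_up (Suc N) s - grid_up (Suc N) (y j))) \<longlonglongrightarrow> tempered_power d lam (s - y j)"
          by (intro isCont_tendsto_compose[OF isCont_tempered_power])
      qed
      consider "s \<le> 0 \<or> s > t" | "0 < s" "s < t" using s by force
      then show "(\<lambda>N. ennreal (\<Prod>j<k. tempered_power d lam (grid_up (Suc N) s - grid_up (Suc N) (y j)))
        * indicator (?I (Suc N)) s) \<longlonglongrightarrow> ennreal (\<Prod>j<k. tempered_power d lam (s - y j)) * indicator {0<..<t} s"
      proof cases
        case 1
        have "s \<notin> ?I (Suc N)" for N
        proof
          assume "s \<in> ?I (Suc N)"
          then have "0 < s" "s * real (Suc N) \<le> of_int \<lfloor>real (Suc N) * t\<rfloor>" by (auto simp: field_simps)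
          moreover have "of_int \<lfloor>real (Suc N) * t\<rfloor> \<le> real (Suc N) * t" by simp
          ultimately have "real (Suc N) * s \<le> real (Suc N) * t" by (simp only: mult.commute)
          then show False using 1 \<open>0 < s\<close> by simp
        qed
        then have z: "indicator (?I (Suc N)) s = (0 :: ennreal)" for N by (rule indicator_simps(2))
        show ?thesis unfolding z using 1 by auto
      next
        case 2
        \<comment> \<open>From n on the mesh is at most t - s, so rounding the time t down to the
          grid cannot fall below s.\<close>
        obtain n :: nat where n: "1 / (t - s) \<le> real n" using real_arch_simple by blast
        have "s \<in> ?I (Suc N)" if "N \<ge> n" for N
        proof -
          have "1 / (t - s) \<le> real (Suc N)" using n that by simp
          then have "1 \<le> real (Suc N) * (t - s)" using 2 by (simp add: field_simps)
          then have "real (Suc N) * s \<le> real (Suc N) * t - 1" by (simp only: right_diff_distrib)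
          also have "\<dots> \<le> of_int \<lfloor>real (Suc N) * t\<rfloor>" by linarith
          finally show ?thesis using 2 by (simp add: field_simps)
        qed
        then have "indicator (?I (Suc N)) s = (1 :: ennreal)" if "N \<ge> n" for N using that by (intro indicator_simps(1))
        then have "eventually (\<lambda>N. ennreal (\<Prod>j<k. tempered_power d lam (grid_up (Suc N) s - grid_up (Suc N) (y j)))
            = ennreal (\<Prod>j<k. tempered_power d lam (grid_up (Suc N) s - grid_up (Suc N) (y j))) * indicator (?I (Suc N)) s) sequentially"
          unfolding eventually_sequentially by (metis mult_1_right)
        from Lim_transform_eventually[OF 1 this] show ?thesis using 2 by simp
      qed
    qed
  qed measurable
  then have "(\<lambda>N. ennreal (discretized_kernel k d lam (Suc N) 0 \<lfloor>real (Suc N) * t\<rfloor> y))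
      \<longlonglongrightarrow> ennreal (tempered_hermite_kernel k H lam t y)"
    by (simp only: discretized_kernel_eq_nn_integral[OF zero_less_Suc] ker of_int_0)
  then show ?thesis
    using ker(2) discretized_kernel_nonneg by (subst (asm) tendsto_ennreal_iff) auto
qed

text \<open>A second dominated convergence, now in y, with a multiple of the squared majorant as
  dominating function; its integrability is the square bound on [0, 1].\<close>

lemma L2_discretized_kernel_tendsto:
  assumes k: "k \<ge> 1" and H: "H = 1 + real k * d - real k / 2" and t: "t \<in> {0..1}"
    and e: "1/2 - 1 / (2 * real k) < e" "e < 1/2"
    and C: "C > 0" "\<And>x. tempered_power d lam x \<le> C * tempered_power e 0 x"
    and [measurable]: "tempered_hermite_kernel k H lam t \<in> borel_measurable (lebesgue_pow k)"
  shows "L2_tendsto (lebesgue_pow k) (\<lambda>N. discretized_kernel k d lam (Suc N) 0 \<lfloor>real (Suc N) * t\<rfloor>)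
    (tempered_hermite_kernel k H lam t)"
proof -
  let ?K = "ennreal ((C * 2 powr (1 - e)) ^ k)"
  let ?h = "hermite_majorant k e 0 1" and ?g = "tempered_hermite_kernel k H lam t"
  let ?f = "\<lambda>N. discretized_kernel k d lam (Suc N) 0 \<lfloor>real (Suc N) * t\<rfloor>"
  have h2: "(\<integral>\<^sup>+y. (?h y)\<^sup>2 \<partial>lebesgue_pow k) < \<infinity>"
    using nn_integral_hermite_majorant_square[OF k e, of 0 1] by (simp add: order_le_less_trans[OF _ ennreal_less_top])
  have "AE y in lebesgue_pow k. (?h y)\<^sup>2 \<noteq> \<infinity>"
    using h2 by (intro nn_integral_noteq_infinite) auto
  then have fin: "AE y in lebesgue_pow k. ?h y < \<infinity>"
    by eventually_elim (auto simp: less_top power2_eq_square ennreal_mult_eq_top_iff)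
  have bound: "ennreal ((?f N y - ?g y)\<^sup>2) \<le> (?K * ?h y)\<^sup>2" if y: "?h y < \<infinity>" for N y
  proof -
    have lim: "(\<lambda>N. ?f N y) \<longlonglongrightarrow> ?g y" using e by (intro discretized_kernel_tendsto[OF k H t _ C y]) auto
    have le: "ennreal (?f N y) \<le> ?K * ?h y" for N
    proof -
      have "ennreal (?f N y) \<le> ?K * hermite_majorant k e (of_int 0 / real (Suc N)) (of_int \<lfloor>real (Suc N) * t\<rfloor> / real (Suc N)) y"
        using e by (intro discretized_kernel_le_majorant C) auto
      also have "\<dots> \<le> ?K * ?h y"
        by (intro mult_left_mono hermite_majorant_mono floor_grid_subset t) auto
      finally show ?thesis .
    qed
    \<comment> \<open>Where the majorant is finite its multiple is a real w, and both the
      discretized kernels and their limit lie in [0, w], so w also bounds the difference.\<close>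
    have "?K * ?h y < top" using y by (simp add: ennreal_mult_less_top)
    then obtain w where w: "?K * ?h y = ennreal w" "w \<ge> 0" by (cases "?K * ?h y" rule: ennreal_cases) auto
    have fw: "?f N y \<le> w" for N using le[of N] w by (simp add: ennreal_le_iff)
    then have gw: "?g y \<le> w" using lim by (intro LIMSEQ_le_const2[OF lim]) auto
    have g0: "0 \<le> ?g y" using lim by (rule LIMSEQ_le_const) (auto intro: discretized_kernel_nonneg)
    have "\<bar>?f N y - ?g y\<bar> \<le> w" using fw[of N] gw g0 discretized_kernel_nonneg[of k d lam "Suc N" 0 _ y] by (smt (verit))
    then have "(?f N y - ?g y)\<^sup>2 \<le> w\<^sup>2" using w(2) by (simp add: abs_le_square_iff[symmetric])
    then show ?thesis using w by (simp add: ennreal_power ennreal_leI)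
  qed
  have "(\<lambda>N. \<integral>\<^sup>+y. ennreal ((?f N y - ?g y)\<^sup>2) \<partial>lebesgue_pow k) \<longlonglongrightarrow> (\<integral>\<^sup>+y. 0 \<partial>lebesgue_pow k)"
  proof (rule nn_integral_dominated_convergence[where w="\<lambda>y. (?K * ?h y)\<^sup>2"])
    show "AE y in lebesgue_pow k. ennreal ((?f N y - ?g y)\<^sup>2) \<le> (?K * ?h y)\<^sup>2" for N
      using fin by eventually_elim (rule bound)
    show "(\<integral>\<^sup>+y. (?K * ?h y)\<^sup>2 \<partial>lebesgue_pow k) < \<infinity>"
      using h2 by (simp add: power_mult_distrib nn_integral_cmult ennreal_mult_less_top power_less_top_ennreal)
    show "AE y in lebesgue_pow k. (\<lambda>N. ennreal ((?f N y - ?g y)\<^sup>2)) \<longlonglongrightarrow> 0"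
      using fin
    proof eventually_elim
      fix y assume y: "?h y < \<infinity>"
      have "(\<lambda>N. ?f N y) \<longlonglongrightarrow> ?g y" using e by (intro discretized_kernel_tendsto[OF k H t _ C y]) auto
      then have "(\<lambda>N. (?f N y - ?g y)\<^sup>2) \<longlonglongrightarrow> (?g y - ?g y)\<^sup>2" by (intro tendsto_intros)
      then show "(\<lambda>N. ennreal ((?f N y - ?g y)\<^sup>2)) \<longlonglongrightarrow> 0" using tendsto_ennrealI by fastforce
    qed
  qed measurable
  then show ?thesis by (simp add: L2_tendsto_def)
qed

text \<open>Half of the tempering absorbs the power, and the other half gives geometric
  decay.\<close>

lemma tempered_power_abs_summable:
  assumes mu: "\<mu> > 0"
  shows "integrable (count_space UNIV) (\<lambda>i::int. tempered_power d \<mu> (of_int (n - i)))"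
proof -
  \<comment> \<open>The exponent is capped at 1 so that the untempered power is at most 1 at every
    positive integer.\<close>
  let ?e = "min d 1"
  obtain C where C: "C > 0" "\<And>x. tempered_power d (\<mu> / 2) x \<le> C * tempered_power ?e 0 x"
    using tempered_power_le[of ?e d "\<mu> / 2"] mu by auto
  have le: "tempered_power d \<mu> (real i) \<le> C * exp (- \<mu> / 2) ^ i" for i :: nat
  proof (cases "i = 0")
    case False
    have "tempered_power d \<mu> (real i) = tempered_power d (\<mu> / 2) (real i) * exp (- \<mu> / 2 * real i)"
      using False by (simp add: tempered_power_def flip: exp_add)
    also have "\<dots> \<le> C * tempered_power ?e 0 (real i) * exp (- \<mu> / 2 * real i)"
      by (intro mult_right_mono C) auto
    also have "\<dots> \<le> C * 1 * exp (- \<mu> / 2 * real i)"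
    proof (intro mult_right_mono mult_left_mono)
      have "real i powr (?e - 1) \<le> real i powr 0"
        using False by (intro powr_mono) auto
      then show "tempered_power ?e 0 (real i) \<le> 1" using False by (simp add: tempered_power_def)
    qed (use C in auto)
    also have "exp (- \<mu> / 2 * real i) = exp (- \<mu> / 2) ^ i"
      by (simp add: exp_of_nat_mult[symmetric] mult.commute)
    finally show ?thesis by simp
  qed (use C in \<open>simp add: tempered_power_def\<close>)
  have "summable (\<lambda>i::nat. C * exp (- \<mu> / 2) ^ i)"
    using mu by (intro summable_mult summable_geometric) simp
  then have "summable (\<lambda>i::nat. norm (tempered_power d \<mu> (real i)))"
    by (rule summable_comparison_test'[where N=0]) (use le in simp)
  then have "Infinite_Set_Sum.abs_summable_on (\<lambda>i::nat. tempered_power d \<mu> (real_of_int (int i))) UNIV"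
    by (simp add: Infinite_Set_Sum.abs_summable_on_nat_iff')
  then have "Infinite_Set_Sum.abs_summable_on (\<lambda>i. tempered_power d \<mu> (real_of_int i)) (range int)"
    by (rule Infinite_Set_Sum.abs_summable_on_reindex)
  then have "Infinite_Set_Sum.abs_summable_on (\<lambda>i. tempered_power d \<mu> (real_of_int i)) (UNIV :: int set)"
  proof (subst Infinite_Set_Sum.abs_summable_on_cong_neutral[where B="range int" and g="\<lambda>i. tempered_power d \<mu> (real_of_int i)"])
    fix x assume "x \<in> UNIV - range int"
    then have "x < 0" using nonneg_int_cases[of x] by (metis DiffD2 linorder_not_less rangeI)
    then show "tempered_power d \<mu> (real_of_int x) = 0" by (simp add: tempered_power_def)
  qed auto
  moreover have "bij_betw (\<lambda>i. n - i) (UNIV :: int set) UNIV"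
    by (rule bij_betw_byWitness[of _ "\<lambda>i. n - i"]) auto
  ultimately have "Infinite_Set_Sum.abs_summable_on (\<lambda>i. tempered_power d \<mu> (real_of_int (n - i))) (UNIV :: int set)"
    using Infinite_Set_Sum.abs_summable_on_reindex_bij_betw[of "\<lambda>i. n - i" UNIV UNIV "\<lambda>i. tempered_power d \<mu> (real_of_int i)"]
    by blast
  then show ?thesis by (simp add: Infinite_Set_Sum.abs_summable_on_def)
qed

text \<open>A product of k summable one-dimensional families is summable over all tuples, hence over
  the off-diagonal ones.\<close>

lemma partial_sum_coeff_summand_integrable:
  assumes mu: "\<mu> > 0"
  shows "integrable (count_space (off_diagonal k UNIV)) (\<lambda>a. \<Prod>j<k. tempered_power d \<mu> (real_of_int (n - a j)))"
proof -
  have "Infinite_Set_Sum.abs_summable_on (\<lambda>a. \<Prod>j\<in>{..<k}. tempered_power d \<mu> (real_of_int (n - a j))) (PiE {..<k} (\<lambda>_. UNIV))"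
    using tempered_power_abs_summable[OF mu]
    by (intro Infinite_Set_Sum.abs_summable_on_prod_PiE) (auto simp: Infinite_Set_Sum.abs_summable_on_def)
  then have "Infinite_Set_Sum.abs_summable_on (\<lambda>a. \<Prod>j\<in>{..<k}. tempered_power d \<mu> (real_of_int (n - a j))) (off_diagonal k UNIV)"
    by (rule Infinite_Set_Sum.abs_summable_on_subset) (auto simp: off_diagonal_def)
  then show ?thesis by (simp add: Infinite_Set_Sum.abs_summable_on_def)
qed

lemma partial_sum_coeff_integrable:
  assumes "lam > 0" "N > 0"
  shows "integrable (count_space (off_diagonal k UNIV)) (partial_sum_coeff k H d lam N n1 n2)"
  unfolding partial_sum_coeff_def[abs_def] using assms
  by (intro integrable_mult_right Bochner_Integration.integrable_sum partial_sum_coeff_summand_integrable) auto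

section \<open>Second moments of the increments of the normalized sums\<close>

context iid_noise
begin

lemma discrete_chaos_measurable [measurable]: "discrete_chaos \<epsilon> d \<mu> k n \<in> borel_measurable M"
  unfolding discrete_chaos_eq_chaos_sum[abs_def] by measurable

lemma AE_partial_sum_eq_chaos_sum:
  assumes "lam > 0" "N > 0"
  shows "AE \<omega> in M. 1 / real N powr H * (\<Sum>n\<in>{n1<..n2}. discrete_chaos \<epsilon> d (lam / real N) k n \<omega>)
    = chaos_sum k \<epsilon> (partial_sum_coeff k H d lam N n1 n2) \<omega>"
proof -
  have "AE \<omega> in M. chaos_sum k \<epsilon> (\<lambda>a. \<Sum>n\<in>{n1<..n2}. \<Prod>j<k. tempered_power d (lam / real N) (real_of_int (n - a j))) \<omega>
      = (\<Sum>n\<in>{n1<..n2}. discrete_chaos \<epsilon> d (lam / real N) k n \<omega>)"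
    unfolding discrete_chaos_eq_chaos_sum using assms
    by (intro AE_chaos_sum_sum partial_sum_coeff_summand_integrable) auto
  then show ?thesis
    by eventually_elim (simp only: partial_sum_coeff_def[abs_def] chaos_sum_cmult)
qed

definition normalized_sum :: "nat \<Rightarrow> real \<Rightarrow> real \<Rightarrow> real \<Rightarrow> nat \<Rightarrow> nat \<Rightarrow> 'a \<Rightarrow> real" where
  "normalized_sum k H d lam N n \<omega> = 1 / real N powr H * (\<Sum>m\<in>{1..int n}. discrete_chaos \<epsilon> d (lam / real N) k m \<omega>)"

lemma normalized_sum_measurable [measurable]: "normalized_sum k H d lam N n \<in> borel_measurable M"
  unfolding normalized_sum_def[abs_def] by measurable

text \<open>Chains the chaos bound, the cell representation and the majorant over (m/N, n/N]. The
  bound depends on N only through (n - m)/N, and its exponent above 1 is what the maximal inequality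
  asks for.\<close>

lemma normalized_sum_increment:
  assumes k: "k \<ge> 1" and H: "H = 1 + real k * d - real k / 2" and lam: "lam > 0" and N: "N > 0"
    and e: "1/2 - 1 / (2 * real k) < e" "e < 1/2"
    and C: "C > 0" "\<And>x. tempered_power d lam x \<le> C * tempered_power e 0 x"
    and mn: "m \<le> n"
  shows "mean_sq M (\<lambda>\<omega>. normalized_sum k H d lam N n \<omega> - normalized_sum k H d lam N m \<omega>)
    \<le> ennreal (real (k ^ k) * ((C * 2 powr (1 - e)) ^ k)\<^sup>2
        * (2 * corr_const e ^ k / (1 - real k * (1 - 2 * e)))
        * (real (n - m) / real N) powr (2 - real k * (1 - 2 * e)))"
proof -
  let ?K = "(C * 2 powr (1 - e)) ^ k"
  let ?Q = "2 * corr_const e ^ k / (1 - real k * (1 - 2 * e)) * (real (n - m) / real N) powr (2 - real k * (1 - 2 * e))"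
  let ?c = "partial_sum_coeff k H d lam N (int m) (int n)"
  have diff: "normalized_sum k H d lam N n \<omega> - normalized_sum k H d lam N m \<omega>
      = 1 / real N powr H * (\<Sum>i\<in>{int m<..int n}. discrete_chaos \<epsilon> d (lam / real N) k i \<omega>)" for \<omega>
  proof -
    have "{1..int n} = {1..int m} \<union> {int m<..int n}" using mn by auto
    then show ?thesis
      by (simp add: normalized_sum_def sum.union_disjoint ivl_disj_int distrib_left)
  qed
  have ab: "real_of_int (int m) / real N \<le> real_of_int (int n) / real N" using mn by (simp add: divide_right_mono)
  have "mean_sq M (\<lambda>\<omega>. normalized_sum k H d lam N n \<omega> - normalized_sum k H d lam N m \<omega>)
      = mean_sq M (chaos_sum k \<epsilon> ?c)"
    unfolding diff by (intro nn_integral_cong_AE) (use AE_partial_sum_eq_chaos_sum[OF lam N, where H=H and d=d and k=k and ?n1.0="int m" and ?n2.0="int n"] in eventually_elim, simp)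
  also have "\<dots> \<le> ennreal (real (k ^ k)) * mean_sq (lebesgue_pow k) (\<lambda>y. sqrt (real N) ^ k * ?c (grid_cell k N y))"
    by (rule nn_integral_chaos_sum_square_le_grid[OF N partial_sum_coeff_integrable[OF lam N]])
  also have "mean_sq (lebesgue_pow k) (\<lambda>y. sqrt (real N) ^ k * ?c (grid_cell k N y))
      = (\<integral>\<^sup>+y. (ennreal (discretized_kernel k d lam N (int m) (int n) y))\<^sup>2 \<partial>lebesgue_pow k)"
    unfolding partial_sum_coeff_grid_cell[OF N H] by (simp add: ennreal_power discretized_kernel_nonneg)
  also have "\<dots> \<le> (\<integral>\<^sup>+y. ennreal (?K\<^sup>2) * (hermite_majorant k e (of_int (int m) / real N) (of_int (int n) / real N) y)\<^sup>2 \<partial>lebesgue_pow k)"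
  proof (intro nn_integral_mono)
    fix y :: "nat \<Rightarrow> real"
    have "(ennreal (discretized_kernel k d lam N (int m) (int n) y))\<^sup>2
        \<le> (ennreal ?K * hermite_majorant k e (of_int (int m) / real N) (of_int (int n) / real N) y)\<^sup>2"
      using e by (intro power_mono discretized_kernel_le_majorant C N) auto
    then show "(ennreal (discretized_kernel k d lam N (int m) (int n) y))\<^sup>2
        \<le> ennreal (?K\<^sup>2) * (hermite_majorant k e (of_int (int m) / real N) (of_int (int n) / real N) y)\<^sup>2"
      using C(1) by (simp add: power_mult_distrib ennreal_power)
  qed
  also have "\<dots> = ennreal (?K\<^sup>2) * (\<integral>\<^sup>+y. (hermite_majorant k e (of_int (int m) / real N) (of_int (int n) / real N) y)\<^sup>2 \<partial>lebesgue_pow k)"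
    by (rule nn_integral_cmult) measurable
  also have "\<dots> \<le> ennreal (?K\<^sup>2) * ennreal ?Q"
    using nn_integral_hermite_majorant_square[OF k e ab] mn
    by (intro mult_left_mono) (auto simp: of_nat_diff diff_divide_distrib)
  finally have "mean_sq M (\<lambda>\<omega>. normalized_sum k H d lam N n \<omega> - normalized_sum k H d lam N m \<omega>)
      \<le> ennreal (real (k ^ k)) * (ennreal (?K\<^sup>2) * ennreal ?Q)"
    by (simp add: mult_left_mono)
  also have "\<dots> = ennreal (real (k ^ k) * (?K\<^sup>2 * ?Q))"
    by (simp only: ennreal_mult' of_nat_0_le_iff zero_le_power2)
  finally show ?thesis by (simp only: mult.assoc)
qed

end

section \<open>Block sums and Brownian increments\<close>

lemma tendsto_funI:
  fixes f :: "'c \<Rightarrow> 'i \<Rightarrow> 'b :: topological_space"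
  assumes "\<And>i. ((\<lambda>c. f c i) \<longlongrightarrow> l i) F"
  shows "(f \<longlongrightarrow> l) F"
proof -
  have "limitin (product_topology (\<lambda>i. euclidean) UNIV) f l F"
    unfolding limitin_componentwise using assms by (simp add: limitin_canonical_iff)
  then show ?thesis by (simp add: euclidean_product_topology limitin_canonical_iff)
qed

lemma distr_PiM_componentwise:
  fixes f :: "'i \<Rightarrow> 's \<Rightarrow> real"
  assumes fin: "finite I" and S: "prob_space S"
    and f [measurable]: "\<And>i. i \<in> I \<Longrightarrow> f i \<in> borel_measurable S"
  shows "distr (PiM I (\<lambda>_. S)) (PiM I (\<lambda>_. borel)) (\<lambda>\<omega>. \<lambda>i\<in>I. f i (\<omega> i)) = PiM I (\<lambda>i. distr S borel (f i))"
proof -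
  \<comment> \<open>Extended by 0 outside I, because the product of probability spaces is built from
    a family over the whole index type.\<close>
  define f' where "f' i = (if i \<in> I then f i else (\<lambda>_. 0))" for i
  have [measurable]: "f' i \<in> borel_measurable S" for i by (simp add: f'_def f)
  interpret S: prob_space S by fact
  interpret D: prob_space "distr S borel (f' i)" for i by (rule S.prob_space_distr) simp
  interpret PS: product_prob_space "\<lambda>_. S" ..
  interpret PD: product_prob_space "\<lambda>i. distr S borel (f' i)" ..
  have "distr (PiM I (\<lambda>_. S)) (PiM I (\<lambda>_. borel)) (\<lambda>\<omega>. \<lambda>i\<in>I. f' i (\<omega> i)) = PiM I (\<lambda>i. distr S borel (f' i))"
  proof (rule PD.PiM_eqI[OF fin])
    show "sets (distr (PiM I (\<lambda>_. S)) (PiM I (\<lambda>_. borel)) (\<lambda>\<omega>. \<lambda>i\<in>I. f' i (\<omega> i))) = sets (PiM I (\<lambda>i. distr S borel (f' i)))"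
      by (simp cong: sets_PiM_cong)
    fix A assume A: "\<And>i. i \<in> I \<Longrightarrow> A i \<in> sets (distr S borel (f' i))"
    have meas: "(\<lambda>\<omega>. \<lambda>i\<in>I. f' i (\<omega> i)) \<in> PiM I (\<lambda>_. S) \<rightarrow>\<^sub>M PiM I (\<lambda>_. borel)" by measurable
    have "emeasure (distr (PiM I (\<lambda>_. S)) (PiM I (\<lambda>_. borel)) (\<lambda>\<omega>. \<lambda>i\<in>I. f' i (\<omega> i))) (PiE I A)
        = emeasure (PiM I (\<lambda>_. S)) ((\<lambda>\<omega>. \<lambda>i\<in>I. f' i (\<omega> i)) -` PiE I A \<inter> space (PiM I (\<lambda>_. S)))"
      using A fin by (intro emeasure_distr meas sets_PiM_I_finite) auto
    also have "(\<lambda>\<omega>. \<lambda>i\<in>I. f' i (\<omega> i)) -` PiE I A \<inter> space (PiM I (\<lambda>_. S)) = PiE I (\<lambda>i. f' i -` A i \<inter> space S)"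
      by (auto simp: space_PiM PiE_def Pi_def)
    also have "emeasure (PiM I (\<lambda>_. S)) \<dots> = (\<Prod>i\<in>I. emeasure S (f' i -` A i \<inter> space S))"
      using A by (intro PS.emeasure_PiM fin measurable_sets[of _ _ borel]) auto
    also have "\<dots> = (\<Prod>i\<in>I. emeasure (distr S borel (f' i)) (A i))"
      using A by (intro prod.cong refl emeasure_distr[symmetric]) auto
    finally show "emeasure (distr (PiM I (\<lambda>_. S)) (PiM I (\<lambda>_. borel)) (\<lambda>\<omega>. \<lambda>i\<in>I. f' i (\<omega> i))) (PiE I A)
      = (\<Prod>i\<in>I. emeasure (distr S borel (f' i)) (A i))" .
  qed
  moreover have "(\<lambda>\<omega>. \<lambda>i\<in>I. f' i (\<omega> i)) = (\<lambda>\<omega>. \<lambda>i\<in>I. f i (\<omega> i))"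
    by (auto simp: f'_def fun_eq_iff restrict_def)
  moreover have "PiM I (\<lambda>i. distr S borel (f' i)) = PiM I (\<lambda>i. distr S borel (f i))"
    by (intro PiM_cong) (auto simp: f'_def)
  ultimately show ?thesis by simp
qed

text \<open>Independence makes the joint law the product of the marginals, so the vector may be
  replaced by coordinatewise copies on a power of S. Padding by 0 turns a vector of length m into a
  full sequence, the argument of \<Psi>.\<close>

lemma (in prob_space) expectation_indep_copy:
  fixes X :: "nat \<Rightarrow> 'a \<Rightarrow> real" and \<Psi> :: "(nat \<Rightarrow> real) \<Rightarrow> real"
  assumes ind: "indep_vars (\<lambda>_. borel) X {..<m}" and S: "prob_space S"
    and f: "\<And>i. i < m \<Longrightarrow> f i \<in> borel_measurable S"
    and eq: "\<And>i. i < m \<Longrightarrow> distr M borel (X i) = distr S borel (f i)"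
    and \<Psi> [measurable]: "\<Psi> \<in> borel_measurable borel"
  shows "expectation (\<lambda>\<omega>. \<Psi> (\<lambda>i. if i < m then X i \<omega> else 0))
    = (\<integral>\<omega>. \<Psi> (\<lambda>i. if i < m then f i (\<omega> i) else 0) \<partial>PiM {..<m} (\<lambda>_. S))"
proof (cases "m = 0")
  \<comment> \<open>Treated apart because the characterization of independence by product laws
    speaks of nonempty index sets; both integrands are constant here.\<close>
  case True
  interpret P': prob_space "PiM {} (\<lambda>_::nat. S)" by (rule prob_space_PiM) (rule S)
  show ?thesis using True by (simp add: prob_space P'.prob_space)
next
  case False
  let ?I = "{..<m}"
  define \<Psi>' where "\<Psi>' v = \<Psi> (\<lambda>i. if i < m then v i else 0)" for v
  have [measurable]: "(\<lambda>v i. if i < m then v i else (0::real)) \<in> PiM ?I (\<lambda>_. borel) \<rightarrow>\<^sub>M borel"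
  proof (rule measurable_coordinatewise_then_product)
    fix i show "(\<lambda>v. if i < m then v i else (0::real)) \<in> borel_measurable (PiM ?I (\<lambda>_. borel))"
      by (cases "i < m") auto
  qed
  have \<Psi>': "\<Psi>' \<in> borel_measurable (PiM ?I (\<lambda>_. borel))" unfolding \<Psi>'_def by measurable
  have X: "X i \<in> borel_measurable M" if "i < m" for i using ind that unfolding indep_vars_def by auto
  have "distr M (PiM ?I (\<lambda>_. borel)) (\<lambda>x. \<lambda>i\<in>?I. X i x) = PiM ?I (\<lambda>i. distr M borel (X i))"
    using ind False X by (subst indep_vars_iff_distr_eq_PiM'[symmetric]) auto
  also have "\<dots> = PiM ?I (\<lambda>i. distr S borel (f i))"
    by (intro PiM_cong) (auto simp: eq)
  also have "\<dots> = distr (PiM ?I (\<lambda>_. S)) (PiM ?I (\<lambda>_. borel)) (\<lambda>\<omega>. \<lambda>i\<in>?I. f i (\<omega> i))"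
    using f by (intro distr_PiM_componentwise[symmetric] S) auto
  finally have "(\<integral>v. \<Psi>' v \<partial>distr M (PiM ?I (\<lambda>_. borel)) (\<lambda>x. \<lambda>i\<in>?I. X i x))
      = (\<integral>v. \<Psi>' v \<partial>distr (PiM ?I (\<lambda>_. S)) (PiM ?I (\<lambda>_. borel)) (\<lambda>\<omega>. \<lambda>i\<in>?I. f i (\<omega> i)))" by simp
  moreover have "(\<lambda>x. \<lambda>i\<in>?I. X i x) \<in> M \<rightarrow>\<^sub>M PiM ?I (\<lambda>_. borel)"
    using X by (intro measurable_restrict) auto
  moreover have "(\<lambda>\<omega>. \<lambda>i\<in>?I. f i (\<omega> i)) \<in> PiM ?I (\<lambda>_. S) \<rightarrow>\<^sub>M PiM ?I (\<lambda>_. borel)"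
    using f by (intro measurable_restrict measurable_compose[OF measurable_component_singleton]) auto
  ultimately have "expectation (\<lambda>\<omega>. \<Psi>' (\<lambda>i\<in>?I. X i \<omega>)) = (\<integral>\<omega>. \<Psi>' (\<lambda>i\<in>?I. f i (\<omega> i)) \<partial>PiM ?I (\<lambda>_. S))"
    using \<Psi>' by (simp add: integral_distr)
  then show ?thesis
    by (simp add: \<Psi>'_def cong: if_cong)
qed

text \<open>The index \<open>a\<close> belongs to the block of \<open>(p, q]\<close> iff \<open>(a - 1) / N\<close> does. This is the point
  strictly left of the \<open>a\<close>-th grid cell, so that discretized indicators of \<open>(p, q]\<close> converge at
  every point, including the end points.\<close>

definition grid_block :: "nat \<Rightarrow> real \<Rightarrow> real \<Rightarrow> int set" where
  "grid_block N p q = {\<lfloor>real N * p\<rfloor> + 2..\<lfloor>real N * q\<rfloor> + 1}"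

lemma grid_block_disjoint:
  assumes p: "strict_mono_on {..m} p" and l: "l < m" "l' < m" "l \<noteq> l'"
  shows "grid_block N (p l) (p (Suc l)) \<inter> grid_block N (p l') (p (Suc l')) = {}"
proof -
  have "grid_block N (p l) (p (Suc l)) \<inter> grid_block N (p l') (p (Suc l')) = {}" if "l < l'" "l' < m" for l l'
  proof -
    have "p (Suc l) \<le> p l'"
      using strict_mono_on_leD[OF p, of "Suc l" l'] that by auto
    then have "\<lfloor>real N * p (Suc l)\<rfloor> \<le> \<lfloor>real N * p l'\<rfloor>" by (intro floor_mono mult_left_mono) auto
    then show ?thesis by (auto simp: grid_block_def)
  qed
  from this[of l l'] this[of l' l] l show ?thesis by (cases "l < l'") auto
qed

definition (in iid_noise) block_sum :: "nat \<Rightarrow> real \<Rightarrow> real \<Rightarrow> 'a \<Rightarrow> real" where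
  "block_sum N p q \<omega> = (\<Sum>a\<in>grid_block N p q. \<epsilon> a \<omega>) / sqrt (real N)"

lemma card_grid_block: "card (grid_block N p q) = nat (\<lfloor>real N * q\<rfloor> - \<lfloor>real N * p\<rfloor>)"
  by (simp add: grid_block_def)

lemma floor_difference_over_n:
  "(\<lambda>N. real (nat (\<lfloor>real (Suc N) * q\<rfloor> - \<lfloor>real (Suc N) * p\<rfloor>)) / real (Suc N)) \<longlonglongrightarrow> q - p" if "p < q"
proof (rule tendsto_sandwich)
  have pq: "\<lfloor>real (Suc N) * p\<rfloor> \<le> \<lfloor>real (Suc N) * q\<rfloor>" for N
    using that by (intro floor_mono mult_left_mono) auto
  have eq: "real (nat (\<lfloor>real (Suc N) * q\<rfloor> - \<lfloor>real (Suc N) * p\<rfloor>))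
      = of_int \<lfloor>real (Suc N) * q\<rfloor> - of_int \<lfloor>real (Suc N) * p\<rfloor>" for N
    using pq[of N] by simp
  show "eventually (\<lambda>N. q - p - 1 / real (Suc N) \<le> real (nat (\<lfloor>real (Suc N) * q\<rfloor> - \<lfloor>real (Suc N) * p\<rfloor>)) / real (Suc N)) sequentially"
  proof (intro always_eventually allI)
    fix N
    have "real (Suc N) * q - 1 - real (Suc N) * p \<le> of_int \<lfloor>real (Suc N) * q\<rfloor> - of_int \<lfloor>real (Suc N) * p\<rfloor>"
      by linarith
    then have "(real (Suc N) * q - 1 - real (Suc N) * p) / real (Suc N)
        \<le> (of_int \<lfloor>real (Suc N) * q\<rfloor> - of_int \<lfloor>real (Suc N) * p\<rfloor>) / real (Suc N)"
      by (rule divide_right_mono) simp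
    then show "q - p - 1 / real (Suc N) \<le> real (nat (\<lfloor>real (Suc N) * q\<rfloor> - \<lfloor>real (Suc N) * p\<rfloor>)) / real (Suc N)"
      unfolding eq by (simp add: diff_divide_distrib del: of_nat_Suc)
  qed
  show "eventually (\<lambda>N. real (nat (\<lfloor>real (Suc N) * q\<rfloor> - \<lfloor>real (Suc N) * p\<rfloor>)) / real (Suc N) \<le> q - p + 1 / real (Suc N)) sequentially"
  proof (intro always_eventually allI)
    fix N
    have "of_int \<lfloor>real (Suc N) * q\<rfloor> - of_int \<lfloor>real (Suc N) * p\<rfloor> \<le> real (Suc N) * q + 1 - real (Suc N) * p"
      by linarith
    then have "(of_int \<lfloor>real (Suc N) * q\<rfloor> - of_int \<lfloor>real (Suc N) * p\<rfloor>) / real (Suc N)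
        \<le> (real (Suc N) * q + 1 - real (Suc N) * p) / real (Suc N)"
      by (rule divide_right_mono) simp
    then show "real (nat (\<lfloor>real (Suc N) * q\<rfloor> - \<lfloor>real (Suc N) * p\<rfloor>)) / real (Suc N) \<le> q - p + 1 / real (Suc N)"
      unfolding eq by (simp add: diff_divide_distrib add_divide_distrib del: of_nat_Suc)
  qed
  show "(\<lambda>N. q - p - 1 / real (Suc N)) \<longlonglongrightarrow> q - p"
    using tendsto_diff[OF tendsto_const LIMSEQ_Suc[OF lim_1_over_n], of "q - p"] by simp
  show "(\<lambda>N. q - p + 1 / real (Suc N)) \<longlonglongrightarrow> q - p"
    using tendsto_add[OF tendsto_const LIMSEQ_Suc[OF lim_1_over_n], of "q - p"] by simp
qed

lemma filterlim_floor_difference: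
  assumes "p < q"
  shows "filterlim (\<lambda>N. nat (\<lfloor>real (Suc N) * q\<rfloor> - \<lfloor>real (Suc N) * p\<rfloor>)) sequentially sequentially"
proof -
  have "filterlim (\<lambda>N. real (nat (\<lfloor>real (Suc N) * q\<rfloor> - \<lfloor>real (Suc N) * p\<rfloor>)) / real (Suc N) * real (Suc N)) at_top sequentially"
    using assms by (intro filterlim_tendsto_pos_mult_at_top[OF floor_difference_over_n]
      filterlim_compose[OF filterlim_real_sequentially filterlim_Suc]) auto
  then have "filterlim (\<lambda>N. real (nat (\<lfloor>real (Suc N) * q\<rfloor> - \<lfloor>real (Suc N) * p\<rfloor>))) at_top sequentially"
    by (simp del: of_nat_Suc of_nat_nat)
  then show ?thesis by (simp only: filterlim_sequentially_iff_filterlim_real)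
qed

section \<open>Laws and independence of block sums\<close>

context iid_noise
begin

lemma block_sum_measurable [measurable]: "block_sum N p q \<in> borel_measurable M"
  unfolding block_sum_def[abs_def] by measurable

text \<open>By independence the characteristic function of the sum is the power of that of
  \<epsilon> 0 with the cardinality as exponent, and it determines the law.\<close>

lemma distr_sum_noise_eq:
  assumes "card A = card A'"
  shows "distr M borel (\<lambda>\<omega>. \<Sum>i\<in>A. \<epsilon> i \<omega>) = distr M borel (\<lambda>\<omega>. \<Sum>i\<in>A'. \<epsilon> i \<omega>)"
proof (rule Levy_uniqueness)
  have "char (distr M borel (\<lambda>\<omega>. \<Sum>i\<in>B. \<epsilon> i \<omega>)) t = char (distr M borel (\<epsilon> 0)) t ^ card B" for B t
  proof -
    have "char (distr M borel (\<lambda>\<omega>. \<Sum>i\<in>B. \<epsilon> i \<omega>)) t = (\<Prod>i\<in>B. char (distr M borel (\<epsilon> i)) t)"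
      by (intro char_distr_sum indep_vars_subset[OF indep_noise]) auto
    also have "\<dots> = (\<Prod>i\<in>B. char (distr M borel (\<epsilon> 0)) t)"
      by (intro prod.cong refl arg_cong[where f="\<lambda>D. char D t"] distr_noise)
    finally show ?thesis by simp
  qed
  then show "char (distr M borel (\<lambda>\<omega>. \<Sum>i\<in>A. \<epsilon> i \<omega>)) = char (distr M borel (\<lambda>\<omega>. \<Sum>i\<in>A'. \<epsilon> i \<omega>))"
    using assms by (simp add: fun_eq_iff)
qed (auto intro!: real_distribution_distr)

lemma clt_noise:
  "weak_conv_m (\<lambda>n. distr M borel (\<lambda>\<omega>. (\<Sum>i<n. \<epsilon> (int i) \<omega>) / sqrt (real n))) std_normal_distribution"
proof -
  have "indep_vars (\<lambda>i. borel) (\<lambda>i. \<epsilon> (int i)) (UNIV :: nat set)"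
  proof -
    \<comment> \<open>Grouping into the singleton blocks {int j} transports independence from
      integer to natural indices.\<close>
    have 1: "indep_vars (\<lambda>j. PiM {int j} (\<lambda>_. borel)) (\<lambda>j \<omega>. restrict (\<lambda>i. \<epsilon> i \<omega>) {int j}) (UNIV :: nat set)"
      by (rule indep_vars_restrict[OF indep_noise]) (auto simp: disjoint_family_on_def)
    have "indep_vars (\<lambda>_. borel) (\<lambda>j \<omega>. (\<lambda>v. v (int j)) (restrict (\<lambda>i. \<epsilon> i \<omega>) {int j})) (UNIV :: nat set)"
      by (rule indep_vars_compose2[OF 1]) (auto intro!: measurable_component_singleton)
    then show ?thesis by simp
  qed
  from central_limit_theorem_zero_mean[OF this expectation_noise zero_less_one integrable_noise_square _ distr_noise[where n=0]]
  show ?thesis by (simp add: variance_noise)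
qed

lemma indep_block_sums:
  assumes q: "strict_mono_on {..m} q"
  shows "indep_vars (\<lambda>_. borel) (\<lambda>l. block_sum N (q l) (q (Suc l))) {..<m}"
proof -
  let ?K = "\<lambda>l. grid_block N (q l) (q (Suc l))"
  have 1: "indep_vars (\<lambda>j. PiM (?K j) (\<lambda>_. borel)) (\<lambda>j \<omega>. restrict (\<lambda>i. \<epsilon> i \<omega>) (?K j)) {..<m}"
  proof (rule indep_vars_restrict[OF indep_noise])
    show "disjoint_family_on ?K {..<m}"
      using grid_block_disjoint[OF q] by (auto simp: disjoint_family_on_def)
  qed auto
  have "indep_vars (\<lambda>_. borel) (\<lambda>j \<omega>. (\<lambda>v. (\<Sum>a\<in>?K j. v a) / sqrt (real N)) (restrict (\<lambda>i. \<epsilon> i \<omega>) (?K j))) {..<m}"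
    by (rule indep_vars_compose2[OF 1]) measurable
  then show ?thesis
    by (simp add: block_sum_def[abs_def] cong: sum.cong)
qed

text \<open>Only the number n of summands matters, so a block sum has the law of sqrt (n / N) times
  the normalized sum of n terms; Y will be the Skorohod copy of the latter.\<close>

lemma distr_block_sum:
  assumes Y: "Y \<in> borel_measurable S"
    and law: "distr S borel Y = distr M borel (\<lambda>\<omega>. (\<Sum>i<card (grid_block N p q). \<epsilon> (int i) \<omega>) / sqrt (real (card (grid_block N p q))))"
  shows "distr M borel (block_sum N p q)
    = distr S borel (\<lambda>x. sqrt (real (card (grid_block N p q)) / real N) * Y x)"
proof -
  let ?n = "card (grid_block N p q)"
  let ?c = "sqrt (real ?n / real N)"
  note [measurable] = Y
  have "distr S borel (\<lambda>x. ?c * Y x) = distr (distr S borel Y) borel (\<lambda>r. ?c * r)"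
    by (subst distr_distr) (auto simp: comp_def)
  also have "\<dots> = distr M borel (\<lambda>\<omega>. ?c * ((\<Sum>i<?n. \<epsilon> (int i) \<omega>) / sqrt (real ?n)))"
    unfolding law by (subst distr_distr) (auto simp: comp_def)
  also have "\<dots> = distr M borel (\<lambda>\<omega>. (\<Sum>i<?n. \<epsilon> (int i) \<omega>) / sqrt (real N))"
    by (intro arg_cong[where f="distr M borel"] ext) (auto simp: real_sqrt_divide)
  also have "\<dots> = distr (distr M borel (\<lambda>\<omega>. \<Sum>i\<in>int ` {..<?n}. \<epsilon> i \<omega>)) borel (\<lambda>r. r / sqrt (real N))"
    by (subst distr_distr) (auto simp: comp_def sum.reindex)
  also have "distr M borel (\<lambda>\<omega>. \<Sum>i\<in>int ` {..<?n}. \<epsilon> i \<omega>) = distr M borel (\<lambda>\<omega>. \<Sum>i\<in>grid_block N p q. \<epsilon> i \<omega>)"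
    by (rule distr_sum_noise_eq) (simp add: card_image)
  also have "distr (distr M borel (\<lambda>\<omega>. \<Sum>i\<in>grid_block N p q. \<epsilon> i \<omega>)) borel (\<lambda>r. r / sqrt (real N)) = distr M borel (block_sum N p q)"
    by (subst distr_distr) (auto simp: comp_def block_sum_def[abs_def])
  finally show ?thesis by simp
qed

end

text \<open>Stationarity moves the increment to (0, q - p], where B 0 = 0 almost surely leaves a
  centred Gaussian of variance q - p, a multiple of the standard one.\<close>

lemma (in prob_space) distr_brownian_increment:
  assumes B: "two_sided_brownian_motion B" and pq: "p < q"
    and Y: "Y \<in> borel_measurable S" and law: "distr S borel Y = std_normal_distribution"
  shows "distr M borel (\<lambda>\<omega>. B q \<omega> - B p \<omega>) = distr S borel (\<lambda>x. sqrt (q - p) * Y x)"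
proof -
  have [measurable]: "B t \<in> borel_measurable M" for t
    using B unfolding two_sided_brownian_motion_def by blast
  note [measurable] = Y
  have "distr M borel (\<lambda>\<omega>. B ((q - p) + p) \<omega> - B (0 + p) \<omega>) = distr M borel (\<lambda>\<omega>. B (q - p) \<omega> - B 0 \<omega>)"
    using B unfolding two_sided_brownian_motion_def by blast
  then have "distr M borel (\<lambda>\<omega>. B q \<omega> - B p \<omega>) = distr M borel (\<lambda>\<omega>. B (q - p) \<omega> - B 0 \<omega>)" by simp
  also have "\<dots> = distr M borel (B (q - p))"
  proof (rule distr_cong_AE)
    have "AE \<omega> in M. B 0 \<omega> = 0" using B unfolding two_sided_brownian_motion_def by blast
    then show "AE \<omega> in M. B (q - p) \<omega> - B 0 \<omega> = B (q - p) \<omega>" by eventually_elim simp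
  qed auto
  also have "\<dots> = density lborel (normal_density 0 (sqrt (q - p)))"
  proof -
    have "\<forall>t. t \<noteq> 0 \<longrightarrow> distributed M lborel (B t) (normal_density 0 (sqrt \<bar>t\<bar>))"
      using B unfolding two_sided_brownian_motion_def by blast
    moreover have "q - p \<noteq> 0" using pq by simp
    ultimately have "distributed M lborel (B (q - p)) (normal_density 0 (sqrt \<bar>q - p\<bar>))" by blast
    then have "distr M lborel (B (q - p)) = density lborel (normal_density 0 (sqrt (q - p)))"
      using pq unfolding distributed_def by simp
    then show ?thesis by (simp cong: distr_cong)
  qed
  also have "\<dots> = distr S borel (\<lambda>x. sqrt (q - p) * Y x)"
  proof -
    interpret S: prob_space S
    proof -
      interpret D: prob_space "distr S borel Y" unfolding law by (rule prob_space_normal_density) simp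
      show "prob_space S" by (rule prob_space_distrD[OF Y D.prob_space_axioms])
    qed
    have "distributed S lborel Y (normal_density 0 1)"
      unfolding distributed_def using law by (auto cong: distr_cong)
    from S.normal_density_affine[OF this, of "sqrt (q - p)" 0]
    have "distributed S lborel (\<lambda>x. sqrt (q - p) * Y x) (normal_density 0 (sqrt (q - p)))"
      using pq by simp
    then show ?thesis unfolding distributed_def by (simp cong: distr_cong)
  qed
  finally show ?thesis .
qed

text \<open>Skorohod's representation of the one-dimensional central limit theorem, used independently in
  each coordinate of a product space, turns convergence in law of the vector of block sums into
  pointwise convergence.\<close>

lemma (in iid_noise) block_sums_tendsto:
  fixes \<Psi> :: "(nat \<Rightarrow> real) \<Rightarrow> real"
  assumes M': "prob_space M'" and B: "prob_space.two_sided_brownian_motion M' B"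
    and q: "strict_mono_on {..m} q" and \<Psi>: "continuous_on UNIV \<Psi>" "\<And>v. \<bar>\<Psi> v\<bar> \<le> C"
  shows "(\<lambda>N. expectation (\<lambda>\<omega>. \<Psi> (\<lambda>l. if l < m then block_sum (Suc N) (q l) (q (Suc l)) \<omega> else 0)))
    \<longlonglongrightarrow> (\<integral>\<omega>. \<Psi> (\<lambda>l. if l < m then B (q (Suc l)) \<omega> - B (q l) \<omega> else 0) \<partial>M')"
proof -
  interpret M': prob_space M' by fact
  have qlt: "q l < q (Suc l)" if "l < m" for l using strict_mono_onD[OF q, of l "Suc l"] that by auto
  have *: "real_distribution (distr M borel (\<lambda>\<omega>. (\<Sum>i<n. \<epsilon> (int i) \<omega>) / sqrt (real n)))" for n
    by (rule real_distribution_distr) measurable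
  obtain S :: "real measure" and Y :: "nat \<Rightarrow> real \<Rightarrow> real" and Y' :: "real \<Rightarrow> real" where S: "prob_space S"
    and Y: "\<And>n. Y n \<in> borel_measurable S"
    and law: "\<And>n. distr S borel (Y n) = distr M borel (\<lambda>\<omega>. (\<Sum>i<n. \<epsilon> (int i) \<omega>) / sqrt (real n))"
    and Y': "Y' \<in> S \<rightarrow>\<^sub>M lborel" "distr S borel Y' = std_normal_distribution"
    and lim: "\<And>x. x \<in> space S \<Longrightarrow> (\<lambda>n. Y n x) \<longlonglongrightarrow> Y' x"
    using Skorohod[OF * real_dist_normal_dist clt_noise] by blast
  have Y'b: "Y' \<in> borel_measurable S" using Y'(1) by simp
  note [measurable] = Y Y'b
  \<comment> \<open>Block lengths: divided by N + 1 they tend to the lengths of the intervals, and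
    they tend to infinity themselves, so the scaling factor and the index of the central limit
    theorem converge together.\<close>
  define n where "n N l = card (grid_block (Suc N) (q l) (q (Suc l)))" for N l
  let ?P = "PiM {..<m} (\<lambda>_. S)"
  interpret S: prob_space S by fact
  interpret P': prob_space ?P by (rule prob_space_PiM) (rule S)
  have [measurable]: "\<Psi> \<in> borel_measurable borel" using \<Psi>(1) by (rule borel_measurable_continuous_onI)
  define U where "U N x l = (if l < m then sqrt (real (n N l) / real (Suc N)) * Y (n N l) (x l) else 0)" for N x and l :: nat
  define U' where "U' x l = (if l < m then sqrt (q (Suc l) - q l) * Y' (x l) else 0)" for x and l :: nat
  have lhs: "expectation (\<lambda>\<omega>. \<Psi> (\<lambda>l. if l < m then block_sum (Suc N) (q l) (q (Suc l)) \<omega> else 0))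
      = (\<integral>x. \<Psi> (U N x) \<partial>?P)" for N
    unfolding U_def
    by (rule expectation_indep_copy[OF indep_block_sums[OF q] S,
          where f="\<lambda>l y. sqrt (real (n N l) / real (Suc N)) * Y (n N l) y"])
      (auto simp del: of_nat_Suc simp: n_def law intro!: distr_block_sum)
  have "M'.indep_vars (\<lambda>_. borel) (\<lambda>l \<omega>. B (q (Suc l)) \<omega> - B (q l) \<omega>) {..<m}"
    using B q unfolding M'.two_sided_brownian_motion_def by blast
  then have rhs: "(\<integral>\<omega>. \<Psi> (\<lambda>l. if l < m then B (q (Suc l)) \<omega> - B (q l) \<omega> else 0) \<partial>M') = (\<integral>x. \<Psi> (U' x) \<partial>?P)"
    unfolding U'_def
    by (rule M'.expectation_indep_copy[OF _ S, where f="\<lambda>l y. sqrt (q (Suc l) - q l) * Y' y"])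
      (auto intro!: M'.distr_brownian_increment B qlt Y'b Y'(2))
  have [measurable]: "U N \<in> borel_measurable ?P" for N
  proof (rule measurable_coordinatewise_then_product)
    fix l show "(\<lambda>x. U N x l) \<in> borel_measurable ?P" unfolding U_def by (cases "l < m") auto
  qed
  have [measurable]: "U' \<in> borel_measurable ?P"
  proof (rule measurable_coordinatewise_then_product)
    fix l show "(\<lambda>x. U' x l) \<in> borel_measurable ?P" unfolding U'_def by (cases "l < m") auto
  qed
  show ?thesis
    unfolding lhs rhs
  proof (rule integral_dominated_convergence[where w="\<lambda>_. C"])
    show "AE x in ?P. (\<lambda>N. \<Psi> (U N x)) \<longlonglongrightarrow> \<Psi> (U' x)"
    proof (rule AE_I2)
      fix x assume x: "x \<in> space ?P"
      have "(\<lambda>N. U N x) \<longlonglongrightarrow> U' x"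
      proof (rule tendsto_funI)
        fix l show "(\<lambda>N. U N x l) \<longlonglongrightarrow> U' x l"
        proof (cases "l < m")
          case True
          then have xl: "x l \<in> space S" using x by (auto simp: space_PiM)
          show ?thesis
            unfolding U_def U'_def n_def card_grid_block using True
            by (simp only: if_True) (intro tendsto_mult tendsto_real_sqrt floor_difference_over_n qlt
                filterlim_compose[OF lim[OF xl] filterlim_floor_difference])
        qed (simp add: U_def U'_def)
      qed
      then show "(\<lambda>N. \<Psi> (U N x)) \<longlonglongrightarrow> \<Psi> (U' x)"
        using \<Psi>(1) by (intro continuous_on_tendsto_compose[of UNIV \<Psi>]) auto
    qed
  qed (use \<Psi>(2) in auto)
qed

section \<open>Coupling with step functions\<close>

lemma integral_count_space_indicator_finite:
  fixes f :: "'x \<Rightarrow> real"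
  assumes "finite E" "E \<subseteq> D"
  shows "integrable (count_space D) (\<lambda>a. indicator E a * f a)"
    and "(LINT a|count_space D. indicator E a * f a) = (\<Sum>a\<in>E. f a)"
proof -
  have eq: "indicator E a * f a = (\<Sum>e\<in>E. f e * indicator {e} a)" for a
    using assms(1) by (cases "a \<in> E") (auto simp: indicator_def of_bool_def sum.delta' if_distrib[of "(*) _"] cong: if_cong)
  have int: "integrable (count_space D) (\<lambda>a. f e * indicator {e} a)" if "e \<in> E" for e
    using that assms(2) by (intro integrable_mult_right integrable_real_indicator) auto
  show "integrable (count_space D) (\<lambda>a. indicator E a * f a)"
    unfolding eq using int by (rule Bochner_Integration.integrable_sum)
  have "(LINT a|count_space D. indicator E a * f a) = (\<Sum>e\<in>E. LINT a|count_space D. f e * indicator {e} a)"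
    unfolding eq using int by (rule Bochner_Integration.integral_sum)
  also have "\<dots> = (\<Sum>e\<in>E. f e)"
  proof (rule sum.cong[OF refl])
    fix e assume "e \<in> E"
    then have "{e} \<inter> D = {e}" "{e} \<subseteq> D" using assms(2) by auto
    then show "(LINT a|count_space D. f e * indicator {e} a) = f e"
      by (simp add: measure_count_space)
  qed
  finally show "(LINT a|count_space D. indicator E a * f a) = (\<Sum>a\<in>E. f a)" .
qed

lemma grid_block_iff:
  "N > 0 \<Longrightarrow> a \<in> grid_block N p q \<longleftrightarrow> (of_int a - 1) / real N \<in> {p<..q}"
proof -
  assume N: "N > 0"
  have "a \<in> grid_block N p q \<longleftrightarrow> \<lfloor>real N * p\<rfloor> < a - 1 \<and> a - 1 \<le> \<lfloor>real N * q\<rfloor>"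
    by (auto simp: grid_block_def)
  also have "\<dots> \<longleftrightarrow> real N * p < of_int a - 1 \<and> of_int a - 1 \<le> real N * q"
    by (simp add: floor_less_iff le_floor_iff)
  also have "\<dots> \<longleftrightarrow> (of_int a - 1) / real N \<in> {p<..q}"
    using N by (auto simp: field_simps)
  finally show ?thesis .
qed

lemma off_diagonal_less: "j \<in> off_diagonal k {..<m} \<Longrightarrow> i < k \<Longrightarrow> j i < m"
  by (auto simp: off_diagonal_def PiE_def Pi_def)

lemma finite_off_diagonal [simp]: "finite (off_diagonal k {..<m :: nat})"
  unfolding off_diagonal_def by (rule finite_subset[OF _ finite_PiE[of "{..<k}" "\<lambda>_. {..<m}"]]) auto

text \<open>Samples the step function at the excluded left end points of the cells; the power of 1 /
  sqrt N is inverse to the factor in the cell bound for chaos sums.\<close>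

definition step_coeff :: "nat \<Rightarrow> nat \<Rightarrow> (nat \<Rightarrow> real) \<Rightarrow> ((nat \<Rightarrow> nat) \<Rightarrow> real) \<Rightarrow> nat \<Rightarrow> (nat \<Rightarrow> int) \<Rightarrow> real" where
  "step_coeff k m p c N a = (1 / sqrt (real N)) ^ k * step_fun k m p c (\<lambda>i. (of_int (a i) - 1) / real N)"

lemma step_coeff_eq_indicator:
  assumes "N > 0" "a \<in> off_diagonal k UNIV"
  shows "step_coeff k m p c N a = (1 / sqrt (real N)) ^ k * (\<Sum>j\<in>off_diagonal k {..<m}.
    c j * indicator (PiE {..<k} (\<lambda>i. grid_block N (p (j i)) (p (Suc (j i))))) a)"
proof -
  have "(\<Prod>i<k. indicator {p (j i)<..p (Suc (j i))} ((of_int (a i) - 1) / real N))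
      = (indicator (PiE {..<k} (\<lambda>i. grid_block N (p (j i)) (p (Suc (j i))))) a :: real)" for j
  proof -
    have "(\<Prod>i<k. indicator {p (j i)<..p (Suc (j i))} ((of_int (a i) - 1) / real N) :: real)
        = (\<Prod>i<k. if a i \<in> grid_block N (p (j i)) (p (Suc (j i))) then 1 else 0)"
      by (intro prod.cong refl) (simp only: indicator_def grid_block_iff[OF assms(1)] of_bool_def)
    also have "\<dots> = (if \<forall>i<k. a i \<in> grid_block N (p (j i)) (p (Suc (j i))) then 1 else 0)"
      by (auto simp: prod_zero_iff)
    also have "\<dots> = indicator (PiE {..<k} (\<lambda>i. grid_block N (p (j i)) (p (Suc (j i))))) a"
      using assms(2) by (auto simp: indicator_def off_diagonal_def PiE_def)
    finally show ?thesis .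
  qed
  then show ?thesis by (simp only: step_coeff_def step_fun_def)
qed

text \<open>Distinct intervals of the grid give disjoint index blocks and j is injective, so no
  noise variable is repeated within a box.\<close>

lemma step_block_off_diagonal:
  assumes p: "strict_mono_on {..m} p" and j: "j \<in> off_diagonal k {..<m}"
  shows "PiE {..<k} (\<lambda>i. grid_block N (p (j i)) (p (Suc (j i)))) \<subseteq> off_diagonal k UNIV"
proof
  fix a assume a: "a \<in> PiE {..<k} (\<lambda>i. grid_block N (p (j i)) (p (Suc (j i))))"
  have "inj_on a {..<k}"
  proof (rule inj_onI, rule ccontr)
    fix i i' assume i: "i \<in> {..<k}" "i' \<in> {..<k}" "a i = a i'" "i \<noteq> i'"
    then have "j i \<noteq> j i'" using j by (auto simp: off_diagonal_def inj_on_def)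
    then have "grid_block N (p (j i)) (p (Suc (j i))) \<inter> grid_block N (p (j i')) (p (Suc (j i'))) = {}"
      using i off_diagonal_less[OF j] by (intro grid_block_disjoint[OF p]) auto
    moreover have "a i \<in> grid_block N (p (j i)) (p (Suc (j i)))" "a i' \<in> grid_block N (p (j i')) (p (Suc (j i')))"
      using PiE_mem[OF a i(1)] PiE_mem[OF a i(2)] by blast+
    ultimately show False using i(3) by auto
  qed
  then show "a \<in> off_diagonal k UNIV" using a by (auto simp: off_diagonal_def PiE_def)
qed

lemma step_coeff_integrable:
  assumes N: "N > 0" and p: "strict_mono_on {..m} p"
  shows "integrable (count_space (off_diagonal k UNIV)) (step_coeff k m p c N)"
proof -
  let ?E = "\<lambda>j. PiE {..<k} (\<lambda>i. grid_block N (p (j i)) (p (Suc (j i))))"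
  have int: "integrable (count_space (off_diagonal k UNIV)) (\<lambda>a. c j * indicator (?E j) a)"
    if "j \<in> off_diagonal k {..<m}" for j
  proof -
    have "finite (?E j)" by (intro finite_PiE) (auto simp: grid_block_def)
    from integral_count_space_indicator_finite(1)[OF this step_block_off_diagonal[OF p that], of "\<lambda>_. c j"]
    show ?thesis by (simp only: mult.commute[of "c j"])
  qed
  have "integrable (count_space (off_diagonal k UNIV)) (\<lambda>a. (1 / sqrt (real N)) ^ k *
      (\<Sum>j\<in>off_diagonal k {..<m}. c j * indicator (?E j) a))"
    by (rule integrable_mult_right, rule Bochner_Integration.integrable_sum, rule int)
  moreover have "integrable (count_space (off_diagonal k UNIV)) (step_coeff k m p c N) \<longleftrightarrow>
      integrable (count_space (off_diagonal k UNIV)) (\<lambda>a. (1 / sqrt (real N)) ^ k *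
      (\<Sum>j\<in>off_diagonal k {..<m}. c j * indicator (?E j) a))"
    by (intro Bochner_Integration.integrable_cong refl step_coeff_eq_indicator[OF N]) simp
  ultimately show ?thesis by blast
qed

context iid_noise
begin

lemma block_sum_diff:
  assumes "x0 \<le> p" "p \<le> q"
  shows "block_sum N x0 q \<omega> - block_sum N x0 p \<omega> = block_sum N p q \<omega>"
proof -
  have "\<lfloor>real N * x0\<rfloor> \<le> \<lfloor>real N * p\<rfloor>" "\<lfloor>real N * p\<rfloor> \<le> \<lfloor>real N * q\<rfloor>"
    using assms by (auto intro!: floor_mono mult_left_mono)
  then have "grid_block N x0 q = grid_block N x0 p \<union> grid_block N p q" "grid_block N x0 p \<inter> grid_block N p q = {}"
    by (auto simp: grid_block_def)
  then have "(\<Sum>a\<in>grid_block N x0 q. \<epsilon> a \<omega>) = (\<Sum>a\<in>grid_block N x0 p. \<epsilon> a \<omega>) + (\<Sum>a\<in>grid_block N p q. \<epsilon> a \<omega>)"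
    by (simp add: sum.union_disjoint grid_block_def)
  then show ?thesis by (simp add: block_sum_def add_divide_distrib)
qed

text \<open>With step coefficients the chaos sum factors over boxes into products of block sums. It
  is thus the same polynomial \<open>step_integral\<close>, with B replaced by the rescaled random
  walk started at a point x0 left of the grid.\<close>

lemma chaos_sum_step_coeff:
  assumes N: "N > 0" and p: "strict_mono_on {..m} p" and x0: "m > 0 \<Longrightarrow> x0 \<le> p 0"
  shows "chaos_sum k \<epsilon> (step_coeff k m p c N) \<omega> = step_integral (block_sum N x0) k m p c \<omega>"
proof -
  let ?E = "\<lambda>j. PiE {..<k} (\<lambda>i. grid_block N (p (j i)) (p (Suc (j i))))"
  let ?D = "off_diagonal k (UNIV :: int set)"
  let ?P = "\<lambda>a. \<Prod>i<k. \<epsilon> (a i) \<omega>"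
  have fin: "finite (?E j)" for j by (intro finite_PiE) (auto simp: grid_block_def)
  have "chaos_sum k \<epsilon> (step_coeff k m p c N) \<omega>
      = (LINT a|count_space ?D. (1 / sqrt (real N)) ^ k * (\<Sum>j\<in>off_diagonal k {..<m}. c j * (indicator (?E j) a * ?P a)))"
    unfolding chaos_sum_def
  proof (intro Bochner_Integration.integral_cong refl)
    fix a assume "a \<in> space (count_space ?D)"
    then have "a \<in> ?D" by simp
    from step_coeff_eq_indicator[OF N this]
    show "step_coeff k m p c N a * ?P a
      = (1 / sqrt (real N)) ^ k * (\<Sum>j\<in>off_diagonal k {..<m}. c j * (indicator (?E j) a * ?P a))"
      by (simp only: sum_distrib_right mult.assoc)
  qed
  also have "\<dots> = (1 / sqrt (real N)) ^ k * (\<Sum>j\<in>off_diagonal k {..<m}. c j * (LINT a|count_space ?D. indicator (?E j) a * ?P a))"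
    by (simp add: integral_count_space_indicator_finite[OF fin step_block_off_diagonal[OF p]])
  also have "\<dots> = (1 / sqrt (real N)) ^ k * (\<Sum>j\<in>off_diagonal k {..<m}. c j * (\<Sum>a\<in>?E j. ?P a))"
    by (intro arg_cong2[where f="(*)"] sum.cong refl)
      (simp add: integral_count_space_indicator_finite[OF fin step_block_off_diagonal[OF p]])
  also have "\<dots> = (\<Sum>j\<in>off_diagonal k {..<m}. c j * (\<Prod>i<k. block_sum N (p (j i)) (p (Suc (j i))) \<omega>))"
  proof -
    have "(1 / sqrt (real N)) ^ k * (\<Sum>a\<in>?E j. ?P a) = (\<Prod>i<k. block_sum N (p (j i)) (p (Suc (j i))) \<omega>)" for j
    proof -
      have "(\<Sum>a\<in>?E j. ?P a) = (\<Prod>i<k. \<Sum>a\<in>grid_block N (p (j i)) (p (Suc (j i))). \<epsilon> a \<omega>)"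
        by (subst prod_sum_PiE) (auto simp: grid_block_def)
      then show ?thesis
        by (simp add: block_sum_def prod_dividef power_one_over field_simps)
    qed
    note * = this
    show ?thesis
      unfolding *[symmetric] by (subst sum_distrib_left) (intro sum.cong refl mult.left_commute)
  qed
  also have "\<dots> = step_integral (block_sum N x0) k m p c \<omega>"
    unfolding step_integral_def
  proof (intro sum.cong refl arg_cong2[where f="(*)"] prod.cong)
    fix j i assume ji: "j \<in> off_diagonal k {..<m}" "i \<in> {..<k}"
    then have lt: "j i < m" by (auto dest: off_diagonal_less)
    have "x0 \<le> p (j i)" using x0 lt strict_mono_on_leD[OF p, of 0 "j i"] by (auto intro: order_trans)
    moreover have "p (j i) \<le> p (Suc (j i))" using lt strict_mono_on_leD[OF p, of "j i" "Suc (j i)"] by auto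
    ultimately show "block_sum N (p (j i)) (p (Suc (j i))) \<omega> = block_sum N x0 (p (Suc (j i))) \<omega> - block_sum N x0 (p (j i)) \<omega>"
      by (rule block_sum_diff[symmetric])
  qed
  finally show ?thesis .
qed

end

text \<open>The sampling point lies strictly left of y and tends to y: y = p stays outside and y = q
  eventually inside, so convergence holds at the jumps too.\<close>

lemma indicator_grid_tendsto:
  fixes y :: real
  shows "(\<lambda>N. indicator {p<..q} ((of_int \<lceil>real (Suc N) * y\<rceil> - 1) / real (Suc N)) :: real) \<longlonglongrightarrow> indicator {p<..q} y"
proof -
  let ?y = "\<lambda>N. (of_int \<lceil>real (Suc N) * y\<rceil> - 1) / real (Suc N)"
  have lt: "?y N < y" for N
  proof -
    have "of_int \<lceil>real (Suc N) * y\<rceil> - 1 < real (Suc N) * y" by linarith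
    then show ?thesis by (simp only: pos_divide_less_eq of_nat_0_less_iff zero_less_Suc mult.commute)
  qed
  have lim: "?y \<longlonglongrightarrow> y"
    using tendsto_diff[OF LIMSEQ_Suc[OF grid_up_tendsto[of y]] LIMSEQ_Suc[OF lim_1_over_n]]
    by (simp add: grid_up_def diff_divide_distrib)
  have "eventually (\<lambda>N. indicator {p<..q} (?y N) = (indicator {p<..q} y :: real)) sequentially"
  proof (cases "y \<le> p")
    case True
    then show ?thesis using lt by (auto intro!: always_eventually simp: indicator_def dest: less_le_trans) (meson less_le_trans lt not_less_iff_gr_or_eq)
  next
    case False
    show ?thesis
    proof (cases "y \<le> q")
      case True
      from order_tendstoD(1)[OF lim, of p] False show ?thesis
        using True lt by (auto elim!: eventually_mono simp: indicator_def intro: less_imp_le less_le_trans)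
    next
      case False
      from order_tendstoD(1)[OF lim, of q] False show ?thesis
        by (auto elim!: eventually_mono simp: indicator_def)
    qed
  qed
  then show ?thesis by (rule tendsto_eventually)
qed

lemma step_fun_measurable [measurable]: "step_fun k m p c \<in> borel_measurable (lebesgue_pow k)"
  unfolding step_fun_def[abs_def] by measurable

definition shifted_grid :: "nat \<Rightarrow> (nat \<Rightarrow> real) \<Rightarrow> nat \<Rightarrow> real" where
  "shifted_grid N y = (\<lambda>i. (of_int \<lceil>real N * y i\<rceil> - 1) / real N)"

lemma step_fun_shifted_grid_measurable [measurable]:
  "(\<lambda>y. step_fun k m p c (shifted_grid N y)) \<in> borel_measurable (lebesgue_pow k)"
  unfolding step_fun_def shifted_grid_def by measurable

lemma step_fun_shifted_grid_tendsto:
  assumes p: "strict_mono_on {..m} p"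
  shows "L2_tendsto (lebesgue_pow k) (\<lambda>N y. step_fun k m p c (shifted_grid (Suc N) y)) (step_fun k m p c)"
proof -
  define S where "S = (\<Sum>j\<in>off_diagonal k {..<m}. \<bar>c j\<bar>)"
  \<comment> \<open>y exceeds its sampling point by at most the mesh, which is at most 1, so the
    enlarged interval contains every y whose sampling point lies in (p 0, p m].\<close>
  define I where "I = {p 0..p m + 1}"
  define b where "b y = (\<Prod>i<k. indicator I (y i) :: real)" for y :: "nat \<Rightarrow> real"
  have S0: "S \<ge> 0" by (simp add: S_def sum_nonneg)
  have b01: "b y \<in> {0..1}" for y unfolding b_def by (auto intro!: prod_nonneg prod_le_1)
  have [measurable]: "b \<in> borel_measurable (lebesgue_pow k)" unfolding b_def I_def by measurable
  have bound: "\<bar>step_fun k m p c z\<bar> \<le> S * b y"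
    if z: "\<And>i. i < k \<Longrightarrow> z i \<in> {p 0<..p m} \<Longrightarrow> y i \<in> I" for z y
  proof -
    have "\<bar>step_fun k m p c z\<bar> \<le> (\<Sum>j\<in>off_diagonal k {..<m}. \<bar>c j\<bar> * b y)"
      unfolding step_fun_def
    proof (rule order_trans[OF sum_abs], rule sum_mono)
      fix j assume j: "j \<in> off_diagonal k {..<m}"
      have "(\<Prod>i<k. indicator {p (j i)<..p (Suc (j i))} (z i) :: real) \<le> b y"
        unfolding b_def
      proof (intro prod_mono conjI)
        fix i assume "i \<in> {..<k}"
        then have i: "i < k" by simp
        have ji: "j i < m" using j i by (rule off_diagonal_less)
        have "p 0 \<le> p (j i)" "p (Suc (j i)) \<le> p m"
          using strict_mono_on_leD[OF p, of 0 "j i"] strict_mono_on_leD[OF p, of "Suc (j i)" m] ji by auto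
        then show "(indicator {p (j i)<..p (Suc (j i))} (z i) :: real) \<le> indicator I (y i)"
          using z[OF i] by (auto simp: indicator_def)
      qed auto
      moreover have "0 \<le> (\<Prod>i<k. indicator {p (j i)<..p (Suc (j i))} (z i) :: real)" by (intro prod_nonneg) auto
      ultimately show "\<bar>c j * (\<Prod>i<k. indicator {p (j i)<..p (Suc (j i))} (z i))\<bar> \<le> \<bar>c j\<bar> * b y"
        by (auto simp: abs_mult intro!: mult_left_mono)
    qed
    then show ?thesis by (simp add: S_def sum_distrib_right)
  qed
  let ?f = "\<lambda>N y. step_fun k m p c (shifted_grid (Suc N) y)"
  let ?g = "step_fun k m p c"
  have bg: "\<bar>?g y\<bar> \<le> S * b y" for y by (rule bound) (auto simp: I_def)
  have bf: "\<bar>?f N y\<bar> \<le> S * b y" for N y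
  proof (rule bound)
    fix i assume "shifted_grid (Suc N) y i \<in> {p 0<..p m}"
    then have sg: "p 0 < grid_up (Suc N) (y i) - 1 / real (Suc N)" "grid_up (Suc N) (y i) - 1 / real (Suc N) \<le> p m"
      by (auto simp: shifted_grid_def grid_up_def diff_divide_distrib simp del: of_nat_Suc)
    have "1 / real (Suc N) \<le> 1" by simp
    then show "y i \<in> I"
      using grid_up_bounds[of "Suc N" "y i"] sg unfolding I_def atLeastAtMost_iff by linarith
  qed
  have "(\<lambda>N. \<integral>\<^sup>+y. ennreal ((?f N y - ?g y)\<^sup>2) \<partial>lebesgue_pow k) \<longlonglongrightarrow> (\<integral>\<^sup>+y. 0 \<partial>lebesgue_pow k)"
  proof (rule nn_integral_dominated_convergence[where w="\<lambda>y. ennreal (4 * S\<^sup>2) * (\<Prod>i<k. indicator I (y i))"])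
    fix N
    show "AE y in lebesgue_pow k. ennreal ((?f N y - ?g y)\<^sup>2) \<le> ennreal (4 * S\<^sup>2) * (\<Prod>i<k. indicator I (y i))"
    proof (rule AE_I2)
      fix y
      have "\<bar>?f N y - ?g y\<bar> \<le> 2 * S * b y" using bf[of N y] bg[of y] abs_triangle_ineq4[of "?f N y" "?g y"] by linarith
      then have "(?f N y - ?g y)\<^sup>2 \<le> (2 * S * b y)\<^sup>2"
        by (metis abs_ge_zero power2_abs power_mono)
      also have "\<dots> = 4 * S\<^sup>2 * (b y)\<^sup>2" by (simp add: power_mult_distrib)
      also have "\<dots> \<le> 4 * S\<^sup>2 * b y"
        using b01[of y] by (intro mult_left_mono) (auto simp: power2_eq_square mult_left_le)
      finally have "ennreal ((?f N y - ?g y)\<^sup>2) \<le> ennreal (4 * S\<^sup>2 * b y)" by (rule ennreal_leI)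
      also have "\<dots> = ennreal (4 * S\<^sup>2) * ennreal (b y)"
        using b01[of y] by (intro ennreal_mult) auto
      also have "ennreal (b y) = (\<Prod>i<k. indicator I (y i))"
        unfolding b_def by (subst prod_ennreal[symmetric]) (auto simp: ennreal_indicator)
      finally show "ennreal ((?f N y - ?g y)\<^sup>2) \<le> ennreal (4 * S\<^sup>2) * (\<Prod>i<k. indicator I (y i))" .
    qed
  next
    have "(\<integral>\<^sup>+y. ennreal (4 * S\<^sup>2) * (\<Prod>i<k. indicator I (y i)) \<partial>lebesgue_pow k)
        = ennreal (4 * S\<^sup>2) * (\<Prod>i<k. \<integral>\<^sup>+x. indicator I x \<partial>lborel)"
      by (subst nn_integral_lebesgue_pow_prod[symmetric]) (auto simp: I_def intro!: nn_integral_cmult)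
    also have "\<dots> = ennreal (4 * S\<^sup>2) * (\<Prod>i<k. emeasure lborel I)"
      by (simp add: I_def)
    also have "\<dots> < \<infinity>"
    proof -
      have "emeasure lborel I < top" by (simp add: I_def emeasure_lborel_Icc_eq)
      then show ?thesis by (simp add: ennreal_mult_less_top power_less_top_ennreal)
    qed
    finally show "(\<integral>\<^sup>+y. ennreal (4 * S\<^sup>2) * (\<Prod>i<k. indicator I (y i)) \<partial>lebesgue_pow k) < \<infinity>" .
  next
    show "AE y in lebesgue_pow k. (\<lambda>N. ennreal ((?f N y - ?g y)\<^sup>2)) \<longlonglongrightarrow> 0"
    proof (rule AE_I2)
      fix y :: "nat \<Rightarrow> real"
      have "(\<lambda>N. ?f N y) \<longlonglongrightarrow> ?g y"
        unfolding step_fun_def shifted_grid_def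
        by (intro tendsto_sum tendsto_mult tendsto_const tendsto_prod indicator_grid_tendsto)
      then have "(\<lambda>N. (?f N y - ?g y)\<^sup>2) \<longlonglongrightarrow> (?g y - ?g y)\<^sup>2" by (intro tendsto_intros)
      then show "(\<lambda>N. ennreal ((?f N y - ?g y)\<^sup>2)) \<longlonglongrightarrow> 0" using tendsto_ennrealI by fastforce
    qed
  qed (auto simp: I_def)
  then show ?thesis by (simp add: L2_tendsto_def)
qed

text \<open>Both quantities are chaos sums in the same noise, so their difference is almost surely
  the chaos sum of the coefficient difference, and its mean square is controlled by the L2 distance
  of two kernels on R^k.\<close>

lemma (in iid_noise) coupling_error:
  assumes k: "k \<ge> 1" and H: "H = 1 + real k * d - real k / 2" and lam: "lam > 0" and N: "N > 0"
    and t: "t \<in> {0..1}" and p: "strict_mono_on {..m} p" and x0: "m > 0 \<Longrightarrow> x0 \<le> p 0"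
  shows "mean_sq M (\<lambda>\<omega>. normalized_sum k H d lam N (nat \<lfloor>real N * t\<rfloor>) \<omega>
      - step_integral (block_sum N x0) k m p c \<omega>)
    \<le> ennreal (real (k ^ k)) * mean_sq (lebesgue_pow k) (\<lambda>y. discretized_kernel k d lam N 0 \<lfloor>real N * t\<rfloor> y
        - step_fun k m p c (shifted_grid N y))"
proof -
  let ?c = "partial_sum_coeff k H d lam N 0 \<lfloor>real N * t\<rfloor>"
  let ?s = "step_coeff k m p c N"
  have fl: "int (nat \<lfloor>real N * t\<rfloor>) = \<lfloor>real N * t\<rfloor>" using t by simp
  have ivl: "{1..\<lfloor>real N * t\<rfloor>} = {0<..\<lfloor>real N * t\<rfloor>}" by auto
  note ci = partial_sum_coeff_integrable[OF lam N, of k H d 0 "\<lfloor>real N * t\<rfloor>"]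
  note si = step_coeff_integrable[OF N p, of k c]
  have "AE \<omega> in M. normalized_sum k H d lam N (nat \<lfloor>real N * t\<rfloor>) \<omega>
      - step_integral (block_sum N x0) k m p c \<omega> = chaos_sum k \<epsilon> (\<lambda>a. ?c a - ?s a) \<omega>"
    using AE_partial_sum_eq_chaos_sum[OF lam N, where H=H and d=d and k=k and ?n1.0=0 and ?n2.0="\<lfloor>real N * t\<rfloor>"]
      AE_chaos_sum_diff[OF ci si]
    by eventually_elim (simp only: normalized_sum_def fl ivl chaos_sum_step_coeff[OF N p x0])
  then have "mean_sq M (\<lambda>\<omega>. normalized_sum k H d lam N (nat \<lfloor>real N * t\<rfloor>) \<omega>
      - step_integral (block_sum N x0) k m p c \<omega>)
      = mean_sq M (\<lambda>\<omega>. chaos_sum k \<epsilon> (\<lambda>a. ?c a - ?s a) \<omega>)"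
    by (intro nn_integral_cong_AE) (auto elim: eventually_mono)
  also have "\<dots> \<le> ennreal (real (k ^ k)) *
      mean_sq (lebesgue_pow k) (\<lambda>y. sqrt (real N) ^ k * (?c (grid_cell k N y) - ?s (grid_cell k N y)))"
    by (rule nn_integral_chaos_sum_square_le_grid[OF N Bochner_Integration.integrable_diff[OF ci si]])
  also have "(\<lambda>y. sqrt (real N) ^ k * (?c (grid_cell k N y) - ?s (grid_cell k N y)))
      = (\<lambda>y. discretized_kernel k d lam N 0 \<lfloor>real N * t\<rfloor> y - step_fun k m p c (shifted_grid N y))"
  proof
    fix y :: "nat \<Rightarrow> real"
    have sq: "sqrt (real N) ^ k * (1 / sqrt (real N)) ^ k = 1"
      using N by (simp flip: power_mult_distrib)
    have "step_fun k m p c (\<lambda>i. (of_int (grid_cell k N y i) - 1) / real N) = step_fun k m p c (shifted_grid N y)"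
      unfolding step_fun_def by (intro sum.cong refl arg_cong2[where f="(*)"] prod.cong)
        (simp add: grid_cell_def shifted_grid_def)
    then have "sqrt (real N) ^ k * ?s (grid_cell k N y) = step_fun k m p c (shifted_grid N y)"
      unfolding step_coeff_def mult.assoc[symmetric] sq by simp
    then show "sqrt (real N) ^ k * (?c (grid_cell k N y) - ?s (grid_cell k N y))
        = discretized_kernel k d lam N 0 \<lfloor>real N * t\<rfloor> y - step_fun k m p c (shifted_grid N y)"
      by (simp only: right_diff_distrib partial_sum_coeff_grid_cell[OF N H])
  qed
  finally show ?thesis .
qed

section \<open>Combining the approximation errors\<close>

lemma nn_integral_square_sum3:
  fixes f g h :: "'x \<Rightarrow> real"
  assumes [measurable]: "f \<in> borel_measurable M" "g \<in> borel_measurable M" "h \<in> borel_measurable M"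
  shows "mean_sq M (\<lambda>x. f x + g x + h x) \<le> 3 * (mean_sq M f
    + mean_sq M g + mean_sq M h)"
proof -
  have le: "(a + b + c)\<^sup>2 \<le> 3 * (a\<^sup>2 + b\<^sup>2 + c\<^sup>2)" for a b c :: real
  proof -
    have "0 \<le> (a - b)\<^sup>2 + (b - c)\<^sup>2 + (a - c)\<^sup>2" by simp
    then show ?thesis by (simp add: power2_eq_square algebra_simps)
  qed
  have "mean_sq M (\<lambda>x. f x + g x + h x)
      \<le> (\<integral>\<^sup>+x. 3 * (ennreal ((f x)\<^sup>2) + ennreal ((g x)\<^sup>2) + ennreal ((h x)\<^sup>2)) \<partial>M)"
  proof (intro nn_integral_mono)
    fix x
    have "ennreal ((f x + g x + h x)\<^sup>2) \<le> ennreal (3 * ((f x)\<^sup>2 + (g x)\<^sup>2 + (h x)\<^sup>2))"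
      by (rule ennreal_leI[OF le])
    also have "\<dots> = 3 * (ennreal ((f x)\<^sup>2) + ennreal ((g x)\<^sup>2) + ennreal ((h x)\<^sup>2))"
      by (simp add: ennreal_mult)
    finally show "ennreal ((f x + g x + h x)\<^sup>2) \<le> 3 * (ennreal ((f x)\<^sup>2) + ennreal ((g x)\<^sup>2) + ennreal ((h x)\<^sup>2))" .
  qed
  also have "\<dots> = 3 * (mean_sq M f
    + mean_sq M g + mean_sq M h)"
    by (simp add: nn_integral_cmult nn_integral_add)
  finally show ?thesis .
qed

text \<open>Three errors of at most \<delta> each: discretized kernel to kernel, kernel to step
  function, step function to its shifted version. The three-term square inequality multiplies their
  sum 3 \<delta> by 3.\<close>

lemma (in iid_noise) eventually_coupling_error:
  assumes k: "k \<ge> 1" and H: "H = 1 + real k * d - real k / 2" and lam: "lam > 0"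
    and d: "d > 1/2 - 1 / (2 * real k)"
    and t: "t \<in> {0..1}" and p: "strict_mono_on {..m} p" and x0: "m > 0 \<Longrightarrow> x0 \<le> p 0"
    and ker [measurable]: "tempered_hermite_kernel k H lam t \<in> borel_measurable (lebesgue_pow k)"
    and \<delta>: "\<delta> > 0"
    and approx: "mean_sq (lebesgue_pow k) (\<lambda>y. step_fun k m p c y - tempered_hermite_kernel k H lam t y) \<le> ennreal \<delta>"
  shows "eventually (\<lambda>N. mean_sq M (\<lambda>\<omega>. normalized_sum k H d lam (Suc N) (nat \<lfloor>real (Suc N) * t\<rfloor>) \<omega>
      - step_integral (block_sum (Suc N) x0) k m p c \<omega>) \<le> ennreal (real (k ^ k) * (9 * \<delta>))) sequentially"
proof -
  let ?L = "lebesgue_pow k"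
  let ?ker = "tempered_hermite_kernel k H lam t" and ?g = "step_fun k m p c"
  let ?f = "\<lambda>N. discretized_kernel k d lam (Suc N) 0 \<lfloor>real (Suc N) * t\<rfloor>"
  let ?gN = "\<lambda>N y. step_fun k m p c (shifted_grid (Suc N) y)"
  \<comment> \<open>The hypothesis on d leaves room for an exponent above the threshold, below 1/2
    and at most d; k >= 1 puts the threshold itself below 1/2.\<close>
  have "1/2 - 1 / (2 * real k) < min d (1/2)" using d k by auto
  then obtain e where e: "1/2 - 1 / (2 * real k) < e" "e < 1/2" "e \<le> d"
    using dense by (metis less_imp_le min_less_iff_conj)
  obtain C where C: "C > 0" "\<And>x. tempered_power d lam x \<le> C * tempered_power e 0 x"
    using tempered_power_le[OF e(3) lam] by blast
  have "(\<lambda>N. \<integral>\<^sup>+y. ennreal ((?f N y - ?ker y)\<^sup>2) \<partial>?L) \<longlonglongrightarrow> 0"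
    using L2_discretized_kernel_tendsto[OF k H t e(1,2) C ker] by (simp add: L2_tendsto_def)
  then have ev1: "eventually (\<lambda>N. mean_sq ?L (\<lambda>y. ?f N y - ?ker y) < ennreal \<delta>) sequentially"
    using \<delta> by (intro order_tendstoD(2)) auto
  have "(\<lambda>N. \<integral>\<^sup>+y. ennreal ((?gN N y - ?g y)\<^sup>2) \<partial>?L) \<longlonglongrightarrow> 0"
    using step_fun_shifted_grid_tendsto[OF p, of k c] by (simp add: L2_tendsto_def)
  then have ev2: "eventually (\<lambda>N. mean_sq ?L (\<lambda>y. ?gN N y - ?g y) < ennreal \<delta>) sequentially"
    using \<delta> by (intro order_tendstoD(2)) auto
  show ?thesis
    using ev1 ev2
  proof eventually_elim
    fix N
    assume 1: "mean_sq ?L (\<lambda>y. ?f N y - ?ker y) < ennreal \<delta>"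
      and 2: "mean_sq ?L (\<lambda>y. ?gN N y - ?g y) < ennreal \<delta>"
    have c: "(\<lambda>y. ennreal ((?ker y - ?g y)\<^sup>2)) = (\<lambda>y. ennreal ((?g y - ?ker y)\<^sup>2))"
      and c': "(\<lambda>y. ennreal ((?g y - ?gN N y)\<^sup>2)) = (\<lambda>y. ennreal ((?gN N y - ?g y)\<^sup>2))"
      by (intro ext arg_cong[where f=ennreal] power2_commute)+
    have "mean_sq M (\<lambda>\<omega>. normalized_sum k H d lam (Suc N) (nat \<lfloor>real (Suc N) * t\<rfloor>) \<omega>
      - step_integral (block_sum (Suc N) x0) k m p c \<omega>)
      \<le> ennreal (real (k ^ k)) * mean_sq ?L (\<lambda>y. ?f N y - ?gN N y)"
      by (rule coupling_error[OF k H lam zero_less_Suc t p x0])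
    also have "mean_sq ?L (\<lambda>y. ?f N y - ?gN N y)
        = mean_sq ?L (\<lambda>y. (?f N y - ?ker y) + (?ker y - ?g y) + (?g y - ?gN N y))"
      by simp
    also have "\<dots> \<le> 3 * (mean_sq ?L (\<lambda>y. ?f N y - ?ker y) + mean_sq ?L (\<lambda>y. ?ker y - ?g y)
        + mean_sq ?L (\<lambda>y. ?g y - ?gN N y))"
      by (rule nn_integral_square_sum3) measurable
    also have "\<dots> \<le> 3 * (ennreal \<delta> + ennreal \<delta> + ennreal \<delta>)"
      unfolding c c' using 1 2 approx by (intro mult_left_mono add_mono) (auto intro: less_imp_le)
    also have "\<dots> = ennreal (9 * \<delta>)"
    proof -
      have "ennreal \<delta> + ennreal \<delta> + ennreal \<delta> = ennreal (\<delta> + \<delta> + \<delta>)" using \<delta> by (simp flip: ennreal_plus)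
      then have "3 * (ennreal \<delta> + ennreal \<delta> + ennreal \<delta>) = ennreal 3 * ennreal (\<delta> + \<delta> + \<delta>)" by simp
      also have "\<dots> = ennreal (3 * (\<delta> + \<delta> + \<delta>))" using \<delta> by (intro ennreal_mult[symmetric]) auto
      finally show ?thesis by (simp add: algebra_simps)
    qed
    finally show "mean_sq M (\<lambda>\<omega>. normalized_sum k H d lam (Suc N) (nat \<lfloor>real (Suc N) * t\<rfloor>) \<omega>
      - step_integral (block_sum (Suc N) x0) k m p c \<omega>) \<le> ennreal (real (k ^ k) * (9 * \<delta>))"
      using \<delta> by (simp add: mult_left_mono ennreal_mult)
  qed
qed

text \<open>Recovers V x - V (q 0) at points x of the partition q from the increments of V along q,
  which makes step integrals functions of the increment vector.\<close>

definition increment_sum :: "nat \<Rightarrow> (nat \<Rightarrow> real) \<Rightarrow> real \<Rightarrow> (nat \<Rightarrow> real) \<Rightarrow> real" where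
  "increment_sum n q x v = (\<Sum>l\<in>{l. l < n \<and> q (Suc l) \<le> x}. v l)"

lemma increment_sum_eq:
  assumes q: "strict_mono_on {..n} q" and j: "j \<le> n"
  shows "increment_sum n q (q j) (\<lambda>l. if l < n then V (q (Suc l)) - V (q l) else 0) = V (q j) - V (q 0)"
proof -
  have "{l. l < n \<and> q (Suc l) \<le> q j} = {..<j}"
  proof (intro set_eqI iffI)
    fix l assume l: "l \<in> {l. l < n \<and> q (Suc l) \<le> q j}"
    then show "l \<in> {..<j}"
      using strict_mono_onD[OF q, of j "Suc l"] j by (cases "l < j") (auto simp: not_less)
  next
    fix l assume "l \<in> {..<j}"
    then show "l \<in> {l. l < n \<and> q (Suc l) \<le> q j}"
      using strict_mono_on_leD[OF q, of "Suc l" j] j by auto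
  qed
  then have "increment_sum n q (q j) (\<lambda>l. if l < n then V (q (Suc l)) - V (q l) else 0)
      = (\<Sum>l<j. if l < n then V (q (Suc l)) - V (q l) else 0)"
    by (simp only: increment_sum_def)
  also have "\<dots> = (\<Sum>l<j. V (q (Suc l)) - V (q l))"
    using j by (intro sum.cong) auto
  also have "\<dots> = V (q j) - V (q 0)" by (rule sum_lessThan_telescope)
  finally show ?thesis .
qed

text \<open>If q refines the grid of the step function, its integral is a fixed polynomial in the
  increments along q. The same polynomial serves the random walk and B, and one q serves several
  times jointly.\<close>

lemma step_integral_eq_increments:
  assumes q: "strict_mono_on {..n} q" and p: "\<And>l. l \<le> m \<Longrightarrow> p l \<in> q ` {..n}"
  shows "step_integral V k m p c \<omega>
    = step_integral (increment_sum n q) k m p c (\<lambda>l. if l < n then V (q (Suc l)) \<omega> - V (q l) \<omega> else 0)"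
proof -
  let ?v = "\<lambda>l. if l < n then V (q (Suc l)) \<omega> - V (q l) \<omega> else 0"
  have R: "increment_sum n q (p l) ?v = V (p l) \<omega> - V (q 0) \<omega>" if "l \<le> m" for l
  proof -
    have "p l \<in> q ` {..n}" using that by (rule p)
    then obtain j where "j \<le> n" "p l = q j" by auto
    then show ?thesis using increment_sum_eq[OF q, of j "\<lambda>x. V x \<omega>"] by simp
  qed
  show ?thesis
    unfolding step_integral_def
  proof (intro sum.cong refl arg_cong2[where f="(*)"] prod.cong)
    fix j i assume "j \<in> off_diagonal k {..<m}" "i \<in> {..<k}"
    then have "j i < m" by (auto dest: off_diagonal_less)
    then show "V (p (Suc (j i))) \<omega> - V (p (j i)) \<omega>
        = increment_sum n q (p (Suc (j i))) ?v - increment_sum n q (p (j i)) ?v"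
      by (simp add: R)
  qed
qed

lemma continuous_step_integral_increments:
  "continuous_on UNIV (step_integral (increment_sum n q) k m p c)"
  unfolding step_integral_def[abs_def] increment_sum_def by (intro continuous_intros continuous_on_product_coordinates)

lemma finite_set_strict_mono_enum:
  fixes P :: "real set"
  assumes "finite P" "P \<noteq> {}"
  obtains n and q :: "nat \<Rightarrow> real" where "strict_mono_on {..n} q" "q ` {..n} = P"
proof -
  define xs where "xs = sorted_list_of_set P"
  have set: "set xs = P" and sorted: "sorted_wrt (<) xs"
    using assms by (auto simp: xs_def)
  have ne: "length xs > 0" using set assms by auto
  define n where "n = length xs - 1"
  have len: "i < length xs \<longleftrightarrow> i \<le> n" for i using ne unfolding n_def by linarith
  show ?thesis
  proof (rule that[of n "(!) xs"])
    show "strict_mono_on {..n} ((!) xs)"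
      using sorted_wrt_nth_less[OF sorted] by (intro strict_mono_onI) (auto simp: len[symmetric])
    show "(!) xs ` {..n} = P"
      unfolding set[symmetric] by (auto simp: in_set_conv_nth len)
  qed
qed

section \<open>Convergence of finite-dimensional distributions\<close>

text \<open>Pointwise |U| <= (U^2 / a + a) / 2, with the weight a matched to the mean-square
  bound.\<close>

lemma (in prob_space) expectation_abs_le_L2:
  assumes [measurable]: "U \<in> borel_measurable M" and a: "a > 0"
    and U: "mean_sq M U \<le> ennreal (a\<^sup>2)"
  shows "integrable M U" "expectation (\<lambda>\<omega>. \<bar>U \<omega>\<bar>) \<le> a"
proof -
  have int2: "integrable M (\<lambda>\<omega>. (U \<omega>)\<^sup>2)"
    using U by (intro integrableI_nonneg) (auto simp: order_le_less_trans[OF _ ennreal_less_top])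
  then show int: "integrable M U" by (rule square_integrable_imp_integrable[rotated]) measurable
  have "ennreal (expectation (\<lambda>\<omega>. (U \<omega>)\<^sup>2)) \<le> ennreal (a\<^sup>2)"
    using U nn_integral_eq_integral[OF int2] by simp
  then have e2: "expectation (\<lambda>\<omega>. (U \<omega>)\<^sup>2) \<le> a\<^sup>2" by (simp add: ennreal_le_iff)
  have "expectation (\<lambda>\<omega>. \<bar>U \<omega>\<bar>) \<le> expectation (\<lambda>\<omega>. ((U \<omega>)\<^sup>2 / a + a) / 2)"
  proof (rule integral_mono)
    fix \<omega>
    have "0 \<le> (\<bar>U \<omega>\<bar> - a)\<^sup>2 / a" using a by simp
    also have "\<dots> = ((U \<omega>)\<^sup>2 + a\<^sup>2 - 2 * \<bar>U \<omega>\<bar> * a) / a"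
      by (simp add: power2_diff)
    also have "\<dots> = (U \<omega>)\<^sup>2 / a + a - 2 * \<bar>U \<omega>\<bar>"
      using a by (simp add: diff_divide_distrib add_divide_distrib power2_eq_square[of a])
    finally show "\<bar>U \<omega>\<bar> \<le> ((U \<omega>)\<^sup>2 / a + a) / 2" by simp
  qed (use int int2 in auto)
  also have "\<dots> = (expectation (\<lambda>\<omega>. (U \<omega>)\<^sup>2) / a + a) / 2"
    using int2 by (simp add: prob_space)
  also have "\<dots> \<le> (a\<^sup>2 / a + a) / 2"
    using e2 a by (intro divide_right_mono add_mono) auto
  also have "\<dots> = a" using a by (simp add: power2_eq_square)
  finally show "expectation (\<lambda>\<omega>. \<bar>U \<omega>\<bar>) \<le> a" .
qed

text \<open>Only the coordinates up to n enter the bound, which is why it gives continuity for the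
  product topology.\<close>

lemma continuous_on_lipschitz_coordinates:
  fixes \<phi> :: "(nat \<Rightarrow> real) \<Rightarrow> real"
  assumes lip: "\<And>u v. \<bar>\<phi> u - \<phi> v\<bar> \<le> L * (\<Sum>i\<le>n. \<bar>u i - v i\<bar>)"
  shows "continuous_on UNIV \<phi>"
  unfolding continuous_on_def
proof
  fix x :: "nat \<Rightarrow> real"
  have "((\<lambda>u. L * (\<Sum>i\<le>n. \<bar>u i - x i\<bar>)) \<longlongrightarrow> L * (\<Sum>i\<le>n. \<bar>x i - x i\<bar>)) (at x)"
  proof -
    have "((\<lambda>u. u i) \<longlongrightarrow> x i) (at x)" for i
      using continuous_on_product_coordinates[of i] by (auto simp: continuous_on_def)
    then show ?thesis by (intro tendsto_intros)
  qed
  then have lim: "((\<lambda>u. L * (\<Sum>i\<le>n. \<bar>u i - x i\<bar>)) \<longlongrightarrow> 0) (at x)" by simp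
  have "((\<lambda>u. \<phi> u - \<phi> x) \<longlongrightarrow> 0) (at x)"
    by (rule Lim_null_comparison[OF _ lim]) (intro always_eventually allI, simp only: real_norm_def lip)
  then show "(\<phi> \<longlongrightarrow> \<phi> x) (at x)" by (simp add: LIM_zero_iff)
qed

lemma (in prob_space) lipschitz_expectation_diff:
  fixes \<phi> :: "(nat \<Rightarrow> real) \<Rightarrow> real"
  assumes lip: "\<And>u v. \<bar>\<phi> u - \<phi> v\<bar> \<le> L * (\<Sum>i\<le>n. \<bar>u i - v i\<bar>)" and L: "L \<ge> 0"
    and B: "\<And>u. \<bar>\<phi> u\<bar> \<le> B" and a: "a > 0"
    and meas: "\<And>i. i \<le> n \<Longrightarrow> X i \<in> borel_measurable M" "\<And>i. i \<le> n \<Longrightarrow> Y i \<in> borel_measurable M"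
    and diff: "\<And>i. i \<le> n \<Longrightarrow> mean_sq M (\<lambda>\<omega>. X i \<omega> - Y i \<omega>) \<le> ennreal (a\<^sup>2)"
  shows "\<bar>expectation (\<lambda>\<omega>. \<phi> (\<lambda>i. if i \<le> n then X i \<omega> else 0)) - expectation (\<lambda>\<omega>. \<phi> (\<lambda>i. if i \<le> n then Y i \<omega> else 0))\<bar>
    \<le> L * (real (Suc n) * a)"
proof -
  have \<phi> [measurable]: "\<phi> \<in> borel_measurable borel"
    by (rule borel_measurable_continuous_onI[OF continuous_on_lipschitz_coordinates[OF lip]])
  have m: "(\<lambda>\<omega>. \<phi> (\<lambda>i. if i \<le> n then X i \<omega> else 0)) \<in> borel_measurable M"
    if "\<And>i. i \<le> n \<Longrightarrow> X i \<in> borel_measurable M" for X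
  proof (rule measurable_compose[OF _ \<phi>], rule measurable_coordinatewise_then_product)
    fix i show "(\<lambda>\<omega>. if i \<le> n then X i \<omega> else 0) \<in> borel_measurable M"
      using that by (cases "i \<le> n") auto
  qed
  let ?X = "\<lambda>\<omega>. \<phi> (\<lambda>i. if i \<le> n then X i \<omega> else 0)" and ?Y = "\<lambda>\<omega>. \<phi> (\<lambda>i. if i \<le> n then Y i \<omega> else 0)"
  have int: "integrable M ?X" "integrable M ?Y"
    by (auto intro!: integrable_const_bound[where B=B] m meas B)
  have D: "integrable M (\<lambda>\<omega>. X i \<omega> - Y i \<omega>)" "expectation (\<lambda>\<omega>. \<bar>X i \<omega> - Y i \<omega>\<bar>) \<le> a" if "i \<le> n" for i
    using expectation_abs_le_L2[OF _ a diff[OF that]] meas that by auto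
  have "\<bar>expectation ?X - expectation ?Y\<bar> = \<bar>expectation (\<lambda>\<omega>. ?X \<omega> - ?Y \<omega>)\<bar>"
    using int by simp
  also have "\<dots> \<le> expectation (\<lambda>\<omega>. \<bar>?X \<omega> - ?Y \<omega>\<bar>)" by (rule integral_abs_bound)
  also have "\<dots> \<le> expectation (\<lambda>\<omega>. L * (\<Sum>i\<le>n. \<bar>X i \<omega> - Y i \<omega>\<bar>))"
  proof (rule integral_mono)
    fix \<omega>
    have "\<bar>?X \<omega> - ?Y \<omega>\<bar> \<le> L * (\<Sum>i\<le>n. \<bar>(if i \<le> n then X i \<omega> else 0) - (if i \<le> n then Y i \<omega> else 0)\<bar>)" by (rule lip)
    then show "\<bar>?X \<omega> - ?Y \<omega>\<bar> \<le> L * (\<Sum>i\<le>n. \<bar>X i \<omega> - Y i \<omega>\<bar>)" by simp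
  qed (use int D(1) in \<open>auto intro!: Bochner_Integration.integrable_sum\<close>)
  also have "\<dots> = L * (\<Sum>i\<le>n. expectation (\<lambda>\<omega>. \<bar>X i \<omega> - Y i \<omega>\<bar>))"
    using D(1) by simp
  also have "\<dots> \<le> L * (\<Sum>i\<le>n. a)"
    using D(2) L by (intro mult_left_mono sum_mono) auto
  finally show ?thesis by simp
qed

text \<open>The triangle inequality through step integrals: x N to y N by the coupling in the noise,
  y N to y' by the limit theorem for block sums, y' to x' by the definition of the Wiener-Ito
  integral. Each step costs r / 4.\<close>

lemma (in iid_noise) finite_dimensional_convergence:
  fixes \<phi> :: "(nat \<Rightarrow> real) \<Rightarrow> real"
  assumes k: "k \<ge> 1" and H: "H = 1 + real k * d - real k / 2" and lam: "lam > 0"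
    and d: "d > 1/2 - 1 / (2 * real k)"
    and M': "prob_space M'" and B: "prob_space.two_sided_brownian_motion M' B"
    and Z: "tempered_hermite_process M' B k H lam {0..1} Z"
    and t: "\<And>i. i \<le> n \<Longrightarrow> t i \<in> {0..1}"
    and lip: "\<And>u v. \<bar>\<phi> u - \<phi> v\<bar> \<le> L * (\<Sum>i\<le>n. \<bar>u i - v i\<bar>)" and L: "L > 0"
    and Bd: "\<And>u. \<bar>\<phi> u\<bar> \<le> Bd"
  shows "(\<lambda>N. expectation (\<lambda>\<omega>. \<phi> (\<lambda>i. if i \<le> n then normalized_sum k H d lam (Suc N) (nat \<lfloor>real (Suc N) * t i\<rfloor>) \<omega> else 0)))
    \<longlonglongrightarrow> (\<integral>\<omega>. \<phi> (\<lambda>i. if i \<le> n then Z (t i) \<omega> else 0) \<partial>M')"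
proof (rule LIMSEQ_I)
  fix r :: real assume r: "r > 0"
  interpret M': prob_space M' by fact
  let ?ker = "\<lambda>i. tempered_hermite_kernel k H lam (t i)"
  have W: "has_wiener_ito_integral M' B k (?ker i) (Z (t i))" if "i \<le> n" for i
    using Z t[OF that] by (auto simp: tempered_hermite_process_def)
  have ker: "?ker i \<in> borel_measurable (lebesgue_pow k)" and Zm: "Z (t i) \<in> borel_measurable M'" if "i \<le> n" for i
    using W[OF that] by (auto simp: has_wiener_ito_integral_def square_integrable_def)
  have Bm [measurable]: "B x \<in> borel_measurable M'" for x
    using B unfolding M'.two_sided_brownian_motion_def by blast
  have kk: "real (k ^ k) > 0" using k by simp
  \<comment> \<open>Chosen so that the Lipschitz estimate L (n + 1) a equals r / 4.\<close>
  define a where "a = r / (4 * L * real (Suc n))"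
  have a: "a > 0" using r L by (simp add: a_def)
  \<comment> \<open>The first bound serves the Brownian side, the second the coupling error 9
    \<delta> k ^ k on the noise side.\<close>
  define \<delta> where "\<delta> = min (a\<^sup>2) (a\<^sup>2 / (9 * real (k ^ k)))"
  have \<delta>: "\<delta> > 0" "\<delta> \<le> a\<^sup>2" "real (k ^ k) * (9 * \<delta>) \<le> a\<^sup>2"
  proof -
    show "\<delta> > 0" using a kk by (simp add: \<delta>_def)
    have "\<delta> \<le> a\<^sup>2 / (9 * real (k ^ k))" by (simp add: \<delta>_def)
    then show "real (k ^ k) * (9 * \<delta>) \<le> a\<^sup>2" using kk by (simp add: field_simps)
  qed (simp add: \<delta>_def)
  define good where "good i m p c \<longleftrightarrow> strict_mono_on {..m} p
      \<and> mean_sq (lebesgue_pow k) (\<lambda>y. step_fun k m p c y - ?ker i y) \<le> ennreal \<delta>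
      \<and> mean_sq M' (\<lambda>\<omega>. step_integral B k m p c \<omega> - Z (t i) \<omega>) \<le> ennreal \<delta>" for i m p c
  have good: "\<exists>m p c. good i m p c" if i: "i \<le> n" for i
  proof -
    obtain m p c where 1: "\<forall>n. strict_mono_on {..m n} (p n)"
      and 2: "L2_tendsto (lebesgue_pow k) (\<lambda>n. step_fun k (m n) (p n) (c n)) (?ker i)"
      and 3: "L2_tendsto M' (\<lambda>n. step_integral B k (m n) (p n) (c n)) (Z (t i))"
      using W[OF i] unfolding has_wiener_ito_integral_def by blast
    have "eventually (\<lambda>n. mean_sq (lebesgue_pow k) (\<lambda>y. step_fun k (m n) (p n) (c n) y - ?ker i y) < ennreal \<delta>) sequentially"
      using 2 \<delta>(1) unfolding L2_tendsto_def by (intro order_tendstoD(2)) auto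
    moreover have "eventually (\<lambda>n. mean_sq M' (\<lambda>\<omega>. step_integral B k (m n) (p n) (c n) \<omega> - Z (t i) \<omega>) < ennreal \<delta>) sequentially"
      using 3 \<delta>(1) unfolding L2_tendsto_def by (intro order_tendstoD(2)) auto
    ultimately have "eventually (\<lambda>n. mean_sq (lebesgue_pow k) (\<lambda>y. step_fun k (m n) (p n) (c n) y - ?ker i y) < ennreal \<delta>
      \<and> mean_sq M' (\<lambda>\<omega>. step_integral B k (m n) (p n) (c n) \<omega> - Z (t i) \<omega>) < ennreal \<delta>) sequentially"
      by (rule eventually_conj)
    then obtain n where "mean_sq (lebesgue_pow k) (\<lambda>y. step_fun k (m n) (p n) (c n) y - ?ker i y) < ennreal \<delta>"
      "mean_sq M' (\<lambda>\<omega>. step_integral B k (m n) (p n) (c n) \<omega> - Z (t i) \<omega>) < ennreal \<delta>"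
      using eventually_happens'[OF sequentially_bot] by blast
    then show ?thesis unfolding good_def using 1 by (intro exI[of _ "m n"] exI[of _ "p n"] exI[of _ "c n"]) (auto intro: less_imp_le)
  qed
  obtain m p c where "\<And>i. i \<le> n \<Longrightarrow> good i (m i) (p i) (c i)"
    using good by metis
  then have p: "\<And>i. i \<le> n \<Longrightarrow> strict_mono_on {..m i} (p i)"
    and sf: "\<And>i. i \<le> n \<Longrightarrow> mean_sq (lebesgue_pow k) (\<lambda>y. step_fun k (m i) (p i) (c i) y - ?ker i y) \<le> ennreal \<delta>"
    and si: "\<And>i. i \<le> n \<Longrightarrow> mean_sq M' (\<lambda>\<omega>. step_integral B k (m i) (p i) (c i) \<omega> - Z (t i) \<omega>) \<le> ennreal \<delta>"
    unfolding good_def by blast+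
  \<comment> \<open>A common refinement of the grids of all n + 1 step functions, so that one
    increment vector drives them jointly.\<close>
  define P where "P = (\<Union>i\<le>n. p i ` {..m i})"
  have P: "finite P" "P \<noteq> {}" by (auto simp: P_def)
  obtain n' and q :: "nat \<Rightarrow> real" where q: "strict_mono_on {..n'} q" "q ` {..n'} = P"
    by (rule finite_set_strict_mono_enum[OF P])
  have pq: "p i l \<in> q ` {..n'}" if "i \<le> n" "l \<le> m i" for i l using that by (auto simp: q(2) P_def)
  have x0: "q 0 \<le> p i 0" if "i \<le> n" for i
  proof -
    obtain j where "j \<le> n'" "p i 0 = q j" using pq[OF \<open>i \<le> n\<close>, of 0] by auto
    then show ?thesis using strict_mono_on_leD[OF q(1), of 0 j] by auto
  qed
  define \<Psi> where "\<Psi> v = \<phi> (\<lambda>i. if i \<le> n then step_integral (increment_sum n' q) k (m i) (p i) (c i) v else 0)" for v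
  have \<Psi>: "continuous_on UNIV \<Psi>"
    unfolding \<Psi>_def
  proof (rule continuous_on_compose2[OF continuous_on_lipschitz_coordinates[OF lip]])
    show "continuous_on UNIV (\<lambda>v i. if i \<le> n then step_integral (increment_sum n' q) k (m i) (p i) (c i) v else 0)"
    proof (rule continuous_on_coordinatewise_then_product)
      fix i show "continuous_on UNIV (\<lambda>v. if i \<le> n then step_integral (increment_sum n' q) k (m i) (p i) (c i) v else 0)"
        using continuous_step_integral_increments by (cases "i \<le> n") auto
    qed
  qed auto
  define Q where "Q N i = step_integral (block_sum (Suc N) (q 0)) k (m i) (p i) (c i)" for N i
  define J where "J i = step_integral B k (m i) (p i) (c i)" for i
  have Qm: "Q N i \<in> borel_measurable M" for N i unfolding Q_def step_integral_def by measurable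
  have Jm: "J i \<in> borel_measurable M'" for i unfolding J_def step_integral_def by measurable
  define x where "x N = expectation (\<lambda>\<omega>. \<phi> (\<lambda>i. if i \<le> n then normalized_sum k H d lam (Suc N) (nat \<lfloor>real (Suc N) * t i\<rfloor>) \<omega> else 0))" for N
  define y where "y N = expectation (\<lambda>\<omega>. \<phi> (\<lambda>i. if i \<le> n then Q N i \<omega> else 0))" for N
  define y' where "y' = (\<integral>\<omega>. \<phi> (\<lambda>i. if i \<le> n then J i \<omega> else 0) \<partial>M')"
  define x' where "x' = (\<integral>\<omega>. \<phi> (\<lambda>i. if i \<le> n then Z (t i) \<omega> else 0) \<partial>M')"
  have La: "L * (real (Suc n) * a) = r / 4" using L by (simp add: a_def field_simps del: of_nat_Suc)
  have xy: "eventually (\<lambda>N. \<bar>x N - y N\<bar> \<le> r / 4) sequentially"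
  proof -
    have "eventually (\<lambda>N. \<forall>i\<in>{..n}. mean_sq M (\<lambda>\<omega>. normalized_sum k H d lam (Suc N) (nat \<lfloor>real (Suc N) * t i\<rfloor>) \<omega> - Q N i \<omega>) \<le> ennreal (a\<^sup>2)) sequentially"
    proof (intro eventually_ball_finite ballI)
      fix i assume "i \<in> {..n}"
      then have i: "i \<le> n" by simp
      show "eventually (\<lambda>N. mean_sq M (\<lambda>\<omega>. normalized_sum k H d lam (Suc N) (nat \<lfloor>real (Suc N) * t i\<rfloor>) \<omega> - Q N i \<omega>) \<le> ennreal (a\<^sup>2)) sequentially"
        using eventually_coupling_error[OF k H lam d t[OF i] p[OF i] x0[OF i] ker[OF i] \<delta>(1) sf[OF i]]
        unfolding Q_def by eventually_elim (rule order_trans, assumption, rule ennreal_leI, rule \<delta>(3))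
    qed auto
    then show ?thesis
    proof eventually_elim
      fix N assume *: "\<forall>i\<in>{..n}. mean_sq M (\<lambda>\<omega>. normalized_sum k H d lam (Suc N) (nat \<lfloor>real (Suc N) * t i\<rfloor>) \<omega> - Q N i \<omega>) \<le> ennreal (a\<^sup>2)"
      show "\<bar>x N - y N\<bar> \<le> r / 4"
        unfolding x_def y_def La[symmetric] using * L a
        by (intro lipschitz_expectation_diff[OF lip _ Bd]) (auto intro: Qm)
    qed
  qed
  have "\<bar>y' - x'\<bar> \<le> r / 4"
    unfolding x'_def y'_def La[symmetric]
  proof (rule M'.lipschitz_expectation_diff[OF lip _ Bd a])
    fix i assume i: "i \<le> n"
    show "mean_sq M' (\<lambda>\<omega>. J i \<omega> - Z (t i) \<omega>) \<le> ennreal (a\<^sup>2)"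
      unfolding J_def using si[OF i] by (rule order_trans) (intro ennreal_leI \<delta>(2))
  qed (use L Jm Zm in auto)
  moreover have "y \<longlonglongrightarrow> y'"
  proof -
    have y: "y N = expectation (\<lambda>\<omega>. \<Psi> (\<lambda>l. if l < n' then block_sum (Suc N) (q l) (q (Suc l)) \<omega> else 0))" for N
    proof -
      have bs: "(\<lambda>l. if l < n' then block_sum (Suc N) (q l) (q (Suc l)) \<omega> else 0)
          = (\<lambda>l. if l < n' then block_sum (Suc N) (q 0) (q (Suc l)) \<omega> - block_sum (Suc N) (q 0) (q l) \<omega> else 0)" for \<omega>
      proof (intro ext if_cong refl)
        fix l assume l: "l < n'"
        show "block_sum (Suc N) (q l) (q (Suc l)) \<omega> = block_sum (Suc N) (q 0) (q (Suc l)) \<omega> - block_sum (Suc N) (q 0) (q l) \<omega>"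
          using l strict_mono_on_leD[OF q(1), of 0 l] strict_mono_on_leD[OF q(1), of l "Suc l"]
          by (intro block_sum_diff[symmetric]) auto
      qed
      show ?thesis
        unfolding y_def \<Psi>_def bs Q_def
        by (intro Bochner_Integration.integral_cong refl arg_cong[where f=\<phi>] ext if_cong
            step_integral_eq_increments[OF q(1) pq])
    qed
    have y': "y' = (\<integral>\<omega>. \<Psi> (\<lambda>l. if l < n' then B (q (Suc l)) \<omega> - B (q l) \<omega> else 0) \<partial>M')"
      unfolding y'_def \<Psi>_def J_def
      by (intro Bochner_Integration.integral_cong refl arg_cong[where f=\<phi>] ext if_cong
          step_integral_eq_increments[OF q(1) pq])
    show ?thesis unfolding y[abs_def] y'
      by (rule block_sums_tendsto[OF M' B q(1) \<Psi>, where C=Bd]) (simp add: \<Psi>_def Bd)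
  qed
  then have "eventually (\<lambda>N. \<bar>y N - y'\<bar> < r / 4) sequentially"
    using r tendstoD[of y y' sequentially "r / 4"] by (simp add: dist_real_def)
  with xy have "eventually (\<lambda>N. norm (x N - x') < r) sequentially"
  proof eventually_elim
    fix N assume "\<bar>x N - y N\<bar> \<le> r / 4" "\<bar>y N - y'\<bar> < r / 4"
    then show "norm (x N - x') < r" using \<open>\<bar>y' - x'\<bar> \<le> r / 4\<close> r unfolding real_norm_def by linarith
  qed
  then show "\<exists>no. \<forall>N\<ge>no. norm (expectation (\<lambda>\<omega>. \<phi> (\<lambda>i. if i \<le> n then normalized_sum k H d lam (Suc N) (nat \<lfloor>real (Suc N) * t i\<rfloor>) \<omega> else 0))
      - (\<integral>\<omega>. \<phi> (\<lambda>i. if i \<le> n then Z (t i) \<omega> else 0) \<partial>M')) < r"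
    by (simp add: x_def x'_def eventually_sequentially)
qed

section \<open>Step paths\<close>

text \<open>Both the partial-sum path (m = N) and its coarse skeleton have this form; at t = 1 the
  value is v m, so the coordinates 0 to m determine the path.\<close>

definition step_path :: "nat \<Rightarrow> (nat \<Rightarrow> real) \<Rightarrow> real \<Rightarrow> real" where
  "step_path m v = (\<lambda>t\<in>{0..1}. v (nat \<lfloor>real m * t\<rfloor>))"

lemma nat_floor_le: "t \<in> {0..1} \<Longrightarrow> nat \<lfloor>real m * t\<rfloor> \<le> m"
proof -
  assume t: "t \<in> {0..1}"
  have "real m * t \<le> real m * 1" using t by (intro mult_left_mono) auto
  then have "\<lfloor>real m * t\<rfloor> \<le> int m" by (simp add: floor_le_iff)
  then show ?thesis by simp
qed

lemma step_path_cadlag: "step_path m v \<in> cadlag01"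
proof (cases "m = 0")
  case True
  have "((\<lambda>t\<in>{0..1}. v 0) \<longlongrightarrow> v 0) (at_right t)" if "t \<in> {0..<1}" for t :: real
  proof (rule tendsto_eventually)
    show "eventually (\<lambda>s. (\<lambda>t\<in>{0..1}. v 0) s = v 0) (at_right t)"
      unfolding eventually_at_right_field using that by (intro exI[of _ 1]) auto
  qed
  moreover have "\<exists>l. ((\<lambda>t\<in>{0..1}. v 0) \<longlongrightarrow> l) (at_left t)" if "t \<in> {0<..1}" for t :: real
  proof (intro exI tendsto_eventually)
    show "eventually (\<lambda>s. (\<lambda>t\<in>{0..1}. v 0) s = v 0) (at_left t)"
      unfolding eventually_at_left_field using that by (intro exI[of _ 0]) auto
  qed
  ultimately show ?thesis using True by (auto simp: cadlag01_def step_path_def)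
next
  case False
  then have m: "real m > 0" by simp
  have "(step_path m v \<longlongrightarrow> step_path m v t) (at_right t)" if t: "t \<in> {0..<1}" for t
  proof (rule tendsto_eventually)
    define b where "b = min 1 ((of_int \<lfloor>real m * t\<rfloor> + 1) / real m)"
    have "real m * t < of_int \<lfloor>real m * t\<rfloor> + 1" by linarith
    then have "t < b" using t m by (simp add: b_def pos_less_divide_eq mult.commute)
    moreover have "step_path m v s = step_path m v t" if s: "t < s" "s < b" for s
    proof -
      have "real m * s < of_int \<lfloor>real m * t\<rfloor> + 1"
        using s m by (simp add: b_def pos_less_divide_eq mult.commute)
      moreover have "of_int \<lfloor>real m * t\<rfloor> \<le> real m * s"
        using s m by (intro order_trans[OF of_int_floor_le]) auto
      ultimately have "\<lfloor>real m * s\<rfloor> = \<lfloor>real m * t\<rfloor>" by (simp add: floor_eq_iff)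
      then show ?thesis using s t by (simp add: step_path_def b_def)
    qed
    ultimately show "eventually (\<lambda>s. step_path m v s = step_path m v t) (at_right t)"
      unfolding eventually_at_right_field by blast
  qed
  moreover have "\<exists>l. (step_path m v \<longlongrightarrow> l) (at_left t)" if t: "t \<in> {0<..1}" for t
  proof (intro exI tendsto_eventually)
    define b where "b = max 0 ((of_int \<lceil>real m * t\<rceil> - 1) / real m)"
    have "of_int \<lceil>real m * t\<rceil> - 1 < real m * t" by linarith
    then have "b < t" using t m by (simp add: b_def pos_divide_less_eq mult.commute)
    moreover have "step_path m v s = v (nat (\<lceil>real m * t\<rceil> - 1))" if s: "b < s" "s < t" for s
    proof -
      have "of_int (\<lceil>real m * t\<rceil> - 1) \<le> real m * s"
        using s m by (simp add: b_def pos_divide_less_eq mult.commute)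
      moreover have "real m * s < real m * t" using s m by simp
      then have "real m * s < of_int (\<lceil>real m * t\<rceil> - 1) + 1" by (simp add: less_le_trans[OF _ le_of_int_ceiling])
      ultimately have "\<lfloor>real m * s\<rfloor> = \<lceil>real m * t\<rceil> - 1" by (intro floor_unique) auto
      then show ?thesis using s t by (simp add: step_path_def b_def)
    qed
    ultimately show "eventually (\<lambda>s. step_path m v s = v (nat (\<lceil>real m * t\<rceil> - 1))) (at_left t)"
      unfolding eventually_at_left_field by blast
  qed
  ultimately show ?thesis by (auto simp: cadlag01_def step_path_def)
qed

lemma unif_dist01_le:
  assumes "x \<in> cadlag01" "y \<in> cadlag01" "\<And>t. t \<in> {0..1} \<Longrightarrow> \<bar>x t - y t\<bar> \<le> D"
  shows "unif_dist01 x y \<le> D"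
  using assms unfolding unif_dist01_def by (auto intro!: cSUP_least)

lemma unif_dist_step_path:
  "unif_dist01 (step_path m u) (step_path m v) \<le> (\<Sum>i\<le>m. \<bar>u i - v i\<bar>)"
proof (rule unif_dist01_le)
  fix t :: real assume t: "t \<in> {0..1}"
  have "\<bar>u (nat \<lfloor>real m * t\<rfloor>) - v (nat \<lfloor>real m * t\<rfloor>)\<bar> \<le> (\<Sum>i\<le>m. \<bar>u i - v i\<bar>)"
    using nat_floor_le[OF t, of m] by (intro member_le_sum[of _ "{..m}" "\<lambda>i. \<bar>u i - v i\<bar>"]) auto
  then show "\<bar>step_path m u t - step_path m v t\<bar> \<le> (\<Sum>i\<le>m. \<bar>u i - v i\<bar>)"
    using t by (simp add: step_path_def)
qed (auto intro: step_path_cadlag)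

lemma step_path_cong: "(\<And>i. i \<le> m \<Longrightarrow> u i = v i) \<Longrightarrow> step_path m u = step_path m v"
  using nat_floor_le by (auto simp: step_path_def fun_eq_iff restrict_def)

text \<open>With the jump times fixed, the uniform distance is controlled by finitely many
  coordinates, so preimages of open sets of paths are open in the product space of coordinate
  sequences. This settles Borel measurability although the path space is not separable.\<close>

lemma step_path_measurable:
  assumes V: "\<And>i. V i \<in> borel_measurable M"
  shows "(\<lambda>\<omega>. step_path m (\<lambda>i. V i \<omega>)) \<in> M \<rightarrow>\<^sub>M borel_of_topology skorokhod01"
proof (rule measurable_borel_of_topologyI)
  interpret Metric_space cadlag01 unif_dist01 by (rule Metric_space_cadlag01)
  fix U assume U: "openin skorokhod01 U"
  have "open {v. step_path m v \<in> U}"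
  proof (subst open_subopen, intro ballI)
    fix v assume v: "v \<in> {v. step_path m v \<in> U}"
    then obtain r where r: "r > 0" "mball (step_path m v) r \<subseteq> U"
      using U unfolding skorokhod01_def openin_mtopology by blast
    let ?W = "{w :: nat \<Rightarrow> real. (\<Sum>i\<le>m. \<bar>v i - w i\<bar>) < r}"
    have "open ?W"
      by (intro open_Collect_less continuous_intros continuous_on_product_coordinates)
    moreover have "v \<in> ?W" using r by simp
    moreover have "?W \<subseteq> {v. step_path m v \<in> U}"
    proof
      fix w assume "w \<in> ?W"
      then have "unif_dist01 (step_path m v) (step_path m w) < r"
        using unif_dist_step_path[of m v w] by simp
      then show "w \<in> {v. step_path m v \<in> U}" using r(2) step_path_cadlag by (auto simp: in_mball)
    qed
    ultimately show "\<exists>T. open T \<and> v \<in> T \<and> T \<subseteq> {v. step_path m v \<in> U}" by blast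
  qed
  moreover have "(\<lambda>\<omega> i. V i \<omega>) \<in> borel_measurable M"
    by (rule measurable_coordinatewise_then_product) (rule V)
  ultimately have "(\<lambda>\<omega> i. V i \<omega>) -` {v. step_path m v \<in> U} \<inter> space M \<in> sets M"
    by (intro measurable_sets[of _ M borel]) auto
  then show "(\<lambda>\<omega>. step_path m (\<lambda>i. V i \<omega>)) -` U \<inter> space M \<in> sets M"
    by (simp add: vimage_def)
qed (simp add: topspace_skorokhod01 step_path_cadlag)

lemma continuous_path_cadlag:
  assumes "continuous_on {0..1} z"
  shows "(\<lambda>t\<in>{0..1}. z t) \<in> cadlag01"
proof -
  have lim: "((\<lambda>t\<in>{0..1}. z t) \<longlongrightarrow> z t) (at t within {0..1})" if "t \<in> {0..1}" for t
  proof -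
    have "(z \<longlongrightarrow> z t) (at t within {0..1})" using assms that by (auto simp: continuous_on_def)
    moreover have "eventually (\<lambda>s. z s = (\<lambda>t\<in>{0..1}. z t) s) (at t within {0..1})"
      by (auto simp: eventually_at_filter)
    ultimately show ?thesis by (rule Lim_transform_eventually)
  qed
  have "((\<lambda>t\<in>{0..1}. z t) \<longlongrightarrow> z t) (at_right t)" if t: "t \<in> {0..<1}" for t
  proof -
    have "at t within {t<..<1} = at_right t" using t by (intro at_within_nhd[of t "{..<1}"]) auto
    moreover have "t \<in> {0..1}" "{t<..<1} \<subseteq> {0..1}" using t by auto
    ultimately show ?thesis using tendsto_within_subset[OF lim] by metis
  qed
  moreover have "\<exists>l. ((\<lambda>t\<in>{0..1}. z t) \<longlongrightarrow> l) (at_left t)" if t: "t \<in> {0<..1}" for t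
  proof -
    have "at t within {0<..<t} = at_left t" using t by (intro at_within_nhd[of t "{0<..}"]) auto
    moreover have "t \<in> {0..1}" "{0<..<t} \<subseteq> {0..1}" using t by auto
    ultimately show ?thesis using tendsto_within_subset[OF lim] by metis
  qed
  ultimately show ?thesis by (auto simp: cadlag01_def)
qed

lemma step_path_tendsto_continuous:
  assumes z: "continuous_on {0..1} z"
  shows "(\<lambda>m. unif_dist01 (step_path (Suc m) (\<lambda>i. z (real i / real (Suc m)))) (\<lambda>t\<in>{0..1}. z t)) \<longlonglongrightarrow> 0"
proof (rule LIMSEQ_I)
  fix r :: real assume r: "r > 0"
  have "uniformly_continuous_on {0..1} z" using z by (intro compact_uniformly_continuous) auto
  then obtain \<delta> where \<delta>: "\<delta> > 0" "\<And>s t. s \<in> {0..1} \<Longrightarrow> t \<in> {0..1} \<Longrightarrow> dist s t < \<delta> \<Longrightarrow> dist (z s) (z t) < r / 2"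
    using r unfolding uniformly_continuous_on_def by (metis half_gt_zero)
  obtain m0 where m0: "1 / real (Suc m0) < \<delta>" using \<delta>(1) reals_Archimedean by (metis inverse_eq_divide)
  have "norm (unif_dist01 (step_path (Suc m) (\<lambda>i. z (real i / real (Suc m)))) (\<lambda>t\<in>{0..1}. z t) - 0) < r" if m: "m \<ge> m0" for m
  proof -
    interpret Metric_space cadlag01 unif_dist01 by (rule Metric_space_cadlag01)
    have "unif_dist01 (step_path (Suc m) (\<lambda>i. z (real i / real (Suc m)))) (\<lambda>t\<in>{0..1}. z t) \<le> r / 2"
    proof (rule unif_dist01_le[OF step_path_cadlag continuous_path_cadlag[OF z]])
      fix t :: real assume t: "t \<in> {0..1}"
      let ?n = "nat \<lfloor>real (Suc m) * t\<rfloor>"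
      have fl: "0 \<le> \<lfloor>real (Suc m) * t\<rfloor>" using t by simp
      have n: "real ?n \<le> real (Suc m) * t" "real (Suc m) * t < real ?n + 1"
        using fl by (simp_all only: of_nat_nat) linarith+
      have 1: "real ?n / real (Suc m) \<le> t" using n(1) by (simp add: divide_simps mult.commute del: of_nat_Suc)
      have 2: "t < real ?n / real (Suc m) + 1 / real (Suc m)"
        using n(2) by (simp add: pos_less_divide_eq mult.commute del: of_nat_Suc flip: add_divide_distrib)
      have "1 / real (Suc m) \<le> 1 / real (Suc m0)" using m by (simp add: frac_le)
      then have "dist (real ?n / real (Suc m)) t < \<delta>" using 1 2 m0 by (simp add: dist_real_def del: of_nat_Suc)
      moreover have "real ?n / real (Suc m) \<in> {0..1}"
      proof -
        have "real ?n \<le> real (Suc m)" using nat_floor_le[OF t, of "Suc m"] by (simp only: of_nat_le_iff)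
        then show ?thesis by (simp only: atLeastAtMost_iff) (simp add: divide_le_eq_1)
      qed
      ultimately have "dist (z (real ?n / real (Suc m))) (z t) < r / 2" using t by (intro \<delta>(2)) auto
      then show "\<bar>step_path (Suc m) (\<lambda>i. z (real i / real (Suc m))) t - (\<lambda>t\<in>{0..1}. z t) t\<bar> \<le> r / 2"
        using t by (simp add: step_path_def dist_real_def del: of_nat_Suc)
    qed
    then show ?thesis using r by (simp del: of_nat_Suc)
  qed
  then show "\<exists>no. \<forall>m\<ge>no. norm (unif_dist01 (step_path (Suc m) (\<lambda>i. z (real i / real (Suc m)))) (\<lambda>t\<in>{0..1}. z t) - 0) < r"
    by blast
qed

section \<open>Convergence of the partial sum process\<close>

text \<open>On each of the m coarse cells the maximal inequality bounds the oscillation in L2 by a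
  multiple of m^(-\<gamma>); summing m squares gives m^(1/2 - \<gamma>), which tends to 0. K and
  \<gamma> depend on neither m nor N.\<close>

lemma (in iid_noise) discretization_error:
  assumes k: "k \<ge> 1" and H: "H = 1 + real k * d - real k / 2" and lam: "lam > 0"
    and d: "d > 1/2 - 1 / (2 * real k)"
  shows "\<exists>K>0. \<exists>\<gamma>>1/2. \<forall>m\<ge>1. \<forall>N\<ge>m. \<exists>D\<in>borel_measurable M.
    (\<forall>\<omega>. unif_dist01 (step_path N (\<lambda>n. normalized_sum k H d lam N n \<omega>))
       (step_path m (\<lambda>i. normalized_sum k H d lam N (nat \<lfloor>real N * (real i / real m)\<rfloor>) \<omega>)) \<le> D \<omega>) \<and>
    mean_sq M D \<le> ennreal ((K * real m powr (1/2 - \<gamma>))\<^sup>2)"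
proof -
  have "1/2 - 1 / (2 * real k) < min d (1/2)" using d k by auto
  then obtain e where e: "1/2 - 1 / (2 * real k) < e" "e < 1/2" "e \<le> d"
    using dense by (metis less_imp_le min_less_iff_conj)
  obtain C where C: "C > 0" "\<And>x. tempered_power d lam x \<le> C * tempered_power e 0 x"
    using tempered_power_le[OF e(3) lam] by blast
  define \<beta> where "\<beta> = real k * (1 - 2 * e)"
  have "1 - 2 * e < 1 / real k" using e by (simp add: field_simps)
  then have \<beta>: "\<beta> < 1" using k by (simp add: \<beta>_def field_simps)
  \<comment> \<open>The mean-square increment bound has exponent 2 \<gamma>, and \<beta> < 1 becomes
    \<gamma> > 1/2.\<close>
  define \<gamma> where "\<gamma> = (2 - \<beta>) / 2"
  have \<gamma>: "\<gamma> > 1/2" using \<beta> by (simp add: \<gamma>_def)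
  \<comment> \<open>\<open>max 0\<close> and the summand 1 guarantee a positive A whose square
    dominates the increment constant.\<close>
  define A where "A = sqrt (max 0 (real (k ^ k) * ((C * 2 powr (1 - e)) ^ k)\<^sup>2
        * (2 * corr_const e ^ k / (1 - real k * (1 - 2 * e))))) + 1"
  have A: "A > 0" by (simp add: A_def add_nonneg_pos)
  have A2: "real (k ^ k) * ((C * 2 powr (1 - e)) ^ k)\<^sup>2
        * (2 * corr_const e ^ k / (1 - real k * (1 - 2 * e))) \<le> A\<^sup>2" (is "?c \<le> _")
  proof -
    have "?c \<le> (sqrt (max 0 ?c))\<^sup>2" by simp
    also have "\<dots> \<le> A\<^sup>2" unfolding A_def by (intro power_mono) auto
    finally show ?thesis .
  qed
  have incr: "mean_sq M (\<lambda>\<omega>. normalized_sum k H d lam N n \<omega> - normalized_sum k H d lam N m \<omega>)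
      \<le> ennreal ((A / real N powr \<gamma> * real (n - m) powr \<gamma>)\<^sup>2)" if "N > 0" "m \<le> n" for N m n
  proof -
    have "(real (n - m) / real N) powr (2 - real k * (1 - 2 * e)) = ((real (n - m) / real N) powr \<gamma>)\<^sup>2"
      by (simp add: power2_eq_square \<gamma>_def \<beta>_def flip: powr_add)
    then have "mean_sq M (\<lambda>\<omega>. normalized_sum k H d lam N n \<omega> - normalized_sum k H d lam N m \<omega>)
      \<le> ennreal (?c * ((real (n - m) / real N) powr \<gamma>)\<^sup>2)"
      using normalized_sum_increment[OF k H lam that(1) e(1,2) C that(2)] by simp
    also have "\<dots> \<le> ennreal (A\<^sup>2 * ((real (n - m) / real N) powr \<gamma>)\<^sup>2)"
      by (intro ennreal_leI mult_right_mono A2) auto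
    also have "A\<^sup>2 * ((real (n - m) / real N) powr \<gamma>)\<^sup>2 = (A / real N powr \<gamma> * real (n - m) powr \<gamma>)\<^sup>2"
      by (simp add: powr_divide power_mult_distrib power_divide)
    finally show ?thesis .
  qed
  define K where "K = A * maximal_const \<gamma> * 2 powr \<gamma>"
  have mc: "maximal_const \<gamma> > 0"
  proof -
    have "sqrt 2 < 2 powr \<gamma>" using \<gamma> by (simp add: powr_half_sqrt[symmetric])
    then have "1 / (2 powr \<gamma> - sqrt 2) > 0" by simp
    then show ?thesis unfolding maximal_const_def by (intro mult_pos_pos add_pos_pos) simp_all
  qed
  have K: "K > 0" using A mc by (simp add: K_def)
  have main: "\<exists>D\<in>borel_measurable M.
    (\<forall>\<omega>. unif_dist01 (step_path N (\<lambda>n. normalized_sum k H d lam N n \<omega>))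
       (step_path m (\<lambda>i. normalized_sum k H d lam N (nat \<lfloor>real N * (real i / real m)\<rfloor>) \<omega>)) \<le> D \<omega>) \<and>
    mean_sq M D \<le> ennreal ((K * real m powr (1/2 - \<gamma>))\<^sup>2)"
    if m: "m \<ge> 1" and Nm: "N \<ge> m" for m N
  proof -
    have N: "N > 0" using m Nm by simp
    define S where "S n \<omega> = normalized_sum k H d lam N n \<omega>" for n \<omega>
    define u where "u i = nat \<lfloor>real N * (real i / real m)\<rfloor>" for i
    have u_real: "real (u i) \<le> real N * (real i / real m)" "real N * (real i / real m) < real (u i) + 1" for i
    proof -
      have "0 \<le> \<lfloor>real N * (real i / real m)\<rfloor>" by simp
      then have "real (u i) = of_int \<lfloor>real N * (real i / real m)\<rfloor>" by (simp add: u_def)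
      then show "real (u i) \<le> real N * (real i / real m)" "real N * (real i / real m) < real (u i) + 1" by linarith+
    qed
    have u_mono: "u i \<le> u (Suc i)" for i
      unfolding u_def by (intro nat_mono floor_mono mult_left_mono divide_right_mono) auto
    \<comment> \<open>Rounding adds at most one step, and 1 <= N / m because N >= m; the resulting
      factor 2 is the source of 2^\<gamma> in K.\<close>
    have gap: "real (u (Suc i) - u i) \<le> 2 * real N / real m" for i
    proof -
      have "real (u (Suc i) - u i) \<le> real N * (real (Suc i) / real m) - real N * (real i / real m) + 1"
        using u_real[of i] u_real[of "Suc i"] u_mono[of i] by (simp only: of_nat_diff)
      also have "\<dots> = real N / real m + 1" by (simp add: distrib_left add_divide_distrib)
      also have "1 \<le> real N / real m" using m Nm by simp
      finally show ?thesis by simp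
    qed
    have "\<exists>U\<in>borel_measurable M. (\<forall>n\<in>{u i..u (Suc i)}. \<forall>\<omega>. \<bar>S n \<omega> - S (u i) \<omega>\<bar> \<le> U \<omega>) \<and>
      mean_sq M U
        \<le> ennreal ((A / real N powr \<gamma> * maximal_const \<gamma> * real (u (Suc i) - u i) powr \<gamma>)\<^sup>2)" for i
    proof (rule maximal_inequality[OF \<gamma> _ _ _ u_mono])
      show "A / real N powr \<gamma> > 0" using A N by simp
      show "S n \<in> borel_measurable M" for n unfolding S_def by measurable
      show "mean_sq M (\<lambda>\<omega>. S n \<omega> - S m \<omega>) \<le> ennreal ((A / real N powr \<gamma> * real (n - m) powr \<gamma>)\<^sup>2)"
        if "m \<le> n" for m n unfolding S_def by (rule incr[OF N that])
    qed
    then obtain U where Um [measurable]: "\<And>i. U i \<in> borel_measurable M"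
      and U: "\<And>i n \<omega>. n \<in> {u i..u (Suc i)} \<Longrightarrow> \<bar>S n \<omega> - S (u i) \<omega>\<bar> \<le> U i \<omega>"
      and IU: "\<And>i. mean_sq M (U i)
        \<le> ennreal ((A / real N powr \<gamma> * maximal_const \<gamma> * real (u (Suc i) - u i) powr \<gamma>)\<^sup>2)"
      by metis
    \<comment> \<open>The l2 norm over the cells replaces the maximum of the U i, since second
      moments are what is controlled.\<close>
    define D where "D \<omega> = sqrt (\<Sum>i<m. (U i \<omega>)\<^sup>2)" for \<omega>
    have UD: "U i \<omega> \<le> D \<omega>" if "i < m" for i \<omega>
      unfolding D_def by (rule real_le_rsqrt)
        (use that in \<open>auto intro!: member_le_sum[of i "{..<m}" "\<lambda>i. (U i \<omega>)\<^sup>2"]\<close>)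
    have D0: "D \<omega> \<ge> 0" for \<omega> unfolding D_def by (auto intro: sum_nonneg)
    have [measurable]: "D \<in> borel_measurable M" unfolding D_def by measurable
    have dist: "unif_dist01 (step_path N (\<lambda>n. S n \<omega>)) (step_path m (\<lambda>i. S (u i) \<omega>)) \<le> D \<omega>" for \<omega>
    proof (rule unif_dist01_le[OF step_path_cadlag step_path_cadlag])
      fix t :: real assume t: "t \<in> {0..1}"
      let ?i = "nat \<lfloor>real m * t\<rfloor>" and ?n = "nat \<lfloor>real N * t\<rfloor>"
      have fl: "0 \<le> \<lfloor>real m * t\<rfloor>" using t by simp
      have i: "real ?i \<le> real m * t" "real m * t < real ?i + 1"
        using fl by (simp_all only: of_nat_nat) linarith+
      have "\<bar>S ?n \<omega> - S (u ?i) \<omega>\<bar> \<le> D \<omega>"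
      proof (cases "?i < m")
        case True
        have "real m * t \<le> real (Suc ?i)" using i(2) by (simp only: of_nat_Suc add.commute less_imp_le)
        then have "real ?i / real m \<le> t" "t \<le> real (Suc ?i) / real m"
          using i(1) m by (simp_all only: pos_divide_le_eq pos_le_divide_eq of_nat_0_less_iff less_eq_Suc_le One_nat_def mult.commute)
        then have "?n \<in> {u ?i..u (Suc ?i)}"
          unfolding u_def atLeastAtMost_iff
          by (intro conjI nat_mono floor_mono mult_left_mono of_nat_0_le_iff)
        from U[OF this, of \<omega>] UD[OF True, of \<omega>] show ?thesis by linarith
      next
        \<comment> \<open>Only t = 1 falls outside the m cells, and there both paths have the same
          value.\<close>
        case False
        then have im: "?i = m" using nat_floor_le[OF t, of m] by simp
        have "real m \<le> real m * t" using i(1) unfolding im .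
        then have "t = 1" using t m by simp
        then show ?thesis using D0 im m by (simp add: u_def)
      qed
      then show "\<bar>step_path N (\<lambda>n. S n \<omega>) t - step_path m (\<lambda>i. S (u i) \<omega>) t\<bar> \<le> D \<omega>"
        using t by (simp add: step_path_def)
    qed
    have "mean_sq M D = (\<Sum>i<m. \<integral>\<^sup>+\<omega>. ennreal ((U i \<omega>)\<^sup>2) \<partial>M)"
      by (subst nn_integral_sum[symmetric]) (auto simp: D_def sum_nonneg)
    also have "\<dots> \<le> (\<Sum>i<m. ennreal ((K / real m powr \<gamma>)\<^sup>2))"
    proof (rule sum_mono)
      fix i
      have "A / real N powr \<gamma> * maximal_const \<gamma> * real (u (Suc i) - u i) powr \<gamma>
          \<le> A / real N powr \<gamma> * maximal_const \<gamma> * (2 * real N / real m) powr \<gamma>"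
        using gap[of i] A mc \<gamma> by (intro mult_left_mono powr_mono2) auto
      also have "\<dots> = K / real m powr \<gamma>"
        using N m by (simp add: K_def powr_divide powr_mult)
      finally have "(A / real N powr \<gamma> * maximal_const \<gamma> * real (u (Suc i) - u i) powr \<gamma>)\<^sup>2 \<le> (K / real m powr \<gamma>)\<^sup>2"
        using A mc by (intro power_mono) auto
      then show "mean_sq M (U i) \<le> ennreal ((K / real m powr \<gamma>)\<^sup>2)"
        by (rule order_trans[OF IU ennreal_leI])
    qed
    also have "\<dots> = ennreal (real m * (K / real m powr \<gamma>)\<^sup>2)"
      by (simp add: ennreal_of_nat_eq_real_of_nat flip: ennreal_mult)
    also have "real m * (K / real m powr \<gamma>)\<^sup>2 = (K * real m powr (1/2 - \<gamma>))\<^sup>2"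
    proof -
      have "real m * (K / real m powr \<gamma>)\<^sup>2 = (real m powr (1/2) * (K / real m powr \<gamma>))\<^sup>2"
        by (simp only: power_mult_distrib powr_half_sqrt real_sqrt_pow2 of_nat_0_le_iff)
      then show ?thesis by (simp add: powr_diff mult.commute)
    qed
    finally show ?thesis using dist unfolding S_def u_def by (intro bexI[of _ D] conjI allI) auto
  qed
  show ?thesis using K \<gamma> main by blast
qed

text \<open>A continuous path is the uniform limit of its step interpolations, which are measurable;
  continuity for every outcome makes this a pointwise limit on the whole space.\<close>

lemma limit_path_measurable:
  assumes Zm: "\<And>t. t \<in> {0..1} \<Longrightarrow> Z t \<in> borel_measurable M'"
    and Z_cont: "\<And>\<omega>. \<omega> \<in> space M' \<Longrightarrow> continuous_on {0..1} (\<lambda>t. Z t \<omega>)"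
  shows "(\<lambda>\<omega>. \<lambda>t\<in>{0..1}. Z t \<omega>) \<in> M' \<rightarrow>\<^sub>M borel_of_topology skorokhod01"
proof -
  interpret Metric_space cadlag01 unif_dist01 by (rule Metric_space_cadlag01)
  define V where "V m i \<omega> = (if i \<le> Suc m then Z (real i / real (Suc m)) \<omega> else 0)" for m i \<omega>
  have V: "V m i \<in> borel_measurable M'" for m i
    unfolding V_def using Zm by (cases "i \<le> Suc m") (auto simp: divide_le_eq_1)
  show ?thesis
    unfolding skorokhod01_def
  proof (rule measurable_metric_limit)
    show "(\<lambda>\<omega>. step_path (Suc m) (\<lambda>i. V m i \<omega>)) \<in> M' \<rightarrow>\<^sub>M borel_of_topology mtopology" for m
      using step_path_measurable[of "V m", OF V] by (simp add: skorokhod01_def)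
    show "(\<lambda>t\<in>{0..1}. Z t \<omega>) \<in> cadlag01" if "\<omega> \<in> space M'" for \<omega>
      by (rule continuous_path_cadlag[OF Z_cont[OF that]])
    show "(\<lambda>m. unif_dist01 (step_path (Suc m) (\<lambda>i. V m i \<omega>)) (\<lambda>t\<in>{0..1}. Z t \<omega>)) \<longlonglongrightarrow> 0"
      if "\<omega> \<in> space M'" for \<omega>
    proof -
      have "step_path (Suc m) (\<lambda>i. V m i \<omega>) = step_path (Suc m) (\<lambda>i. Z (real i / real (Suc m)) \<omega>)" for m
        by (rule step_path_cong) (simp add: V_def)
      then show ?thesis using step_path_tendsto_continuous[OF Z_cont[OF that]] by simp
    qed
  qed
qed

theorem theorem1:
  fixes M :: "'a measure" and \<epsilon> :: "int \<Rightarrow> 'a \<Rightarrow> real"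
    and M' :: "'b measure" and B Z :: "real \<Rightarrow> 'b \<Rightarrow> real"
    and k :: nat and d lam H :: real
  assumes k: "k \<ge> 1"
    and lam: "lam > 0"
    and d: "d > 1/2 - 1 / (2 * real k)"
    and H: "H = 1 + real k * d - real k / 2"
    and M: "prob_space M"
    and noise: "prob_space.iid_standardized M \<epsilon>"
    and M': "prob_space M'"
    and B: "prob_space.two_sided_brownian_motion M' B"
    and Z: "tempered_hermite_process M' B k H lam {0..1} Z"
    and Z_cont: "\<And>\<omega>. \<omega> \<in> space M' \<Longrightarrow> continuous_on {0..1} (\<lambda>t. Z t \<omega>)"
  shows "weakly_converges_to skorokhod01
    M (\<lambda>N \<omega>. \<lambda>t\<in>{0..1}. 1 / real N powr H * chaos_partial_sum \<epsilon> d (lam / real N) k N t \<omega>)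
    M' (\<lambda>\<omega>. \<lambda>t\<in>{0..1}. Z t \<omega>)"
proof -
  interpret iid_noise M \<epsilon>
    unfolding iid_noise_def iid_noise_axioms_def using M noise by blast
  interpret M': prob_space M' by fact
  interpret D: Metric_space cadlag01 unif_dist01 by (rule Metric_space_cadlag01)
  let ?S = "\<lambda>N. normalized_sum k H d lam N"
  let ?X = "\<lambda>N \<omega>. step_path N (\<lambda>n. ?S N n \<omega>)"
  let ?Z = "\<lambda>\<omega>. \<lambda>t\<in>{0..1}. Z t \<omega>"
  \<comment> \<open>The partial-sum process is itself a step path, N = 0 included: the sum is then
    empty and both sides are the zero path.\<close>
  have X_eq: "(\<lambda>N \<omega>. \<lambda>t\<in>{0..1}. 1 / real N powr H * chaos_partial_sum \<epsilon> d (lam / real N) k N t \<omega>) = ?X"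
    by (intro ext) (auto simp: step_path_def chaos_partial_sum_def normalized_sum_def restrict_def)
  have X: "?X N \<in> M \<rightarrow>\<^sub>M borel_of_topology skorokhod01" for N
    by (rule step_path_measurable) measurable
  have Zm: "Z t \<in> borel_measurable M'" if "t \<in> {0..1}" for t
    using Z that by (auto simp: tempered_hermite_process_def has_wiener_ito_integral_def square_integrable_def)
  have Zmeas: "?Z \<in> M' \<rightarrow>\<^sub>M borel_of_topology skorokhod01"
    by (rule limit_path_measurable[OF Zm Z_cont])
  obtain K \<gamma> where K: "K > 0" and \<gamma>: "\<gamma> > 1/2"
    and tight: "\<And>m N. m \<ge> 1 \<Longrightarrow> N \<ge> m \<Longrightarrow> \<exists>D\<in>borel_measurable M.
      (\<forall>\<omega>. unif_dist01 (?X N \<omega>) (step_path m (\<lambda>i. ?S N (nat \<lfloor>real N * (real i / real m)\<rfloor>) \<omega>)) \<le> D \<omega>) \<and>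
      mean_sq M D \<le> ennreal ((K * real m powr (1/2 - \<gamma>))\<^sup>2)"
    using discretization_error[OF k H lam d] by metis
  have "weakly_converges_to D.mtopology M ?X M' ?Z"
  proof (rule D.weakly_converges_to_lipschitzI[OF M M'])
    fix f :: "(real \<Rightarrow> real) \<Rightarrow> real" and Bd L0 :: real
    assume Bd: "\<And>x. x \<in> cadlag01 \<Longrightarrow> \<bar>f x\<bar> \<le> Bd"
      and lip0: "\<And>x y. x \<in> cadlag01 \<Longrightarrow> y \<in> cadlag01 \<Longrightarrow> \<bar>f x - f y\<bar> \<le> L0 * unif_dist01 x y"
    define L where "L = max L0 1"
    have L: "L > 0" by (simp add: L_def)
    have lip: "\<bar>f x - f y\<bar> \<le> L * unif_dist01 x y" if "x \<in> cadlag01" "y \<in> cadlag01" for x y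
      by (rule order_trans[OF lip0[OF that]]) (intro mult_right_mono, auto simp: L_def)
    have f [measurable]: "f \<in> borel_measurable (borel_of_topology skorokhod01)"
      unfolding skorokhod01_def by (rule borel_measurable_continuous_map[OF D.continuous_map_lipschitz[OF lip0]])
    note [measurable] = X Zmeas
    have Zc: "?Z \<omega> \<in> cadlag01" if "\<omega> \<in> space M'" for \<omega>
      by (rule continuous_path_cadlag[OF Z_cont[OF that]])
    define z where "z = (\<integral>\<omega>. f (?Z \<omega>) \<partial>M')"
    \<comment> \<open>Coordinates beyond m are set to 0 to match the finite-dimensional statement; a
      step path with m steps does not see them.\<close>
    define zm where "zm m = (\<integral>\<omega>. f (step_path m (\<lambda>i. if i \<le> m then Z (real i / real m) \<omega> else 0)) \<partial>M')" for m
    define xm where "xm m N = expectation (\<lambda>\<omega>. f (step_path m (\<lambda>i. if i \<le> m then ?S N (nat \<lfloor>real N * (real i / real m)\<rfloor>) \<omega> else 0)))" for m N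
    have zm_meas: "(\<lambda>\<omega>. step_path m (\<lambda>i. if i \<le> m then Z (real i / real m) \<omega> else 0)) \<in> M' \<rightarrow>\<^sub>M borel_of_topology skorokhod01" for m
    proof (rule step_path_measurable)
      fix i show "(\<lambda>\<omega>. if i \<le> m then Z (real i / real m) \<omega> else 0) \<in> borel_measurable M'"
        using Zm[of "real i / real m"] by (cases "i \<le> m") (auto simp: divide_le_eq_1)
    qed
    have xm_meas: "(\<lambda>\<omega>. step_path m (\<lambda>i. if i \<le> m then ?S N (nat \<lfloor>real N * (real i / real m)\<rfloor>) \<omega> else 0))
        \<in> M \<rightarrow>\<^sub>M borel_of_topology skorokhod01" for m N
    proof (rule step_path_measurable)
      fix i show "(\<lambda>\<omega>. if i \<le> m then ?S N (nat \<lfloor>real N * (real i / real m)\<rfloor>) \<omega> else 0) \<in> borel_measurable M"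
        by (cases "i \<le> m") auto
    qed
    have zm_lim: "(\<lambda>m. zm (Suc m)) \<longlonglongrightarrow> z"
      unfolding zm_def z_def
    proof (rule integral_dominated_convergence[where w="\<lambda>_. Bd"])
      show "AE \<omega> in M'. (\<lambda>m. f (step_path (Suc m) (\<lambda>i. if i \<le> Suc m then Z (real i / real (Suc m)) \<omega> else 0))) \<longlonglongrightarrow> f (?Z \<omega>)"
      proof (rule AE_I2)
        fix \<omega> assume w: "\<omega> \<in> space M'"
        let ?p = "\<lambda>m. step_path (Suc m) (\<lambda>i. Z (real i / real (Suc m)) \<omega>)"
        have eq: "step_path (Suc m) (\<lambda>i. if i \<le> Suc m then Z (real i / real (Suc m)) \<omega> else 0) = ?p m" for m
          by (rule step_path_cong) simp
        have lim: "(\<lambda>m. L * unif_dist01 (?p m) (?Z \<omega>)) \<longlonglongrightarrow> 0"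
          using tendsto_mult[OF tendsto_const step_path_tendsto_continuous[OF Z_cont[OF w]], of L] by simp
        have "(\<lambda>m. f (?p m) - f (?Z \<omega>)) \<longlonglongrightarrow> 0"
          by (rule Lim_null_comparison[OF _ lim])
            (intro always_eventually allI, simp only: real_norm_def lip[OF step_path_cadlag Zc[OF w]])
        then show "(\<lambda>m. f (step_path (Suc m) (\<lambda>i. if i \<le> Suc m then Z (real i / real (Suc m)) \<omega> else 0))) \<longlonglongrightarrow> f (?Z \<omega>)"
          unfolding eq by (simp add: LIM_zero_iff)
      qed
      show "AE \<omega> in M'. norm (f (step_path (Suc m) (\<lambda>i. if i \<le> Suc m then Z (real i / real (Suc m)) \<omega> else 0))) \<le> Bd" for m
        by (intro AE_I2) (simp only: real_norm_def Bd step_path_cadlag)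
    qed (use zm_meas in \<open>auto intro: measurable_compose[OF _ f]\<close>)
    have xm_lim: "(\<lambda>N. xm m N) \<longlonglongrightarrow> zm m" if m: "m \<ge> 1" for m
    proof -
      have "(\<lambda>N. xm m (Suc N)) \<longlonglongrightarrow> zm m"
        unfolding xm_def zm_def
      proof (rule finite_dimensional_convergence[OF k H lam d M' B Z, where \<phi>="\<lambda>v. f (step_path m v)" and L=L and Bd=Bd])
        show "real i / real m \<in> {0..1}" if "i \<le> m" for i using that m by (simp add: divide_le_eq_1)
        show "\<bar>f (step_path m u) - f (step_path m v)\<bar> \<le> L * (\<Sum>i\<le>m. \<bar>u i - v i\<bar>)" for u v
          using lip[OF step_path_cadlag step_path_cadlag, of m u m v] mult_left_mono[OF unif_dist_step_path[of m u v], of L] L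
          by linarith
      qed (use L Bd step_path_cadlag in auto)
      then show ?thesis by (rule LIMSEQ_imp_Suc)
    qed
    \<comment> \<open>The bound is uniform in N >= m, which allows m to be fixed before N tends to
      infinity.\<close>
    have x_xm: "\<bar>expectation (\<lambda>\<omega>. f (?X N \<omega>)) - xm m N\<bar> \<le> L * (K * real m powr (1/2 - \<gamma>))"
      if m: "m \<ge> 1" "N \<ge> m" for m N
    proof -
      let ?Y = "\<lambda>\<omega>. step_path m (\<lambda>i. if i \<le> m then ?S N (nat \<lfloor>real N * (real i / real m)\<rfloor>) \<omega> else 0)"
      obtain D where D [measurable]: "D \<in> borel_measurable M"
        and XD: "\<And>\<omega>. unif_dist01 (?X N \<omega>) (step_path m (\<lambda>i. ?S N (nat \<lfloor>real N * (real i / real m)\<rfloor>) \<omega>)) \<le> D \<omega>"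
        and ID: "mean_sq M D \<le> ennreal ((K * real m powr (1/2 - \<gamma>))\<^sup>2)"
        using tight[OF m] by blast
      have a: "K * real m powr (1/2 - \<gamma>) > 0" using K m by simp
      note ED = expectation_abs_le_L2[OF D a ID]
      have Y: "?Y \<omega> = step_path m (\<lambda>i. ?S N (nat \<lfloor>real N * (real i / real m)\<rfloor>) \<omega>)" for \<omega>
        by (rule step_path_cong) simp
      have intX: "integrable M (\<lambda>\<omega>. f (?X N \<omega>))"
        by (rule integrable_const_bound[where B=Bd]) (auto intro!: AE_I2 Bd step_path_cadlag measurable_compose[OF X f])
      have intY: "integrable M (\<lambda>\<omega>. f (?Y \<omega>))"
        by (rule integrable_const_bound[where B=Bd]) (auto intro!: AE_I2 Bd step_path_cadlag measurable_compose[OF xm_meas f])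
      have "\<bar>expectation (\<lambda>\<omega>. f (?X N \<omega>)) - xm m N\<bar> = \<bar>expectation (\<lambda>\<omega>. f (?X N \<omega>) - f (?Y \<omega>))\<bar>"
        unfolding xm_def using intX intY by (simp only: Bochner_Integration.integral_diff)
      also have "\<dots> \<le> expectation (\<lambda>\<omega>. \<bar>f (?X N \<omega>) - f (?Y \<omega>)\<bar>)" by (rule integral_abs_bound)
      also have "\<dots> \<le> expectation (\<lambda>\<omega>. L * \<bar>D \<omega>\<bar>)"
      proof (rule integral_mono)
        fix \<omega>
        have "\<bar>f (?X N \<omega>) - f (?Y \<omega>)\<bar> \<le> L * unif_dist01 (?X N \<omega>) (?Y \<omega>)"
          by (rule lip[OF step_path_cadlag step_path_cadlag])
        also have "\<dots> \<le> L * \<bar>D \<omega>\<bar>"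
          unfolding Y using L XD[of \<omega>] by (intro mult_left_mono) auto
        finally show "\<bar>f (?X N \<omega>) - f (?Y \<omega>)\<bar> \<le> L * \<bar>D \<omega>\<bar>" .
      qed (use intX intY ED(1) in \<open>auto intro!: Bochner_Integration.integrable_diff Bochner_Integration.integrable_abs\<close>)
      also have "\<dots> = L * expectation (\<lambda>\<omega>. \<bar>D \<omega>\<bar>)" by simp
      also have "\<dots> \<le> L * (K * real m powr (1/2 - \<gamma>))"
        using ED(2) L by (intro mult_left_mono) auto
      finally show ?thesis .
    qed
    have "(\<lambda>m. L * (K * real (Suc m) powr (1/2 - \<gamma>))) \<longlonglongrightarrow> L * (K * 0)"
    proof (intro tendsto_mult tendsto_const)
      have "filterlim (\<lambda>m. real (Suc m)) at_top sequentially"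
        by (rule filterlim_compose[OF filterlim_real_sequentially filterlim_Suc])
      then show "(\<lambda>m. real (Suc m) powr (1/2 - \<gamma>)) \<longlonglongrightarrow> 0"
        using \<gamma> by (intro tendsto_neg_powr) auto
    qed
    then have small: "(\<lambda>m. L * (K * real (Suc m) powr (1/2 - \<gamma>))) \<longlonglongrightarrow> 0" by simp
    show "(\<lambda>N. expectation (\<lambda>\<omega>. f (?X N \<omega>))) \<longlonglongrightarrow> (\<integral>\<omega>. f (?Z \<omega>) \<partial>M')"
    proof (rule LIMSEQ_I)
      fix r :: real assume r: "r > 0"
      have "eventually (\<lambda>m. \<bar>zm (Suc m) - z\<bar> < r / 3 \<and> L * (K * real (Suc m) powr (1/2 - \<gamma>)) < r / 3) sequentially"
        using tendstoD[OF zm_lim, of "r / 3"] order_tendstoD(2)[OF small, of "r / 3"] r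
        by (intro eventually_conj) (auto simp: dist_real_def)
      then obtain m' where m': "\<bar>zm (Suc m') - z\<bar> < r / 3" "L * (K * real (Suc m') powr (1/2 - \<gamma>)) < r / 3"
        using eventually_happens'[OF sequentially_bot] by blast
      define m where "m = Suc m'"
      have m: "m \<ge> 1" by (simp add: m_def)
      have "eventually (\<lambda>N. \<bar>xm m N - zm m\<bar> < r / 3 \<and> N \<ge> m) sequentially"
        using tendstoD[OF xm_lim[OF m], of "r / 3"] r
        by (intro eventually_conj eventually_ge_at_top) (auto simp: dist_real_def)
      then obtain N0 where N0: "\<And>N. N \<ge> N0 \<Longrightarrow> \<bar>xm m N - zm m\<bar> < r / 3 \<and> N \<ge> m"
        by (auto simp: eventually_sequentially)
      show "\<exists>no. \<forall>N\<ge>no. norm (expectation (\<lambda>\<omega>. f (?X N \<omega>)) - (\<integral>\<omega>. f (?Z \<omega>) \<partial>M')) < r"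
      proof (intro exI allI impI)
        fix N assume "N \<ge> N0"
        then have N: "\<bar>xm m N - zm m\<bar> < r / 3" "N \<ge> m" using N0 by auto
        show "norm (expectation (\<lambda>\<omega>. f (?X N \<omega>)) - (\<integral>\<omega>. f (?Z \<omega>) \<partial>M')) < r"
          using x_xm[OF m N(2)] N(1) m' unfolding m_def[symmetric] z_def[symmetric] real_norm_def by linarith
      qed
    qed
  qed (use X Zmeas in \<open>simp_all add: skorokhod01_def\<close>)
  then show ?thesis unfolding X_eq skorokhod01_def .
qed

end
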